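(* Suppose assumptions (A1)–(A5) of the context hold, fix $\mu\ge\hat\mu$, and suppose the parameters $\eta_1,\eta_2>0$ and $\delta_{\mu,b}$ satisfy $$\eta_1\ge\frac{9}{\eta_2\gamma_G},\qquad\eta_2\le\frac{\gamma_H}{7\hat\Upsilon^2},\qquad\delta_{\mu,b}\le\frac{\eta_2\gamma_G}{17\,\eta_1\hat\Upsilon^2}.$$ Then the iterates of the Fast Overlapping Graph Decomposition (FOGD) method described in the context satisfy $\|\nabla\mathcal L(\boldsymbol x^\tau,\boldsymbol\lambda^\tau)\|\to0$ as $\tau\to\infty$.
   Context: Graph notation. $\mathcal G=(\mathcal V,\mathcal E)$ is a finite undirected graph with strictly ordered node set; $d_{\mathcal G}(i,j)$ is the number of edges of a shortest path between $i$ and $j$, and $d_{\mathcal G}(i,\mathcal W)$ is the distance from $i$ to the set $\mathcal W$. $N^b_{\mathcal G}[\mathcal W]=\{i\in\mathcal V:d_{\mathcal G}(i,\mathcal W)\le b\}$, $N_{\mathcal G}[\mathcal W]=N^1_{\mathcal G}[\mathcal W]$, $N_{\mathcal G}(\mathcal W)=N_{\mathcal G}[\mathcal W]\setminus\mathcal W$, $N_{\mathcal G}[i]=N_{\mathcal G}[\{i\}]$, $[M]=\{1,\dots,M\}$. Problem. The graph-structured nonlinear program is $\min\sum_{i\in\mathcal V}f_i(\{\boldsymbol x_j\}_{j\in N_{\mathcal G}[i]})$ subject to $\boldsymbol c_i(\{\boldsymbol x_j\}_{j\in N_{\mathcal G}[i]})=\boldsymbol 0$, $i\in\mathcal V$,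 with $\boldsymbol x_i\in\mathbb R^{r_i}$, $f_i$ real valued, $\boldsymbol c_i$ valued in $\mathbb R^{m_i}$, and dual variables $\boldsymbol\lambda_i\in\mathbb R^{m_i}$. Put $f=\sum_if_i$, $\boldsymbol c=\{\boldsymbol c_i\}_{i\in\mathcal V}$, $\mathcal L(\boldsymbol x,\boldsymbol\lambda)=f(\boldsymbol x)+\boldsymbol\lambda^T\boldsymbol c(\boldsymbol x)$, $G(\boldsymbol x)=\nabla\boldsymbol c(\boldsymbol x)$ (constraint Jacobian), $H(\boldsymbol x,\boldsymbol\lambda)=\nabla^2_{\boldsymbol x}\mathcal L(\boldsymbol x,\boldsymbol\lambda)$. At iterates $(\boldsymbol x^\tau,\boldsymbol\lambda^\tau)$, $\tau=0,1,\dots$, a superscript $\tau$ denotes evaluation there ($\boldsymbol c^\tau,\nabla\mathcal L^\tau,G^\tau,H^\tau$), and $\hat H^\tau$ is a symmetric structure-preserving modification of $H^\tau$. Vectors and matrices are indexed blockwise by nodes; $A_{i,j}$ is the $(i,j)$-block and $A[\mathcal I][\mathcal J]$ (or $v[\mathcal I]$) the subarray with row indices in $\mathcal I$ and column indices in $\mathcal J$. Thus $H_{i,j}=\hat H^\tau_{i,j}=\boldsymbol0$ if $d_{\mathcal G}(i,j)>2$ and $G_{i,j}=\boldsymbol0$ if $d_{\mathcal G}(i,j)>1$. $\|\cdot\|$ is the Euclidean/spectral norm. Overlapping decomposition. $\{\mathcal V_\ell\}_{\ell\in[M]}$ is a disjoint partition of $\mathcal V$, $b\ge1$ is an integer (overlap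 size), and $\mathcal W_\ell\subseteq\mathcal V$ satisfies $N^b_{\mathcal G}[\mathcal V_\ell]\subseteq\mathcal W_\ell$. Set $\tilde{\mathcal W}_\ell=N_{\mathcal G}(N_{\mathcal G}(\mathcal W_\ell))\cap\mathcal W_\ell$ and $\hat{\mathcal W}_\ell=N_{\mathcal G}(\mathcal W_\ell)\cup\tilde{\mathcal W}_\ell$. FOGD method. Input: initial point $(\boldsymbol x^0,\boldsymbol\lambda^0)$, scalars $\mu,\eta_1,\eta_2>0$, $\beta\in(0,0.5)$. For $\tau=0,1,2,\dots$: (i) for each $\ell\in[M]$ compute the primal-dual solution $(\tilde{\boldsymbol\omega}^*_\ell,\tilde{\boldsymbol\zeta}^*_\ell)$ (unique for $\mu\ge\hat\mu$) of $$\min_{\tilde{\boldsymbol\omega}_\ell}\ \tfrac12\tilde{\boldsymbol\omega}_\ell^T\hat H^\tau[\mathcal W_\ell][\mathcal W_\ell]\tilde{\boldsymbol\omega}_\ell+\tilde{\boldsymbol\omega}_\ell^T\nabla_{\boldsymbol x}\mathcal L^\tau[\mathcal W_\ell]+\tfrac\mu2\|\boldsymbol c^\tau[\hat{\mathcal W}_\ell]+G^\tau[\hat{\mathcal W}_\ell][\mathcal W_\ell]\tilde{\boldsymbol\omega}_\ell\|^2\ \ \text{s.t.}\ \ \boldsymbol c^\tau[\mathcal W_\ell\setminus\tilde{\mathcal W}_\ell]+G^\tau[\mathcal W_\ell\setminus\tilde{\mathcal W}_\ell][\mathcal W_\ell]\tilde{\boldsymbol\omega}_\ell=\boldsymbol0,$$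 where $\tilde{\boldsymbol\omega}_\ell$ is indexed by $\mathcal W_\ell$ and the dual variable $\tilde{\boldsymbol\zeta}_\ell$ by $\mathcal W_\ell\setminus\tilde{\mathcal W}_\ell$; (ii) form $(\tilde\Delta\boldsymbol x^\tau,\tilde\Delta\boldsymbol\lambda^\tau)$: for $k\in\mathcal V$ and the unique $\ell$ with $k\in\mathcal V_\ell$, its components at node $k$ are those of $(\tilde{\boldsymbol\omega}^*_\ell,\tilde{\boldsymbol\zeta}^*_\ell)$ at node $k$; (iii) set $(\boldsymbol x^{\tau+1},\boldsymbol\lambda^{\tau+1})=(\boldsymbol x^\tau,\boldsymbol\lambda^\tau)+\alpha_\tau(\tilde\Delta\boldsymbol x^\tau,\tilde\Delta\boldsymbol\lambda^\tau)$, where $\alpha_\tau$ is found by backtracking line search (start from $\alpha_\tau=1$ and multiply by a fixed factor in $(0,1)$ until accepted) so as to satisfy the Armijo condition $$\mathcal L_\eta(\boldsymbol x^{\tau+1},\boldsymbol\lambda^{\tau+1})\le\mathcal L_\eta(\boldsymbol x^\tau,\boldsymbol\lambda^\tau)+\beta\alpha_\tau\nabla\mathcal L_\eta(\boldsymbol x^\tau,\boldsymbol\lambda^\tau)^T(\tilde\Delta\boldsymbol x^\tau,\tilde\Delta\boldsymbol\lambda^\tau)$$ with the exact augmented Lagrangian $\mathcal L_\eta(\boldsymbol x,\boldsymbol\lambda)=\mathcal L(\boldsymbol x,\boldsymbol\lambda)+\frac{\eta_1}2\|\nabla_{\boldsymbol\lambda}\mathcal L(\boldsymbol x,\boldsymbol\lambda)\|^2+\frac{\eta_2}2\|\nabla_{\boldsymbol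 x}\mathcal L(\boldsymbol x,\boldsymbol\lambda)\|^2$. Assumptions. (A1) For a constant $\gamma_H\in(0,1]$ and all $\tau\ge0$, $\boldsymbol\omega^T\hat H^\tau\boldsymbol\omega\ge\gamma_H\|\boldsymbol\omega\|^2$ whenever $G^\tau\boldsymbol\omega=\boldsymbol0$. (A2) For a constant $\gamma_G\in(0,1]$ and all $\tau\ge0$, $G^\tau(G^\tau)^T\succeq\gamma_GI$. (A3) For a constant $\Upsilon\ge1$, all $\tau\ge0$ and all $i,j\in\mathcal V$, $\max\{\|\hat H^\tau_{i,j}\|,\|H^\tau_{i,j}\|,\|G^\tau_{i,j}\|\}\le\Upsilon$. (A4) There are polynomials $\mathrm{poly}_{\mathcal W},\mathrm{poly}_{\mathcal G}$ such that $d_{\mathcal G}(i,j)\le\mathrm{poly}_{\mathcal W}(b)$ for all $i,j\in\mathcal W_\ell$, $\ell\in[M]$, and $|\{j\in\mathcal V:d_{\mathcal G}(i,j)\le d\}|\le\mathrm{poly}_{\mathcal G}(d)$ for all $i\in\mathcal V$ and any integer $d$. (A5) There is a compact set $\mathcal X\times\Lambda$ with $(\boldsymbol x^\tau+\alpha\tilde\Delta\boldsymbol x^\tau,\boldsymbol\lambda^\tau+\alpha\tilde\Delta\boldsymbol\lambda^\tau)\in\mathcal X\times\Lambda$ for all $\tau\ge0$, $\alpha\in[0,1]$; the functions $f_i,\boldsymbol c_i$ ($i\in\mathcal V$) are thrice continuously differentiable in $\mathcal X\times\Lambda$; and (with the same constant $\Upsilon\ge1$) $\sup_{\boldsymbol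 x\in\mathcal X,\boldsymbol\lambda\in\Lambda}\|H_{i,j}(\boldsymbol x,\boldsymbol\lambda)\|\le\Upsilon$ and $\sup_{\boldsymbol x\in\mathcal X}\|G_{i,j}(\boldsymbol x)\|\le\Upsilon$ for all $i,j\in\mathcal V$. Constants: $\mathrm{poly}_{\mathcal G\circ\mathcal W}(b):=\mathrm{poly}_{\mathcal G}(\mathrm{poly}_{\mathcal W}(b))$, $\hat\Upsilon:=\Upsilon\cdot\mathrm{poly}_{\mathcal G}(1)^2$ (which bounds $\|\hat H^\tau\|,\|H^\tau\|,\|G^\tau\|$ for all $\tau$), $\hat\mu:=4\hat\Upsilon^2/(\gamma_G\gamma_H)$, $\Upsilon_K=1.5\mu\hat\Upsilon^2$, $\gamma_K=\gamma_H^3\gamma_G^2/(75\Upsilon_K^6)$, $\rho_\mu=\big((\Upsilon_K^2-\gamma_K^2)/(\Upsilon_K^2+\gamma_K^2)\big)^{1/4}\in(0,1)$, $\Upsilon_\mu=\Upsilon_K/(\gamma_K^2\rho_\mu^2)$, $\Upsilon_{\mu,b}=\frac{\sqrt2\Upsilon_\mu\Upsilon_K}{\rho_\mu\sqrt{1-\rho_\mu^2}}\mathrm{poly}_{\mathcal G\circ\mathcal W}(b)\{\mathrm{poly}_{\mathcal G}(b+2)\}^{1/2}$, and $\delta_{\mu,b}:=\Upsilon_{\mu,b}\rho_\mu^b$. *)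

theory Defs
  imports "HOL-Analysis.Analysis" "HOL-Computational_Algebra.Polynomial"
begin

section \<open>Graph distance and neighbourhoods\<close>

text \<open>
  An undirected graph is given by its symmetric adjacency relation \<open>E\<close> on a finite node type.
  A shortest walk is a shortest path; nodes in different components have distance \<open>\<infinity>\<close>,
  as does every node from the empty set.
\<close>

definition gdist :: "('v \<times> 'v) set \<Rightarrow> 'v \<Rightarrow> 'v \<Rightarrow> enat" where
  "gdist E i j = (INF n \<in> {n. (i, j) \<in> E ^^ n}. enat n)"

definition gdist_set :: "('v \<times> 'v) set \<Rightarrow> 'v \<Rightarrow> 'v set \<Rightarrow> enat" where
  "gdist_set E i W = (INF j \<in> W. gdist E i j)"

definition closed_nbhd :: "('v \<times> 'v) set \<Rightarrow> nat \<Rightarrow> 'v set \<Rightarrow> 'v set" where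
  "closed_nbhd E b W = {i. gdist_set E i W \<le> enat b}"

definition open_nbhd :: "('v \<times> 'v) set \<Rightarrow> 'v set \<Rightarrow> 'v set" where
  "open_nbhd E W = closed_nbhd E 1 W - W"

text \<open>\<open>W_tilde E W\<close> and \<open>W_hat E W\<close> are the sets written
  $\tilde{\mathcal W}$ and $\hat{\mathcal W}$ in the overlapping decomposition.\<close>

definition W_tilde :: "('v \<times> 'v) set \<Rightarrow> 'v set \<Rightarrow> 'v set" where
  "W_tilde E W = open_nbhd E (open_nbhd E W) \<inter> W"

definition W_hat :: "('v \<times> 'v) set \<Rightarrow> 'v set \<Rightarrow> 'v set" where
  "W_hat E W = open_nbhd E W \<union> W_tilde E W"

section \<open>Vectors and matrices indexed blockwise by nodes\<close>

text \<open>
  A vector whose block at node \<open>i\<close> lies in $\mathbb{R}^{r_i}$ is an element of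
  \<open>real ^ 'k\<close> together with a map \<open>nd :: 'k \<Rightarrow> 'v\<close> that sends every scalar
  coordinate to the node owning it; thus $r_i$ is the number of \<open>k\<close> with \<open>nd k = i\<close>
  (it may be 0 and may vary with \<open>i\<close>).  The subarrays $v[\mathcal I]$ and
  $A[\mathcal I][\mathcal J]$ are represented with zeros outside the selected blocks, which changes
  neither Euclidean and spectral norms nor products of conforming subarrays.
\<close>

definition subvec :: "('k \<Rightarrow> 'v) \<Rightarrow> 'v set \<Rightarrow> real ^ 'k::finite \<Rightarrow> real ^ 'k" where
  "subvec nd I v = (\<chi> k. if nd k \<in> I then v $ k else 0)"

definition submat ::
  "('m \<Rightarrow> 'v) \<Rightarrow> ('n \<Rightarrow> 'v) \<Rightarrow> 'v set \<Rightarrow> 'v set \<Rightarrow> real ^ 'n::finite ^ 'm::finite \<Rightarrow> real ^ 'n ^ 'm" where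
  "submat rn cn I J A = (\<chi> k l. if rn k \<in> I \<and> cn l \<in> J then A $ k $ l else 0)"

definition spectral_norm :: "real ^ 'n::finite ^ 'm::finite \<Rightarrow> real" where
  "spectral_norm A = onorm ((*v) A)"

definition block_norm ::
  "('m \<Rightarrow> 'v) \<Rightarrow> ('n \<Rightarrow> 'v) \<Rightarrow> 'v \<Rightarrow> 'v \<Rightarrow> real ^ 'n::finite ^ 'm::finite \<Rightarrow> real" where
  "block_norm rn cn i j A = spectral_norm (submat rn cn {i} {j} A)"

definition depends_only_on :: "('k \<Rightarrow> 'v) \<Rightarrow> 'v set \<Rightarrow> (real ^ 'k::finite \<Rightarrow> 'b) \<Rightarrow> bool" where
  "depends_only_on nd I g \<longleftrightarrow> (\<forall>x y. (\<forall>k. nd k \<in> I \<longrightarrow> x $ k = y $ k) \<longrightarrow> g x = g y)"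

section \<open>Gradients and smoothness\<close>

definition grad :: "('a::euclidean_space \<Rightarrow> real) \<Rightarrow> 'a \<Rightarrow> 'a" where
  "grad g z = (\<Sum>b\<in>Basis. frechet_derivative g (at z) b *\<^sub>R b)"

text \<open>\<open>k\<close>-fold continuous differentiability; to be used with \<open>S\<close> open.\<close>

fun Ck_on :: "nat \<Rightarrow> 'a set \<Rightarrow> ('a::real_normed_vector \<Rightarrow> 'b::real_normed_vector) \<Rightarrow> bool" where
  "Ck_on 0 S g \<longleftrightarrow> continuous_on S g"
| "Ck_on (Suc k) S g \<longleftrightarrow>
     (\<forall>x\<in>S. g differentiable (at x)) \<and> (\<forall>v. Ck_on k S (\<lambda>x. frechet_derivative g (at x) v))"

section \<open>The nonlinear program\<close>

text \<open>
  The objective is the sum of the \<open>f i\<close>; \<open>c\<close> stacks all constraint blocks, so that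
  $c_i(x)$ is \<open>subvec dn {i} (c x)\<close> for the node map \<open>dn\<close> of the dual coordinates.
\<close>

definition Lagr ::
  "('v::finite \<Rightarrow> real ^ 'p::finite \<Rightarrow> real) \<Rightarrow> (real ^ 'p \<Rightarrow> real ^ 'd::finite)
    \<Rightarrow> real ^ 'p \<Rightarrow> real ^ 'd \<Rightarrow> real" where
  "Lagr f c x lam = (\<Sum>i\<in>UNIV. f i x) + lam \<bullet> c x"

definition grad_x_Lagr ::
  "('v::finite \<Rightarrow> real ^ 'p::finite \<Rightarrow> real) \<Rightarrow> (real ^ 'p \<Rightarrow> real ^ 'd::finite)
    \<Rightarrow> real ^ 'p \<Rightarrow> real ^ 'd \<Rightarrow> real ^ 'p" where
  "grad_x_Lagr f c x lam = grad (\<lambda>y. Lagr f c y lam) x"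

definition grad_lam_Lagr ::
  "('v::finite \<Rightarrow> real ^ 'p::finite \<Rightarrow> real) \<Rightarrow> (real ^ 'p \<Rightarrow> real ^ 'd::finite)
    \<Rightarrow> real ^ 'p \<Rightarrow> real ^ 'd \<Rightarrow> real ^ 'd" where
  "grad_lam_Lagr f c x lam = grad (\<lambda>l. Lagr f c x l) lam"

definition con_jac :: "(real ^ 'p::finite \<Rightarrow> real ^ 'd::finite) \<Rightarrow> real ^ 'p \<Rightarrow> real ^ 'p ^ 'd" where
  "con_jac c x = jacobian c (at x)"

definition Lagr_hess ::
  "('v::finite \<Rightarrow> real ^ 'p::finite \<Rightarrow> real) \<Rightarrow> (real ^ 'p \<Rightarrow> real ^ 'd::finite)
    \<Rightarrow> real ^ 'p \<Rightarrow> real ^ 'd \<Rightarrow> real ^ 'p ^ 'p" where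
  "Lagr_hess f c x lam = jacobian (\<lambda>y. grad_x_Lagr f c y lam) (at x)"

definition aug_Lagr ::
  "('v::finite \<Rightarrow> real ^ 'p::finite \<Rightarrow> real) \<Rightarrow> (real ^ 'p \<Rightarrow> real ^ 'd::finite)
    \<Rightarrow> real \<Rightarrow> real \<Rightarrow> (real ^ 'p) \<times> (real ^ 'd) \<Rightarrow> real" where
  "aug_Lagr f c \<eta>1 \<eta>2 = (\<lambda>(x, lam). Lagr f c x lam
      + \<eta>1 / 2 * (norm (grad_lam_Lagr f c x lam))\<^sup>2
      + \<eta>2 / 2 * (norm (grad_x_Lagr f c x lam))\<^sup>2)"

section \<open>The FOGD method\<close>

text \<open>
  Data of the subproblem on the overlapping subdomain \<open>W\<close>: node maps \<open>pn\<close>, \<open>dn\<close> of the primal and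
  dual coordinates, modified Hessian \<open>Hh\<close>, Jacobian \<open>G\<close>, gradient \<open>g\<close> of the Lagrangian in the
  primal variable and constraint value \<open>cv\<close> at the current iterate.
\<close>

definition sub_obj ::
  "('v \<times> 'v) set \<Rightarrow> ('p \<Rightarrow> 'v) \<Rightarrow> ('d \<Rightarrow> 'v) \<Rightarrow> real \<Rightarrow> 'v set
    \<Rightarrow> real ^ 'p ^ 'p \<Rightarrow> real ^ 'p ^ 'd \<Rightarrow> real ^ 'p::finite \<Rightarrow> real ^ 'd::finite
    \<Rightarrow> real ^ 'p \<Rightarrow> real" where
  "sub_obj E pn dn \<mu> W Hh G g cv w =
      1 / 2 * (w \<bullet> (submat pn pn W W Hh *v w)) + w \<bullet> subvec pn W g
      + \<mu> / 2 * (norm (subvec dn (W_hat E W) cv + submat dn pn (W_hat E W) W G *v w))\<^sup>2"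

definition sub_con ::
  "('v \<times> 'v) set \<Rightarrow> ('p \<Rightarrow> 'v) \<Rightarrow> ('d \<Rightarrow> 'v) \<Rightarrow> 'v set
    \<Rightarrow> real ^ 'p ^ 'd \<Rightarrow> real ^ 'd::finite \<Rightarrow> real ^ 'p::finite \<Rightarrow> real ^ 'd" where
  "sub_con E pn dn W G cv w =
      subvec dn (W - W_tilde E W) cv + submat dn pn (W - W_tilde E W) W G *v w"

text \<open>
  \<open>(w, z)\<close> is a primal-dual solution: \<open>w\<close> is indexed by \<open>W\<close> and is a constrained minimizer,
  \<open>z\<close> is indexed by \<open>W - W_tilde E W\<close>, and the Lagrangian of the subproblem with multiplier \<open>z\<close>
  is stationary at \<open>w\<close>.  (That Lagrangian only involves the coordinates of nodes in \<open>W\<close>, so its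
  gradient on the full space vanishes outside \<open>W\<close> anyway.)
\<close>

definition sub_solution ::
  "('v \<times> 'v) set \<Rightarrow> ('p \<Rightarrow> 'v) \<Rightarrow> ('d \<Rightarrow> 'v) \<Rightarrow> real \<Rightarrow> 'v set
    \<Rightarrow> real ^ 'p ^ 'p \<Rightarrow> real ^ 'p ^ 'd \<Rightarrow> real ^ 'p::finite \<Rightarrow> real ^ 'd::finite
    \<Rightarrow> real ^ 'p \<Rightarrow> real ^ 'd \<Rightarrow> bool" where
  "sub_solution E pn dn \<mu> W Hh G g cv w z \<longleftrightarrow>
      subvec pn W w = w \<and> subvec dn (W - W_tilde E W) z = z
      \<and> sub_con E pn dn W G cv w = 0
      \<and> (\<forall>w'. subvec pn W w' = w' \<and> sub_con E pn dn W G cv w' = 0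
            \<longrightarrow> sub_obj E pn dn \<mu> W Hh G g cv w \<le> sub_obj E pn dn \<mu> W Hh G g cv w')
      \<and> grad (\<lambda>u. sub_obj E pn dn \<mu> W Hh G g cv u + z \<bullet> sub_con E pn dn W G cv u) w = 0"

definition armijo ::
  "('a::euclidean_space \<Rightarrow> real) \<Rightarrow> real \<Rightarrow> 'a \<Rightarrow> 'a \<Rightarrow> real \<Rightarrow> bool" where
  "armijo \<phi> \<beta> z dz a \<longleftrightarrow> \<phi> (z + a *\<^sub>R dz) \<le> \<phi> z + \<beta> * a * (grad \<phi> z \<bullet> dz)"

text \<open>
  Step size found by backtracking from 1 with factor \<open>\<kappa>\<close>: the first accepted trial step.
  (The value is unspecified if no trial step is ever accepted; that this does not happen is not
  assumed in the theorem.)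
\<close>

definition backtrack ::
  "('a::euclidean_space \<Rightarrow> real) \<Rightarrow> real \<Rightarrow> real \<Rightarrow> 'a \<Rightarrow> 'a \<Rightarrow> real" where
  "backtrack \<phi> \<beta> \<kappa> z dz = \<kappa> ^ (LEAST n. armijo \<phi> \<beta> z dz (\<kappa> ^ n))"

section \<open>Constants\<close>

definition Ups_hat :: "real \<Rightarrow> real poly \<Rightarrow> real" where
  "Ups_hat \<Upsilon> pG = \<Upsilon> * (poly pG 1)\<^sup>2"

definition mu_hat :: "real \<Rightarrow> real \<Rightarrow> real \<Rightarrow> real poly \<Rightarrow> real" where
  "mu_hat \<gamma>H \<gamma>G \<Upsilon> pG = 4 * (Ups_hat \<Upsilon> pG)\<^sup>2 / (\<gamma>G * \<gamma>H)"

definition Ups_K :: "real \<Rightarrow> real \<Rightarrow> real poly \<Rightarrow> real" where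
  "Ups_K \<mu> \<Upsilon> pG = 1.5 * \<mu> * (Ups_hat \<Upsilon> pG)\<^sup>2"

definition gam_K :: "real \<Rightarrow> real \<Rightarrow> real \<Rightarrow> real \<Rightarrow> real poly \<Rightarrow> real" where
  "gam_K \<mu> \<gamma>H \<gamma>G \<Upsilon> pG = \<gamma>H ^ 3 * \<gamma>G\<^sup>2 / (75 * Ups_K \<mu> \<Upsilon> pG ^ 6)"

definition rho_mu :: "real \<Rightarrow> real \<Rightarrow> real \<Rightarrow> real \<Rightarrow> real poly \<Rightarrow> real" where
  "rho_mu \<mu> \<gamma>H \<gamma>G \<Upsilon> pG =
     (((Ups_K \<mu> \<Upsilon> pG)\<^sup>2 - (gam_K \<mu> \<gamma>H \<gamma>G \<Upsilon> pG)\<^sup>2)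
       / ((Ups_K \<mu> \<Upsilon> pG)\<^sup>2 + (gam_K \<mu> \<gamma>H \<gamma>G \<Upsilon> pG)\<^sup>2)) powr (1 / 4)"

definition Ups_mu :: "real \<Rightarrow> real \<Rightarrow> real \<Rightarrow> real \<Rightarrow> real poly \<Rightarrow> real" where
  "Ups_mu \<mu> \<gamma>H \<gamma>G \<Upsilon> pG =
     Ups_K \<mu> \<Upsilon> pG / ((gam_K \<mu> \<gamma>H \<gamma>G \<Upsilon> pG)\<^sup>2 * (rho_mu \<mu> \<gamma>H \<gamma>G \<Upsilon> pG)\<^sup>2)"

definition Ups_mu_b ::
  "real \<Rightarrow> nat \<Rightarrow> real \<Rightarrow> real \<Rightarrow> real \<Rightarrow> real poly \<Rightarrow> real poly \<Rightarrow> real" where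
  "Ups_mu_b \<mu> b \<gamma>H \<gamma>G \<Upsilon> pW pG =
     sqrt 2 * Ups_mu \<mu> \<gamma>H \<gamma>G \<Upsilon> pG * Ups_K \<mu> \<Upsilon> pG
       / (rho_mu \<mu> \<gamma>H \<gamma>G \<Upsilon> pG * sqrt (1 - (rho_mu \<mu> \<gamma>H \<gamma>G \<Upsilon> pG)\<^sup>2))
     * poly pG (poly pW (real b)) * sqrt (poly pG (real (b + 2)))"

definition delta_mu_b ::
  "real \<Rightarrow> nat \<Rightarrow> real \<Rightarrow> real \<Rightarrow> real \<Rightarrow> real poly \<Rightarrow> real poly \<Rightarrow> real" where
  "delta_mu_b \<mu> b \<gamma>H \<gamma>G \<Upsilon> pW pG =
     Ups_mu_b \<mu> b \<gamma>H \<gamma>G \<Upsilon> pW pG * rho_mu \<mu> \<gamma>H \<gamma>G \<Upsilon> pG ^ b"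

section \<open>Polynomial growth of the subdomains and of the graph\<close>

text \<open>
  The cardinality bound is required for the integers \<open>d \<ge> 0\<close> and for \<open>d = poly pW b\<close>.  The latter
  is the argument at which \<open>poly pG\<close> enters \<open>Ups_mu_b\<close>, where it has to bound the size of the
  subdomains; it is an integer in the intended reading, but a general real polynomial need not
  take an integer value there (nor be monotone).
\<close>

definition polynomial_growth ::
  "('v \<times> 'v) set \<Rightarrow> nat \<Rightarrow> nat \<Rightarrow> (nat \<Rightarrow> 'v set) \<Rightarrow> real poly \<Rightarrow> real poly \<Rightarrow> bool" where
  "polynomial_growth E b M W pW pG \<longleftrightarrow>
     (\<forall>l\<in>{1..M}. \<forall>i\<in>W l. \<forall>j\<in>W l. ereal_of_enat (gdist E i j) \<le> ereal (poly pW (real b)))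
     \<and> (\<forall>i. \<forall>d. d \<in> \<nat> \<or> d = poly pW (real b) \<longrightarrow>
           real (card {j. ereal_of_enat (gdist E i j) \<le> ereal d}) \<le> poly pG d)"

end

theory Submission
  imports Defs
begin

text \<open>
  The error of the solution on \<open>W\<close> against the exact Newton direction \<open>\<Delta>\<close> solves the KKT system \<open>K\<close> of
  the subproblem with a right-hand side \<open>r\<close> that lives within distance 2 of the complement of \<open>W\<close>.
  On the relevant subspace \<open>T = 1 - 2 / (\<Upsilon>\<^sub>K\<^sup>2 + \<gamma>\<^sub>K\<^sup>2) K\<^sup>2\<close> is a contraction with factor
  \<open>\<rho>\<^sup>4\<close>, while \<open>K\<close> has bandwidth 2, so on \<open>V\<close>, which has distance more than \<open>b\<close> from that complement, the
  error is damped by about \<open>\<rho>\<^sup>b\<close>.  Every node is close to few subdomains, so that summation yields a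
  direction within \<open>\<delta> \<parallel>\<Delta>\<parallel>\<close> of \<open>\<Delta>\<close>.  The exact direction decreases the augmented Lagrangian at rate
  at least \<open>\<eta>2 \<gamma>G / 8 \<parallel>\<Delta>\<parallel>\<^sup>2\<close>, and half of this survives the perturbation.  Backtracking on a
  compact set then forces \<open>\<parallel>\<Delta>\<parallel> \<longlonglongrightarrow> 0\<close>, and \<open>\<parallel>\<nabla>L\<parallel>\<close> is bounded by a multiple of \<open>\<parallel>\<Delta>\<parallel>\<close>.
\<close>

section \<open>Symmetric operators and saddle point systems\<close>

text \<open>The obstacle is that (A1) and (A2) concern the whole graph, while a subproblem sees only
  \<open>W\<close>. They carry over because no row of \<open>G\<close> that can meet a column in
  \<open>W\<close> is dropped: it is a hard constraint if all nodes within distance 1 of its node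
  lie in \<open>W\<close>, and is penalised otherwise. For \<mu> \<ge> \<open>mu_hat\<close> the
  penalty turns positivity on the kernel of \<open>G\<close> into positivity everywhere, which
  survives restriction to vectors supported in \<open>W\<close>. Multipliers sit on interior nodes,
  from which \<open>transpose G\<close> does not lead out of \<open>W\<close>, so (A2) applies to
  them untruncated. The exact direction has zero linearised constraint residual, so the penalty adds
  no error; only truncation at the boundary does. A KKT matrix is indefinite, and its square is used
  to obtain a positive spectrum. One step of \<open>T\<close> therefore spreads supports by 4, which
  is why \<open>rho_mu\<close> is a fourth root. The bound on \<open>delta_mu_b\<close> compares the
  descent rate with the size of the gradient of the augmented Lagrangian, which is dominated by its
  \<eta>1 term.\<close>

lemma selfadjoint_norm_bound_on_subspace:
  fixes T :: "'a::real_inner \<Rightarrow> 'a"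
  assumes lin: "linear T" and S: "subspace S" and inv: "\<And>s. s \<in> S \<Longrightarrow> T s \<in> S"
    and sa: "\<And>s t. s \<in> S \<Longrightarrow> t \<in> S \<Longrightarrow> T s \<bullet> t = s \<bullet> T t"
    and q: "\<And>s. s \<in> S \<Longrightarrow> \<bar>s \<bullet> T s\<bar> \<le> r * (norm s)\<^sup>2"
    and s: "s \<in> S"
  shows "norm (T s) \<le> r * norm s"
proof (cases "s = 0 \<or> T s = 0")
  case True
  have "0 \<le> r * norm s"
  proof (cases "s = 0")
    case False
    have "0 \<le> r * (norm s)\<^sup>2" using q[OF s] by linarith
    then show ?thesis using False by (simp add: zero_le_mult_iff)
  qed simp
  then show ?thesis using True linear_0[OF lin] by auto
next
  case False
  \<comment> \<open>Polarisation is tested against the vector along \<open>T s\<close> with the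
    length of \<open>s\<close>: then \<open>T s \<bullet> t\<close> is
    \<open>norm s * norm (T s)\<close>, and the parallelogram law closes the estimate with the
    constant \<open>r\<close>.\<close>
  define t where "t = (norm s / norm (T s)) *\<^sub>R T s"
  have t: "t \<in> S" using S inv[OF s] by (simp add: t_def subspace_scale)
  have nt: "norm t = norm s" using False by (simp add: t_def)
  have "4 * (T s \<bullet> t) = (s + t) \<bullet> T (s + t) - (s - t) \<bullet> T (s - t)"
    using sa[OF s t] by (simp add: linear_add[OF lin] linear_diff[OF lin] inner_commute algebra_simps)
  also have "\<dots> \<le> r * (norm (s + t))\<^sup>2 + r * (norm (s - t))\<^sup>2"
    using q[of "s + t"] q[of "s - t"] S s t by (smt (verit) subspace_add subspace_diff)
  also have "\<dots> = r * (2 * (norm s)\<^sup>2 + 2 * (norm t)\<^sup>2)"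
    by (simp add: power2_norm_eq_inner algebra_simps inner_commute)
  finally have "T s \<bullet> t \<le> r * (norm s)\<^sup>2" by (simp add: nt)
  moreover have "T s \<bullet> t = norm s * norm (T s)"
    using False by (simp add: t_def power2_norm_eq_inner[symmetric] power2_eq_square)
  ultimately have "norm s * norm (T s) \<le> norm s * (r * norm s)"
    by (simp add: power2_eq_square mult_ac)
  then show ?thesis using False by (simp add: mult_le_cancel_left)
qed

text \<open>On \<open>S\<close> the form of \<open>K\<^sup>2\<close> lies between
  \<open>\<gamma>\<^sup>2\<close> and \<open>U\<^sup>2\<close>, and
  \<open>2 / (U\<^sup>2 + \<gamma>\<^sup>2)\<close> is the Richardson step that sends these
  endpoints to opposite values \<open>r\<close> and \<open>- r\<close>. Only
  \<open>K\<^sup>2\<close> enters, so an indefinite \<open>K\<close> is harmless.\<close>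

lemma selfadjoint_residual_contraction:
  fixes K :: "'a::real_inner \<Rightarrow> 'a"
  assumes lin: "linear K" and S: "subspace S" and inv: "\<And>s. s \<in> S \<Longrightarrow> K s \<in> S"
    and sa: "\<And>s t. K s \<bullet> t = s \<bullet> K t"
    and lo: "\<And>s. s \<in> S \<Longrightarrow> \<gamma> * norm s \<le> norm (K s)"
    and up: "\<And>s. norm (K s) \<le> U * norm s"
    and pos: "0 < \<gamma>" "0 < U" and s: "s \<in> S"
  shows "norm (s - (2 / (U\<^sup>2 + \<gamma>\<^sup>2)) *\<^sub>R K (K s)) \<le> (U\<^sup>2 - \<gamma>\<^sup>2) / (U\<^sup>2 + \<gamma>\<^sup>2) * norm s"
proof -
  define c where "c = 2 / (U\<^sup>2 + \<gamma>\<^sup>2)"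
  define r where "r = (U\<^sup>2 - \<gamma>\<^sup>2) / (U\<^sup>2 + \<gamma>\<^sup>2)"
  have den: "0 < U\<^sup>2 + \<gamma>\<^sup>2" using pos by (simp add: add_pos_pos)
  have c0: "0 < c" using den by (simp add: c_def)
  have cU: "1 - c * U\<^sup>2 = - r" and cg: "1 - c * \<gamma>\<^sup>2 = r"
    using less_imp_neq[OF den] unfolding c_def r_def
    by (simp_all add: eq_divide_eq divide_eq_eq diff_divide_eq_iff flip: minus_divide_left)
  define T where "T = (\<lambda>s. s - c *\<^sub>R K (K s))"
  have T_lin: "linear T"
    unfolding T_def using lin
    by (intro linear_compose_sub linear_compose_scale_right linear_ident)
       (auto simp: o_def dest: linear_compose[OF lin])
  have "norm (T s) \<le> r * norm s"
  proof (rule selfadjoint_norm_bound_on_subspace[OF T_lin S _ _ _ s])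
    show "T s \<in> S" if "s \<in> S" for s using that S inv by (simp add: T_def subspace_diff subspace_scale)
    show "T s \<bullet> t = s \<bullet> T t" for s t by (simp add: T_def inner_diff sa)
    show "\<bar>s \<bullet> T s\<bar> \<le> r * (norm s)\<^sup>2" if "s \<in> S" for s
    proof -
      have e: "s \<bullet> T s = (norm s)\<^sup>2 - c * (norm (K s))\<^sup>2"
        by (simp add: T_def inner_diff sa[symmetric] power2_norm_eq_inner)
      have 1: "(\<gamma> * norm s)\<^sup>2 \<le> (norm (K s))\<^sup>2"
        using lo[OF that] pos by (intro power_mono) auto
      have 2: "(norm (K s))\<^sup>2 \<le> (U * norm s)\<^sup>2" using up by (intro power_mono) auto
      have "s \<bullet> T s \<le> (norm s)\<^sup>2 - c * (\<gamma> * norm s)\<^sup>2"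
        unfolding e using mult_left_mono[OF 1, of c] c0 by linarith
      also have "\<dots> = (1 - c * \<gamma>\<^sup>2) * (norm s)\<^sup>2" by (simp add: power_mult_distrib algebra_simps)
      finally have a: "s \<bullet> T s \<le> r * (norm s)\<^sup>2" by (simp add: cg)
      have "(1 - c * U\<^sup>2) * (norm s)\<^sup>2 = (norm s)\<^sup>2 - c * (U * norm s)\<^sup>2"
        by (simp add: power_mult_distrib algebra_simps)
      also have "\<dots> \<le> s \<bullet> T s"
        unfolding e using mult_left_mono[OF 2, of c] c0 by linarith
      finally have "- r * (norm s)\<^sup>2 \<le> s \<bullet> T s" by (simp only: cU)
      with a show ?thesis by linarith
    qed
  qed
  then show ?thesis by (simp add: T_def c_def r_def)
qed

text \<open>Iterating \<open>e = T e + c K (K e)\<close> with \<open>T = 1 - c K\<^sup>2\<close> expresses \<open>e\<close> as \<open>T\<^sup>q e\<close> plus terms that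
  are polynomial in \<open>K\<close> of degree at most \<open>2 q - 1\<close> applied to \<open>K e\<close>; a banded \<open>K\<close> cannot propagate
  these further than the bandwidth allows.\<close>

lemma decay_of_banded_solution:
  fixes K P :: "'a::real_inner \<Rightarrow> 'a"
  assumes lin: "linear K" and S: "subspace S" and inv: "\<And>s. s \<in> S \<Longrightarrow> K s \<in> S"
    and sa: "\<And>s t. K s \<bullet> t = s \<bullet> K t"
    and lo: "\<And>s. s \<in> S \<Longrightarrow> \<gamma> * norm s \<le> norm (K s)"
    and up: "\<And>s. norm (K s) \<le> U * norm s"
    and pos: "0 < \<gamma>" "\<gamma> \<le> U"
    and P_lin: "linear P" and P_le: "\<And>s. norm (P s) \<le> norm s"
    and e: "e \<in> S"
    and far: "\<And>k. k < q \<Longrightarrow>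
      P (((\<lambda>s. s - (2 / (U\<^sup>2 + \<gamma>\<^sup>2)) *\<^sub>R K (K s)) ^^ k) (K (K e))) = 0"
  shows "norm (P e) \<le> ((U\<^sup>2 - \<gamma>\<^sup>2) / (U\<^sup>2 + \<gamma>\<^sup>2)) ^ q * (norm (K e) / \<gamma>)"
proof -
  define c where "c = 2 / (U\<^sup>2 + \<gamma>\<^sup>2)"
  define T where "T = (\<lambda>s. s - c *\<^sub>R K (K s))"
  define r where "r = (U\<^sup>2 - \<gamma>\<^sup>2) / (U\<^sup>2 + \<gamma>\<^sup>2)"
  have U: "0 < U" using pos by linarith
  have r0: "0 \<le> r" unfolding r_def using pos by (intro divide_nonneg_nonneg) auto
  have T_lin: "linear T"
    unfolding T_def using lin
    by (intro linear_compose_sub linear_compose_scale_right linear_ident)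
       (auto simp: o_def dest: linear_compose[OF lin])
  have T_inv: "T s \<in> S" if "s \<in> S" for s
    using that S inv by (simp add: T_def subspace_diff subspace_scale)
  have Tk: "(T ^^ k) e \<in> S \<and> norm ((T ^^ k) e) \<le> r ^ k * norm e" for k
  proof (induction k)
    case (Suc k)
    have "norm (T ((T ^^ k) e)) \<le> r * norm ((T ^^ k) e)"
      unfolding T_def c_def r_def
      by (rule selfadjoint_residual_contraction[OF lin S inv sa lo up pos(1) U])
         (use Suc in \<open>auto simp: T_def c_def r_def\<close>)
    also have "\<dots> \<le> r * (r ^ k * norm e)" using Suc r0 by (intro mult_left_mono) auto
    finally show ?case using Suc T_inv by (simp add: mult_ac)
  qed (simp add: e)
  have T_pow_lin: "linear (T ^^ k)" for k
    by (induction k) (auto simp: linear_id[unfolded id_def] o_def intro: linear_compose[OF _ T_lin, unfolded o_def])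
  \<comment> \<open>This is an identity under \<open>P\<close> only: the increments need not vanish,
    but \<open>far\<close> makes them invisible to \<open>P\<close> while
    \<open>k < q\<close>.\<close>
  have "P e = P ((T ^^ k) e)" if "k \<le> q" for k
    using that
  proof (induction k)
    case (Suc k)
    have "(T ^^ Suc k) e = (T ^^ k) (e - c *\<^sub>R K (K e))"
      by (simp add: funpow_swap1) (simp add: T_def)
    also have "\<dots> = (T ^^ k) e - c *\<^sub>R (T ^^ k) (K (K e))"
      using T_pow_lin[of k] by (simp add: linear_diff linear_scale)
    finally have "(T ^^ Suc k) e = (T ^^ k) e - c *\<^sub>R (T ^^ k) (K (K e))" .
    then have "P ((T ^^ Suc k) e) = P ((T ^^ k) e) - c *\<^sub>R P ((T ^^ k) (K (K e)))"
      by (simp add: linear_diff[OF P_lin] linear_scale[OF P_lin] del: funpow.simps)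
    also have "P ((T ^^ k) (K (K e))) = 0" using far[of k] Suc.prems by (simp add: T_def c_def)
    finally show ?case using Suc by simp
  qed simp
  from this[of q] have "norm (P e) \<le> norm ((T ^^ q) e)" using P_le by simp
  also have "\<dots> \<le> r ^ q * norm e" using Tk by blast
  also have "\<dots> \<le> r ^ q * (norm (K e) / \<gamma>)"
    using lo[OF e] pos r0 by (intro mult_left_mono) (auto simp: field_simps)
  finally show ?thesis by (simp add: r_def)
qed

text \<open>Abstract stability of a penalised saddle point system with image \<open>(r, s)\<close>
  of \<open>(p, q)\<close>. \<open>A1\<close> is the first row tested with \<open>p\<close>,
  combined with coercivity of the penalised Hessian; \<open>A2\<close> is an inf-sup bound for
  \<open>q\<close>. By \<open>sU\<close> the term \<open>\<mu> * (norm s)\<^sup>2\<close> is at most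
  \<open>norm s * (U * norm p)\<close>, so \<mu> does not enter the constant separately from
  \<open>U\<close>.\<close>

lemma saddle_point_lower_bound:
  fixes p r :: "'a::real_inner" and q s :: "'b::real_inner"
  assumes A1: "\<gamma>H / 2 * (norm p)\<^sup>2 \<le> p \<bullet> r + \<mu> * (norm s)\<^sup>2 - q \<bullet> s"
    and A2: "sqrt \<gamma>G * norm q \<le> norm r + U * norm p"
    and mu: "0 \<le> \<mu>" and sU: "\<mu> * norm s \<le> U * norm p"
    and g: "0 < \<gamma>H" "\<gamma>H \<le> 1" "0 < \<gamma>G" "\<gamma>G \<le> 1" and U: "1 \<le> U"
  shows "\<gamma>H * \<gamma>G\<^sup>2 / (17 * U\<^sup>2) * norm (p, q) \<le> norm (r, s)"
proof -
  define n where "n = norm (r, s)"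
  have n0: "0 \<le> n" by (simp add: n_def)
  have rn: "norm r \<le> n" and sn: "norm s \<le> n"
    unfolding n_def by (auto simp: norm_Pair intro: real_le_rsqrt)
  have gs: "\<gamma>G \<le> sqrt \<gamma>G" using g by (intro real_le_rsqrt) (simp add: power2_eq_square mult_left_le)
  have q1: "\<gamma>G * norm q \<le> n + U * norm p"
    using mult_right_mono[OF gs norm_ge_zero[of q]] A2 rn by linarith
  have a: "p \<bullet> r \<le> norm p * n"
    using norm_cauchy_schwarz[of p r] mult_left_mono[OF rn norm_ge_zero[of p]] by linarith
  have "\<mu> * (norm s)\<^sup>2 = norm s * (\<mu> * norm s)" by (simp add: power2_eq_square)
  also have "\<dots> \<le> n * (U * norm p)" using sn sU mu n0 by (intro mult_mono[OF sn sU]) auto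
  finally have b: "\<mu> * (norm s)\<^sup>2 \<le> n * (U * norm p)" .
  have c: "- (q \<bullet> s) \<le> norm q * n"
    using Cauchy_Schwarz_ineq2[of q s] mult_left_mono[OF sn norm_ge_zero[of q]] by linarith
  have "\<gamma>H / 2 * (norm p)\<^sup>2 \<le> norm p * n + n * (U * norm p) + norm q * n"
    using A1 a b c by linarith
  then have "\<gamma>G * (\<gamma>H / 2 * (norm p)\<^sup>2) \<le> \<gamma>G * (norm p * n + n * (U * norm p) + norm q * n)"
    using g by (intro mult_left_mono) auto
  then have "\<gamma>G * (\<gamma>H / 2 * (norm p)\<^sup>2) \<le> \<gamma>G * (norm p * n + n * (U * norm p)) + (\<gamma>G * norm q) * n"
    by (simp add: distrib_left mult.assoc)
  also have "\<dots> \<le> 1 * (norm p * n + n * (U * norm p)) + (n + U * norm p) * n"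
    using q1 g n0 U by (intro add_mono mult_right_mono) auto
  also have "\<dots> \<le> 3 * U * n * norm p + n\<^sup>2"
  proof -
    have "1 * (norm p * n) \<le> U * (norm p * n)" using U n0 by (intro mult_right_mono) auto
    then show ?thesis by (simp add: algebra_simps power2_eq_square)
  qed
  finally have quad: "\<gamma>G * \<gamma>H * (norm p)\<^sup>2 \<le> 6 * U * n * norm p + 2 * n\<^sup>2" by (simp add: algebra_simps)
  define \<theta> where "\<theta> = \<gamma>G * \<gamma>H"
  have th: "0 < \<theta>" "\<theta> \<le> 1" using g by (auto simp: \<theta>_def mult_le_one)
  \<comment> \<open>Otherwise \<open>norm p\<close> is at least \<open>n\<close>, so
    \<open>2 * n\<^sup>2\<close> is absorbed by \<open>2 * U * n * norm p\<close>, and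
    \<open>quad\<close> with 6 + 2 = 8 is violated.\<close>
  have p_le: "\<theta> * norm p \<le> 8 * U * n"
  proof (rule ccontr)
    assume "\<not> ?thesis"
    then have lt: "8 * U * n < \<theta> * norm p" by simp
    have p0: "0 < norm p"
    proof -
      have "0 \<le> 8 * U * n" using n0 U by simp
      then have "0 < \<theta> * norm p" using lt by linarith
      then show ?thesis using th by (simp add: zero_less_mult_iff)
    qed
    have "n \<le> norm p"
    proof -
      have "1 * n \<le> 8 * U * n" using U n0 by (intro mult_right_mono) auto
      also have "\<dots> \<le> \<theta> * norm p" using lt by simp
      also have "\<dots> \<le> 1 * norm p" using th p0 by (intro mult_right_mono) auto
      finally show ?thesis by simp
    qed
    then have "1 * n * n \<le> U * n * norm p" using U n0 by (intro mult_mono) auto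
    then have "2 * n\<^sup>2 \<le> 2 * (U * n * norm p)" by (simp add: power2_eq_square)
    then have "\<theta> * (norm p)\<^sup>2 \<le> 8 * U * n * norm p" using quad by (simp add: \<theta>_def)
    moreover have "8 * U * n * norm p < \<theta> * norm p * norm p" using lt p0 by simp
    ultimately show False by (simp add: power2_eq_square mult_ac)
  qed
  have q_le: "\<theta> * \<gamma>G * norm q \<le> 9 * U\<^sup>2 * n"
  proof -
    have "\<theta> * (\<gamma>G * norm q) \<le> \<theta> * (n + U * norm p)" using q1 th by simp
    also have "\<dots> = \<theta> * n + U * (\<theta> * norm p)" by (simp add: algebra_simps)
    also have "\<dots> \<le> 1 * n + U * (8 * U * n)"
      using U th n0 by (intro add_mono mult_right_mono mult_left_mono p_le) auto
    also have "\<dots> \<le> 9 * U\<^sup>2 * n"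
    proof -
      have "1 \<le> U\<^sup>2" using U by simp
      then have "1 * n \<le> U\<^sup>2 * n" using n0 by (intro mult_right_mono) auto
      then show ?thesis by (simp add: algebra_simps power2_eq_square)
    qed
    finally show ?thesis by (simp add: mult_ac)
  qed
  have p_le2: "\<theta> * \<gamma>G * norm p \<le> 8 * U\<^sup>2 * n"
  proof -
    have "\<theta> * \<gamma>G * norm p \<le> \<theta> * norm p" using th g by (simp add: mult_le_cancel_right2 mult_le_cancel_left1)
    also have "\<dots> \<le> 8 * U * n" by (rule p_le)
    also have "\<dots> \<le> 8 * U\<^sup>2 * n" using U n0 by (intro mult_right_mono) (auto simp: power2_eq_square)
    finally show ?thesis .
  qed
  have "\<theta> * \<gamma>G * norm (p, q) \<le> \<theta> * \<gamma>G * (norm p + norm q)"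
    using th g by (intro mult_left_mono norm_Pair_le) auto
  \<comment> \<open>The constant 17 is 8 from \<open>p\<close> plus 9 from \<open>q\<close>.\<close>
  also have "\<dots> \<le> 17 * U\<^sup>2 * n" using q_le p_le2 by (simp add: algebra_simps)
  finally have "\<theta> * \<gamma>G * norm (p, q) \<le> 17 * U\<^sup>2 * n" .
  then show ?thesis using U by (simp add: n_def \<theta>_def field_simps power2_eq_square)
qed

section \<open>Backtracking line search\<close>

lemma has_derivative_grad:
  fixes g :: "'a::euclidean_space \<Rightarrow> real"
  assumes "g differentiable (at z)"
  shows "(g has_derivative (\<lambda>h. grad g z \<bullet> h)) (at z)"
proof -
  have D: "(g has_derivative frechet_derivative g (at z)) (at z)"
    using assms by (simp add: frechet_derivative_works)
  have "frechet_derivative g (at z) h = grad g z \<bullet> h" for h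
  proof -
    have "frechet_derivative g (at z) h = frechet_derivative g (at z) (\<Sum>b\<in>Basis. (h \<bullet> b) *\<^sub>R b)"
      by (simp add: euclidean_representation)
    also have "\<dots> = (\<Sum>b\<in>Basis. (h \<bullet> b) * frechet_derivative g (at z) b)"
      using has_derivative_linear[OF D] by (simp add: linear_sum linear_scale)
    finally show ?thesis by (simp add: grad_def inner_sum_left inner_commute[of h] mult.commute)
  qed
  then have "frechet_derivative g (at z) = (\<lambda>h. grad g z \<bullet> h)" by blast
  then show ?thesis using D by simp
qed

lemma grad_eqI:
  fixes g :: "'a::euclidean_space \<Rightarrow> real"
  assumes "(g has_derivative (\<lambda>h. v \<bullet> h)) (at z)"
  shows "grad g z = v"
proof -
  have "frechet_derivative g (at z) = (\<lambda>h. v \<bullet> h)"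
    using frechet_derivative_at[OF assms] by simp
  then show ?thesis by (simp add: grad_def euclidean_representation)
qed

text \<open>Uniform continuity of the gradient on \<open>K\<close> makes every sufficiently short step acceptable, with
  a threshold that is uniform over the iterates whose \<open>n t\<close> stays away from 0; this replaces a
  Lipschitz constant of the gradient.\<close>

lemma armijo_uniform:
  fixes \<phi> :: "'a::euclidean_space \<Rightarrow> real"
  assumes K: "compact K" and diff: "\<And>z. z \<in> K \<Longrightarrow> \<phi> differentiable (at z)"
    and cont: "continuous_on K (grad \<phi>)"
    and seg: "\<And>t a. 0 \<le> a \<Longrightarrow> a \<le> 1 \<Longrightarrow> z t + a *\<^sub>R d t \<in> K"
    and beta: "\<beta> < 1" and e: "0 < e"
  obtains a0 where "0 < a0"
    "\<And>t a. grad \<phi> (z t) \<bullet> d t \<le> - e \<Longrightarrow> 0 < a \<Longrightarrow> a \<le> a0 \<Longrightarrow> a \<le> 1 \<Longrightarrow> armijo \<phi> \<beta> (z t) (d t) a"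
proof -
  \<comment> \<open>Both ends of the segment, \<open>a = 0\<close> and \<open>a = 1\<close>, lie in
    the compact \<open>K\<close>, so the directions are uniformly bounded.\<close>
  obtain R where R: "0 < R" "\<And>t. norm (d t) \<le> R"
  proof -
    obtain B where B: "\<And>x. x \<in> K \<Longrightarrow> norm x \<le> B"
      using compact_imp_bounded[OF K] by (auto simp: bounded_iff)
    have "norm (d t) \<le> 2 * \<bar>B\<bar> + 1" for t
    proof -
      have "norm (d t) = norm ((z t + 1 *\<^sub>R d t) - (z t + 0 *\<^sub>R d t))" by simp
      also have "\<dots> \<le> norm (z t + 1 *\<^sub>R d t) + norm (z t + 0 *\<^sub>R d t)"
        by (rule norm_triangle_ineq4)
      also have "\<dots> \<le> B + B" by (intro add_mono B seg) auto
      finally show ?thesis by linarith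
    qed
    then show ?thesis by (intro that[of "2 * \<bar>B\<bar> + 1"]) auto
  qed
  \<comment> \<open>Chosen so that a gradient change below \<open>e'\<close>, paired with a
    direction of length at most \<open>R\<close>, costs at most \<open>(1 - \<beta>) * e\<close>,
    which is covered by the gap between the slope and \<beta> times the slope.\<close>
  define e' where "e' = (1 - \<beta>) * e / R"
  have "0 < e'" using beta e R by (simp add: e'_def)
  then obtain s where s: "0 < s"
    "\<And>x y. x \<in> K \<Longrightarrow> y \<in> K \<Longrightarrow> dist y x < s \<Longrightarrow> dist (grad \<phi> y) (grad \<phi> x) < e'"
    using compact_uniformly_continuous[OF cont K] unfolding uniformly_continuous_on_def by metis
  have "armijo \<phi> \<beta> (z t) (d t) a"
    if D: "grad \<phi> (z t) \<bullet> d t \<le> - e" and a: "0 < a" "a \<le> s / (2 * R)" "a \<le> 1" for t a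
  proof -
    define h where "h = (\<lambda>u. \<phi> (z t + u *\<^sub>R d t))"
    have hd: "(h has_derivative (\<lambda>v. grad \<phi> (z t + u *\<^sub>R d t) \<bullet> (v *\<^sub>R d t))) (at u)"
      if "0 \<le> u" "u \<le> a" for u
    proof -
      have k: "(\<phi> has_derivative (\<lambda>h. grad \<phi> (z t + u *\<^sub>R d t) \<bullet> h)) (at (z t + u *\<^sub>R d t))"
        using that a by (intro has_derivative_grad diff seg) auto
      have l: "((\<lambda>u. z t + u *\<^sub>R d t) has_derivative (\<lambda>v. v *\<^sub>R d t)) (at u)"
        by (auto intro!: derivative_eq_intros)
      show ?thesis
        unfolding h_def using has_derivative_compose[OF l k] by (simp add: o_def)
    qed
    obtain u where u: "0 < u" "u < a" "h a - h 0 = grad \<phi> (z t + u *\<^sub>R d t) \<bullet> ((a - 0) *\<^sub>R d t)"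
      using mvt_simple[OF a(1), of h "\<lambda>u v. grad \<phi> (z t + u *\<^sub>R d t) \<bullet> (v *\<^sub>R d t)"]
        has_derivative_at_withinI[OF hd] by (metis greaterThanLessThan_iff)
    have zt: "z t \<in> K" using seg[of 0 t] by simp
    have "u * norm (d t) \<le> s / (2 * R) * R" using u a R by (intro mult_mono) auto
    also have "\<dots> < s" using s(1) R by simp
    finally have "dist (grad \<phi> (z t + u *\<^sub>R d t)) (grad \<phi> (z t)) < e'"
      using u a by (intro s(2) zt seg) (auto simp: dist_norm)
    then have "(grad \<phi> (z t + u *\<^sub>R d t) - grad \<phi> (z t)) \<bullet> d t \<le> e' * R"
      using norm_cauchy_schwarz[of "grad \<phi> (z t + u *\<^sub>R d t) - grad \<phi> (z t)" "d t"] R(2)[of t] R(1)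
      by (smt (verit) dist_norm mult_mono norm_ge_zero)
    also have "\<dots> = (1 - \<beta>) * e" using R by (simp add: e'_def)
    also have "\<dots> \<le> (1 - \<beta>) * (- (grad \<phi> (z t) \<bullet> d t))" using D beta by (intro mult_left_mono) auto
    finally have "grad \<phi> (z t + u *\<^sub>R d t) \<bullet> d t \<le> \<beta> * (grad \<phi> (z t) \<bullet> d t)"
      by (simp add: inner_diff_left algebra_simps)
    then have "a * (grad \<phi> (z t + u *\<^sub>R d t) \<bullet> d t) \<le> a * (\<beta> * (grad \<phi> (z t) \<bullet> d t))"
      using a by (intro mult_left_mono) auto
    then show ?thesis using u(3) by (simp add: armijo_def h_def mult_ac)
  qed
  then show ?thesis using that[of "s / (2 * R)"] s(1) R by simp
qed

text \<open>If \<open>n t \<ge> e\<close> happened infinitely often, steps bounded below would each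
  lower \<phi> by a fixed amount, while \<phi> is bounded on \<open>K\<close>. Where
  \<open>n t = 0\<close> the descent bound gives no strict decrease; there \<open>d0\<close> makes
  the direction zero, so that the trial step 1 is accepted at once.\<close>

lemma backtracking_convergence:
  fixes \<phi> :: "'a::euclidean_space \<Rightarrow> real"
  assumes K: "compact K" and diff: "\<And>z. z \<in> K \<Longrightarrow> \<phi> differentiable (at z)"
    and cont: "continuous_on K (grad \<phi>)"
    and seg: "\<And>t a. 0 \<le> a \<Longrightarrow> a \<le> 1 \<Longrightarrow> z t + a *\<^sub>R d t \<in> K"
    and beta: "0 < \<beta>" "\<beta> < 1" and kappa: "0 < \<kappa>" "\<kappa> < 1"
    and step: "\<And>t. z (Suc t) = z t + backtrack \<phi> \<beta> \<kappa> (z t) (d t) *\<^sub>R d t"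
    and k: "0 < k" and descent: "\<And>t. grad \<phi> (z t) \<bullet> d t \<le> - k * (n t)\<^sup>2"
    and n0: "\<And>t. 0 \<le> n t" and d0: "\<And>t. n t = 0 \<Longrightarrow> d t = 0"
  shows "n \<longlonglongrightarrow> 0"
proof -
  define \<alpha> where "\<alpha> = (\<lambda>t. backtrack \<phi> \<beta> \<kappa> (z t) (d t))"
  have zK: "z t \<in> K" for t using seg[of 0 t] by simp
  \<comment> \<open>Unfolds \<open>backtrack\<close> provided some trial step is accepted, as the
    \<open>LEAST\<close> is unspecified otherwise. Unless the first trial is taken, the previous
    one, \<open>\<alpha> t / \<kappa>\<close>, was rejected.\<close>
  have least: "armijo \<phi> \<beta> (z t) (d t) (\<alpha> t) \<and> 0 < \<alpha> t \<and> \<alpha> t \<le> 1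
      \<and> (\<alpha> t = 1 \<or> \<not> armijo \<phi> \<beta> (z t) (d t) (\<alpha> t / \<kappa>) \<and> \<alpha> t / \<kappa> \<le> 1)"
    if ex: "armijo \<phi> \<beta> (z t) (d t) (\<kappa> ^ m)" for t m
  proof -
    define N where "N = (LEAST m. armijo \<phi> \<beta> (z t) (d t) (\<kappa> ^ m))"
    have aN: "\<alpha> t = \<kappa> ^ N" by (simp add: \<alpha>_def backtrack_def N_def)
    have "armijo \<phi> \<beta> (z t) (d t) (\<kappa> ^ N)" unfolding N_def using ex by (rule LeastI)
    moreover have "\<alpha> t = 1 \<or> \<not> armijo \<phi> \<beta> (z t) (d t) (\<alpha> t / \<kappa>) \<and> \<alpha> t / \<kappa> \<le> 1"
    proof (cases N)
      case (Suc N')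
      have "\<not> armijo \<phi> \<beta> (z t) (d t) (\<kappa> ^ N')"
        using not_less_Least[of N' "\<lambda>m. armijo \<phi> \<beta> (z t) (d t) (\<kappa> ^ m)"] Suc by (simp add: N_def)
      then show ?thesis using kappa by (simp add: aN Suc power_le_one)
    qed (simp add: aN)
    ultimately show ?thesis using kappa by (simp add: aN power_le_one)
  qed
  have low: "\<exists>a1. 0 < a1 \<and> (\<forall>t. e \<le> n t \<longrightarrow> armijo \<phi> \<beta> (z t) (d t) (\<alpha> t) \<and> a1 \<le> \<alpha> t)" if "0 < e" for e
  proof -
    have "0 < k * e\<^sup>2" using k that by simp
    from armijo_uniform[OF K diff cont seg beta(2) this] obtain a0 where a0: "0 < a0"
      "\<And>t a. grad \<phi> (z t) \<bullet> d t \<le> - (k * e\<^sup>2) \<Longrightarrow> 0 < a \<Longrightarrow> a \<le> a0 \<Longrightarrow> a \<le> 1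
        \<Longrightarrow> armijo \<phi> \<beta> (z t) (d t) a" by metis
    have "armijo \<phi> \<beta> (z t) (d t) (\<alpha> t) \<and> min 1 (\<kappa> * a0) \<le> \<alpha> t" if "e \<le> n t" for t
    proof -
      have "k * e\<^sup>2 \<le> k * (n t)\<^sup>2" using k that \<open>0 < e\<close> by (intro mult_left_mono power_mono) auto
      then have D: "grad \<phi> (z t) \<bullet> d t \<le> - (k * e\<^sup>2)" using descent[of t] by linarith
      obtain m where m: "\<kappa> ^ m < a0" using real_arch_pow_inv[OF a0(1) kappa(2)] by blast
      have "armijo \<phi> \<beta> (z t) (d t) (\<kappa> ^ m)"
        using m kappa by (intro a0(2)[OF D]) (auto simp: power_le_one)
      note l = least[OF this]
      \<comment> \<open>Every trial up to \<open>a0\<close> is accepted, so a rejected one exceeds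
        \<open>a0\<close>; the next trial still exceeds \<open>\<kappa> * a0\<close>.\<close>
      have "\<alpha> t = 1 \<or> a0 < \<alpha> t / \<kappa>"
        using l a0(2)[OF D, of "\<alpha> t / \<kappa>"] kappa by force
      then show ?thesis using l kappa by (auto simp: field_simps min_def)
    qed
    then show ?thesis using a0(1) kappa by (intro exI[of _ "min 1 (\<kappa> * a0)"]) auto
  qed
  have ok: "armijo \<phi> \<beta> (z t) (d t) (\<alpha> t) \<and> 0 < \<alpha> t" for t
  proof (cases "n t = 0")
    case True
    then have "d t = 0" by (rule d0)
    then have "armijo \<phi> \<beta> (z t) (d t) (\<kappa> ^ 0)" by (simp add: armijo_def)
    from least[OF this] show ?thesis by blast
  next
    case False
    then show ?thesis using low[of "n t"] n0[of t] by fastforce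
  qed
  have dec: "\<phi> (z (Suc t)) \<le> \<phi> (z t) - \<beta> * \<alpha> t * (k * (n t)\<^sup>2)" for t
  proof -
    have "\<beta> * \<alpha> t * (grad \<phi> (z t) \<bullet> d t) \<le> \<beta> * \<alpha> t * (- k * (n t)\<^sup>2)"
      using ok[of t] beta by (intro mult_left_mono descent) auto
    then show ?thesis using ok[of t] by (simp add: armijo_def step \<alpha>_def)
  qed
  have nn: "0 \<le> \<beta> * \<alpha> t * (k * (n t)\<^sup>2)" for t
    using ok[of t] beta k by simp
  have "decseq (\<lambda>t. \<phi> (z t))"
    using dec nn by (intro decseq_SucI) (smt (verit))
  moreover have "bounded (\<phi> ` K)"
    using diff by (intro compact_imp_bounded compact_continuous_image K continuous_at_imp_continuous_on)
      (auto intro: differentiable_imp_continuous_within)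
  then obtain B where "\<And>y. y \<in> K \<Longrightarrow> \<bar>\<phi> y\<bar> \<le> B" by (auto simp: bounded_iff)
  then have "\<And>t. - B \<le> \<phi> (z t)" using zK by (smt (verit))
  ultimately obtain L where L: "(\<lambda>t. \<phi> (z t)) \<longlonglongrightarrow> L" by (metis decseq_convergent)
  have gap: "(\<lambda>t. \<phi> (z t) - \<phi> (z (Suc t))) \<longlonglongrightarrow> 0"
    using tendsto_diff[OF L LIMSEQ_Suc[OF L]] by simp
  show ?thesis
  proof (rule LIMSEQ_I)
    fix e :: real assume e: "0 < e"
    obtain a1 where a1: "0 < a1" "\<And>t. e \<le> n t \<Longrightarrow> a1 \<le> \<alpha> t" using low[OF e] by blast
    have pos: "0 < \<beta> * a1 * (k * e\<^sup>2)" using beta a1 k e by simp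
    obtain N where N: "\<And>t. N \<le> t \<Longrightarrow> \<bar>\<phi> (z t) - \<phi> (z (Suc t))\<bar> < \<beta> * a1 * (k * e\<^sup>2)"
      using LIMSEQ_D[OF gap pos] by auto
    have "n t < e" if "N \<le> t" for t
    proof (rule ccontr)
      assume "\<not> n t < e"
      then have "e \<le> n t" by simp
      then have "\<beta> * a1 * (k * e\<^sup>2) \<le> \<beta> * \<alpha> t * (k * (n t)\<^sup>2)"
        using beta k a1 e \<open>e \<le> n t\<close> ok[of t] by (intro mult_mono power_mono mult_left_mono) auto
      then show False using dec[of t] N[OF that] by linarith
    qed
    then show "\<exists>N. \<forall>t\<ge>N. norm (n t - 0) < e" using n0 by (auto simp: abs_of_nonneg)
  qed
qed

section \<open>Graph distances and banded matrices\<close>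

text \<open>In \<open>enat\<close> the condition \<open>x \<le> n\<close> is the strict inequality
  \<open>x < n + 1\<close>, for which the infimum has a witness. The empty family, with infimum
  \<infinity>, is covered.\<close>

lemma INF_le_enat_iff: "(INF i\<in>A. f i) \<le> enat n \<longleftrightarrow> (\<exists>i\<in>A. f i \<le> enat n)"
proof -
  have *: "x \<le> enat n \<longleftrightarrow> x < enat (Suc n)" for x by (cases x) auto
  show ?thesis unfolding * by (rule INF_less_iff)
qed

lemma gdist_le_iff: "gdist E i j \<le> enat n \<longleftrightarrow> (\<exists>m\<le>n. (i, j) \<in> E ^^ m)"
  unfolding gdist_def INF_le_enat_iff by auto

lemma closed_nbhd_iff: "i \<in> closed_nbhd E n W \<longleftrightarrow> (\<exists>j\<in>W. gdist E i j \<le> enat n)"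
  by (simp add: closed_nbhd_def gdist_set_def INF_le_enat_iff)

lemma gdist_self: "gdist E i i \<le> enat n"
  unfolding gdist_le_iff by (rule exI[of _ 0]) auto

lemma gdist_triangle:
  "gdist E i j \<le> enat m \<Longrightarrow> gdist E j k \<le> enat n \<Longrightarrow> gdist E i k \<le> enat (m + n)"
  unfolding gdist_le_iff by (meson add_mono relpow_trans)

lemma sym_relpow: "sym E \<Longrightarrow> (i, j) \<in> E ^^ n \<Longrightarrow> (j, i) \<in> E ^^ n"
proof (induction n arbitrary: j)
  case (Suc n)
  obtain k where "(i, k) \<in> E ^^ n" "(k, j) \<in> E" using Suc.prems(2) by (rule relpow_Suc_E)
  then show ?case using Suc.IH Suc.prems(1) by (meson relpow_Suc_I2 symD)
qed auto

lemma gdist_sym: "sym E \<Longrightarrow> gdist E i j = gdist E j i"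
  unfolding gdist_def using sym_relpow[of E i j] sym_relpow[of E j i]
  by (intro arg_cong[where f = "\<lambda>A. INF n\<in>A. enat n"]) blast

lemma closed_nbhd_closed_nbhd:
  "closed_nbhd E m (closed_nbhd E n A) \<subseteq> closed_nbhd E (m + n) A"
proof
  fix i assume "i \<in> closed_nbhd E m (closed_nbhd E n A)"
  then obtain j k where "gdist E i j \<le> enat m" "gdist E j k \<le> enat n" "k \<in> A"
    by (auto simp: closed_nbhd_iff)
  then show "i \<in> closed_nbhd E (m + n) A" using gdist_triangle by (fastforce simp: closed_nbhd_iff)
qed

lemma closed_nbhd_mono: "m \<le> n \<Longrightarrow> A \<subseteq> B \<Longrightarrow> closed_nbhd E m A \<subseteq> closed_nbhd E n B"
  unfolding closed_nbhd_iff subset_iff gdist_le_iff by (meson order_trans)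

lemma subset_closed_nbhd: "A \<subseteq> closed_nbhd E n A"
  unfolding closed_nbhd_iff subset_iff using gdist_self by metis

lemma gdist_two_split:
  assumes "gdist E i k \<le> enat 2"
  obtains j where "gdist E i j \<le> enat 1" "gdist E j k \<le> enat 1"
proof -
  obtain m where m: "m \<le> 2" "(i, k) \<in> E ^^ m" using assms by (auto simp: gdist_le_iff)
  consider "m \<le> 1" | "m = Suc 1" using m(1) by linarith
  then show thesis
  proof cases
    case 1
    then show thesis using m gdist_self by (intro that[of k]) (auto simp: gdist_le_iff)
  next
    case 2
    then obtain j where "(i, j) \<in> E ^^ 1" "(j, k) \<in> E" using m by (auto elim!: relpow_Suc_E)
    then show thesis by (intro that[of j]) (auto simp: gdist_le_iff intro: exI[of _ 1])
  qed
qed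

text \<open>The source of the square in \<open>Ups_hat\<close>: Hessians reach distance 2, and a
  ball of radius 2 is counted by composing two balls of radius 1.\<close>

lemma card_ball_two:
  fixes E :: "('v::finite \<times> 'v) set"
  assumes D: "\<And>i. real (card {j. gdist E i j \<le> enat 1}) \<le> D"
  shows "real (card {j. gdist E i j \<le> enat 2}) \<le> D\<^sup>2"
proof -
  have "{k. gdist E i k \<le> enat 2} \<subseteq> (\<Union>j\<in>{j. gdist E i j \<le> enat 1}. {k. gdist E j k \<le> enat 1})"
    using gdist_two_split by (fastforce simp del: One_nat_def)
  then have "card {k. gdist E i k \<le> enat 2}
      \<le> card (\<Union>j\<in>{j. gdist E i j \<le> enat 1}. {k. gdist E j k \<le> enat 1})"
    by (intro card_mono) auto
  also have "\<dots> \<le> (\<Sum>j\<in>{j. gdist E i j \<le> enat 1}. card {k. gdist E j k \<le> enat 1})"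
    by (rule card_UN_le) simp
  finally have "real (card {k. gdist E i k \<le> enat 2})
      \<le> (\<Sum>j\<in>{j. gdist E i j \<le> enat 1}. real (card {k. gdist E j k \<le> enat 1}))"
    by (metis of_nat_le_iff of_nat_sum)
  also have "\<dots> \<le> (\<Sum>j\<in>{j. gdist E i j \<le> enat 1}. D)" by (intro sum_mono D)
  also have "\<dots> \<le> D * D" using D[of i] order_trans[OF _ D[of i], of 0] by (simp add: mult_right_mono)
  finally show ?thesis by (simp add: power2_eq_square)
qed

text \<open>\<open>W_tilde\<close> is the inner boundary of \<open>W\<close>, where constraints may
  involve variables outside \<open>W\<close>. A node outside \<open>W\<close> within distance 1 of a
  node of \<open>W\<close> is automatically in \<open>open_nbhd E W\<close>, so the nested
  neighbourhoods collapse.\<close>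

lemma in_W_tilde_iff:
  assumes "sym E"
  shows "i \<in> W_tilde E W \<longleftrightarrow> i \<in> W \<and> (\<exists>j. j \<notin> W \<and> gdist E i j \<le> enat 1)"
proof -
  have "gdist E j i \<le> enat 1 \<longleftrightarrow> gdist E i j \<le> enat 1" for j
    by (simp only: gdist_sym[OF assms, of i j])
  then have "j \<in> open_nbhd E W \<longleftrightarrow> j \<notin> W"
    if "i \<in> W" "gdist E i j \<le> enat 1" for j
    using that unfolding open_nbhd_def Diff_iff closed_nbhd_iff by blast
  then show ?thesis
    unfolding W_tilde_def open_nbhd_def[of E "open_nbhd E W"] Int_iff Diff_iff closed_nbhd_iff
    by (auto simp: open_nbhd_def simp del: One_nat_def)
qed

lemma in_W_hat_iff:
  assumes "sym E"
  shows "i \<in> W_hat E W \<longleftrightarrow> (if i \<in> W then i \<in> W_tilde E W else \<exists>j\<in>W. gdist E i j \<le> enat 1)"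
  by (auto simp: W_hat_def open_nbhd_def closed_nbhd_iff W_tilde_def)

section \<open>Supports of vectors and bandwidth of matrices\<close>

definition supported :: "('k \<Rightarrow> 'v) \<Rightarrow> 'v set \<Rightarrow> real ^ 'k::finite \<Rightarrow> bool" where
  "supported nd A v \<longleftrightarrow> (\<forall>k. nd k \<notin> A \<longrightarrow> v $ k = 0)"

text \<open>Phrased for scalar entries, so that one notion serves square and rectangular matrices;
  the bandwidth is 2 for Hessians and 1 for the Jacobian and its transpose.\<close>

definition banded :: "('v \<times> 'v) set \<Rightarrow> nat \<Rightarrow> ('m \<Rightarrow> 'v) \<Rightarrow> ('n \<Rightarrow> 'v) \<Rightarrow> real ^ 'n::finite ^ 'm::finite \<Rightarrow> bool" where
  "banded E n rn cn A \<longleftrightarrow> (\<forall>k l. A $ k $ l \<noteq> 0 \<longrightarrow> gdist E (rn k) (cn l) \<le> enat n)"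

lemma supported_mono: "supported nd A v \<Longrightarrow> A \<subseteq> B \<Longrightarrow> supported nd B v"
  by (auto simp: supported_def)

lemma supported_0 [simp]: "supported nd A 0"
  by (simp add: supported_def)

lemma supported_add: "supported nd A v \<Longrightarrow> supported nd A w \<Longrightarrow> supported nd A (v + w)"
  by (auto simp: supported_def)

lemma supported_diff: "supported nd A v \<Longrightarrow> supported nd A w \<Longrightarrow> supported nd A (v - w)"
  by (auto simp: supported_def)

lemma supported_scaleR: "supported nd A v \<Longrightarrow> supported nd A (r *\<^sub>R v)"
  by (auto simp: supported_def)

lemma supported_subvec: "supported nd A v \<Longrightarrow> supported nd A (subvec nd I v)"
  by (auto simp: supported_def subvec_def)

lemma supported_subvec_self: "supported nd I (subvec nd I v)"
  by (auto simp: supported_def subvec_def)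

lemma subvec_eq_0: "supported nd A v \<Longrightarrow> A \<inter> I = {} \<Longrightarrow> subvec nd I v = 0"
  by (auto simp: supported_def subvec_def vec_eq_iff)

text \<open>Finite propagation speed, from which the decay estimate draws its locality.\<close>

lemma supported_mult:
  assumes "banded E n rn cn A" "supported cn B v"
  shows "supported rn (closed_nbhd E n B) (A *v v)"
  unfolding supported_def
proof (intro allI impI)
  fix k assume k: "rn k \<notin> closed_nbhd E n B"
  have "A $ k $ l * v $ l = 0" for l
  proof (cases "A $ k $ l = 0")
    case False
    then have "gdist E (rn k) (cn l) \<le> enat n" using assms(1) by (simp add: banded_def)
    then have "cn l \<notin> B" using k by (auto simp: closed_nbhd_iff)
    then show ?thesis using assms(2) by (simp add: supported_def)
  qed simp
  then show "(A *v v) $ k = 0" unfolding matrix_vector_mult_def vec_lambda_beta by (intro sum.neutral) blast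
qed

lemma banded_transpose: "sym E \<Longrightarrow> banded E n rn cn A \<Longrightarrow> banded E n cn rn (transpose A)"
  by (auto simp: banded_def transpose_def gdist_sym)

lemma linear_subvec: "linear (subvec nd I)"
  by (auto simp: linear_iff subvec_def vec_eq_iff)

lemmas subvec_add = linear_add[OF linear_subvec]
  and subvec_diff = linear_diff[OF linear_subvec]
  and subvec_scale = linear_scale[OF linear_subvec]

lemma subvec_nth [simp]: "subvec nd I v $ k = (if nd k \<in> I then v $ k else 0)"
  by (simp add: subvec_def)

lemma subvec_subvec: "subvec nd I (subvec nd J v) = subvec nd (I \<inter> J) v"
  by (simp add: vec_eq_iff)

lemma subvec_inner: "subvec nd I u \<bullet> v = u \<bullet> subvec nd I v"
  by (auto simp: inner_vec_def intro!: sum.cong)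

lemma norm_subvec_sq: "(norm (subvec nd I v))\<^sup>2 = (\<Sum>k\<in>UNIV. if nd k \<in> I then (v $ k)\<^sup>2 else 0)"
  unfolding power2_norm_eq_inner by (auto simp: inner_vec_def power2_eq_square intro!: sum.cong)

lemma norm_sq_vec: "(norm (v :: real ^ 'k::finite))\<^sup>2 = (\<Sum>k\<in>UNIV. (v $ k)\<^sup>2)"
  unfolding power2_norm_eq_inner by (simp add: inner_vec_def power2_eq_square)

lemma norm_subvec_le: "norm (subvec nd I v) \<le> norm v"
proof -
  have "(norm (subvec nd I v))\<^sup>2 \<le> (norm v)\<^sup>2"
    unfolding norm_subvec_sq norm_sq_vec by (intro sum_mono) auto
  then show ?thesis by (simp add: power2_le_iff_abs_le)
qed

lemma norm_sq_blocks:
  fixes nd :: "'k::finite \<Rightarrow> 'v::finite"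
  shows "(norm v)\<^sup>2 = (\<Sum>i\<in>UNIV. (norm (subvec nd {i} v))\<^sup>2)"
  unfolding norm_subvec_sq by (subst sum.swap) (simp add: norm_sq_vec)

lemma submat_mult: "submat rn cn I J A *v v = subvec rn I (A *v subvec cn J v)"
  by (auto simp: vec_eq_iff matrix_vector_mult_def submat_def intro!: sum.cong)

lemma norm_block_mult_le: "norm (submat rn cn {i} {j} A *v v) \<le> block_norm rn cn i j A * norm v"
  unfolding block_norm_def spectral_norm_def by (rule onorm[OF matrix_vector_mul_bounded_linear])

text \<open>A Schur test on blocks: Cauchy-Schwarz over the at most \<open>D\<close> nonzero blocks
  of a row gives one factor \<open>D\<close>, and exchanging the sums gives another, since by
  symmetry of the distance each column also meets at most \<open>D\<close> rows. The square root
  leaves \<open>\<Upsilon> * D\<close>.\<close>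

lemma banded_norm_bound:
  fixes A :: "real ^ 'n::finite ^ 'm::finite" and E :: "('v::finite \<times> 'v) set"
  assumes sym: "sym E" and band: "banded E n rn cn A"
    and D: "\<And>i. real (card {j. gdist E i j \<le> enat n}) \<le> D"
    and blk: "\<And>i j. block_norm rn cn i j A \<le> \<Upsilon>" and U: "0 \<le> \<Upsilon>"
  shows "norm (A *v x) \<le> \<Upsilon> * D * norm x"
proof -
  define B where "B = (\<lambda>i. {j. gdist E i j \<le> enat n})"
  have D0: "0 \<le> D" using D order_trans[OF of_nat_0_le_iff] by blast
  have row: "(norm (subvec rn {i} (A *v x)))\<^sup>2 \<le> \<Upsilon>\<^sup>2 * D * (\<Sum>j\<in>B i. (norm (subvec cn {j} x))\<^sup>2)" for i
  proof -
    have zero: "submat rn cn {i} {j} A = 0" if "j \<notin> B i" for j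
      using that band by (auto simp: B_def banded_def submat_def vec_eq_iff)
    have "subvec rn {i} (A *v x) = (\<Sum>j\<in>UNIV. submat rn cn {i} {j} A *v x)"
    proof -
      have "(\<Sum>j\<in>UNIV. submat rn cn {i} {j} A *v x) $ k = subvec rn {i} (A *v x) $ k" for k
        by (simp add: matrix_vector_mult_def submat_def if_distrib[of "\<lambda>a. a * _"] cong: if_cong)
           (subst sum.swap, simp)
      then show ?thesis by (simp add: vec_eq_iff)
    qed
    also have "\<dots> = (\<Sum>j\<in>B i. submat rn cn {i} {j} A *v x)"
      by (intro sum.mono_neutral_right) (auto simp: zero)
    also have "\<dots> = (\<Sum>j\<in>B i. submat rn cn {i} {j} A *v subvec cn {j} x)"
      by (simp add: submat_mult subvec_subvec)
    also have "norm \<dots> \<le> (\<Sum>j\<in>B i. \<Upsilon> * norm (subvec cn {j} x))"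
      by (intro sum_norm_le order_trans[OF norm_block_mult_le] mult_right_mono blk) auto
    also have "\<dots> = \<Upsilon> * (\<Sum>j\<in>B i. norm (subvec cn {j} x))" by (simp add: sum_distrib_left)
    finally have "(norm (subvec rn {i} (A *v x)))\<^sup>2 \<le> \<Upsilon>\<^sup>2 * (\<Sum>j\<in>B i. norm (subvec cn {j} x))\<^sup>2"
      unfolding power_mult_distrib[symmetric] by (intro power_mono) auto
    also have "\<dots> \<le> \<Upsilon>\<^sup>2 * (real (card (B i)) * (\<Sum>j\<in>B i. (norm (subvec cn {j} x))\<^sup>2))"
      using Cauchy_Schwarz_ineq_sum[of "\<lambda>_. 1" "\<lambda>j. norm (subvec cn {j} x)" "B i"]
      by (intro mult_left_mono) auto
    also have "\<dots> \<le> \<Upsilon>\<^sup>2 * (D * (\<Sum>j\<in>B i. (norm (subvec cn {j} x))\<^sup>2))"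
      using D[of i] by (intro mult_left_mono mult_right_mono sum_nonneg) (auto simp: B_def)
    finally show ?thesis by (simp add: mult.assoc)
  qed
  have "(norm (A *v x))\<^sup>2 = (\<Sum>i\<in>UNIV. (norm (subvec rn {i} (A *v x)))\<^sup>2)" by (rule norm_sq_blocks)
  also have "\<dots> \<le> (\<Sum>i\<in>UNIV. \<Upsilon>\<^sup>2 * D * (\<Sum>j\<in>B i. (norm (subvec cn {j} x))\<^sup>2))"
    by (intro sum_mono row)
  also have "\<dots> = \<Upsilon>\<^sup>2 * D * (\<Sum>i\<in>UNIV. \<Sum>j\<in>UNIV. if j \<in> B i then (norm (subvec cn {j} x))\<^sup>2 else 0)"
    by (simp add: sum_distrib_left sum.If_cases)
  also have "\<dots> = \<Upsilon>\<^sup>2 * D * (\<Sum>j\<in>UNIV. \<Sum>i\<in>UNIV. if i \<in> B j then (norm (subvec cn {j} x))\<^sup>2 else 0)"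
    by (subst sum.swap) (simp add: B_def gdist_sym[OF sym])
  also have "\<dots> = \<Upsilon>\<^sup>2 * D * (\<Sum>j\<in>UNIV. real (card (B j)) * (norm (subvec cn {j} x))\<^sup>2)"
    by (simp add: sum.If_cases)
  also have "\<dots> \<le> \<Upsilon>\<^sup>2 * D * (\<Sum>j\<in>UNIV. D * (norm (subvec cn {j} x))\<^sup>2)"
    using D D0 by (intro mult_left_mono sum_mono mult_right_mono) (auto simp: B_def)
  also have "\<dots> = (\<Upsilon> * D * norm x)\<^sup>2"
    by (simp add: sum_distrib_left[symmetric] norm_sq_blocks[of x cn] power_mult_distrib)
       (simp add: power2_eq_square)
  finally show ?thesis using U D0 by (simp add: power2_le_iff_abs_le)
qed

lemma transpose_inner: "(transpose A *v u) \<bullet> v = u \<bullet> (A *v v)"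
  for A :: "real ^ 'n::finite ^ 'm::finite"
  by (metis dot_lmul_matrix transpose_matrix_vector)

lemma norm_transpose_bound:
  fixes A :: "real ^ 'n::finite ^ 'm::finite"
  assumes "\<And>x. norm (A *v x) \<le> N * norm x"
  shows "norm (transpose A *v y) \<le> N * norm y"
proof (cases "transpose A *v y = 0")
  case True
  \<comment> \<open>The sign of \<open>N\<close> is not given; testing the hypothesis on the
    all-ones vector, which is nonzero, excludes \<open>N < 0\<close>.\<close>
  have "0 \<le> N * norm y"
  proof (cases "N < 0")
    case True
    have "norm (A *v (1 :: real ^ 'n)) < 0"
      using assms[of "1 :: real ^ 'n"] True
      by (smt (verit) mult_neg_pos norm_eq_zero zero_less_norm_iff zero_neq_one)
    then show ?thesis by simp
  qed auto
  then show ?thesis using True by simp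
next
  case False
  let ?w = "transpose A *v y"
  have "norm ?w * norm ?w = y \<bullet> (A *v ?w)"
    by (simp add: transpose_inner[symmetric] power2_norm_eq_inner[symmetric] power2_eq_square)
  also have "\<dots> \<le> norm y * (N * norm ?w)"
    using norm_cauchy_schwarz mult_left_mono[OF assms norm_ge_zero] order_trans by blast
  finally have "norm ?w * norm ?w \<le> (N * norm y) * norm ?w" by (simp add: mult_ac)
  then show ?thesis using False by (simp add: mult_le_cancel_right)
qed

section \<open>The KKT systems of the subproblems\<close>

declare transpose_matrix_vector [simp del]

lemma subvec_id_iff: "subvec nd I v = v \<longleftrightarrow> supported nd I v"
  by (auto simp: vec_eq_iff supported_def)

text \<open>A snapshot of one iteration: \<open>H\<close> is the modified Hessian, \<open>G\<close>
  the Jacobian, and \<open>N\<close> stands for \<open>Ups_hat\<close>.\<close>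

locale banded_kkt =
  fixes E :: "('v::finite \<times> 'v) set" and pn :: "'p::finite \<Rightarrow> 'v" and dn :: "'d::finite \<Rightarrow> 'v"
    and H :: "real ^ 'p ^ 'p" and G :: "real ^ 'p ^ 'd" and N \<gamma>H \<gamma>G \<mu> :: real
  assumes sym: "sym E" and H_sym: "transpose H = H"
    and H_band: "banded E 2 pn pn H" and G_band: "banded E 1 dn pn G"
    and H_le: "\<And>x. norm (H *v x) \<le> N * norm x" and G_le: "\<And>x. norm (G *v x) \<le> N * norm x"
    and N: "1 \<le> N" and gH: "0 < \<gamma>H" "\<gamma>H \<le> 1" and gG: "0 < \<gamma>G" "\<gamma>G \<le> 1"
    and A1: "\<And>w. G *v w = 0 \<Longrightarrow> \<gamma>H * (norm w)\<^sup>2 \<le> w \<bullet> (H *v w)"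
    and A2: "\<And>v. \<gamma>G * (norm v)\<^sup>2 \<le> (norm (transpose G *v v))\<^sup>2"
    and mu: "4 * N\<^sup>2 / (\<gamma>G * \<gamma>H) \<le> \<mu>"
begin

lemma GT_le: "norm (transpose G *v y) \<le> N * norm y"
  by (rule norm_transpose_bound[OF G_le])

lemma GT_band: "banded E 1 pn dn (transpose G)"
  by (rule banded_transpose[OF sym G_band])

lemma GT_lower: "sqrt \<gamma>G * norm v \<le> norm (transpose G *v v)"
proof -
  have "(sqrt \<gamma>G * norm v)\<^sup>2 \<le> (norm (transpose G *v v))\<^sup>2"
    using A2[of v] gG by (simp add: power_mult_distrib)
  then show ?thesis by (rule power2_le_imp_le) simp
qed

lemma H_inner: "(H *v u) \<bullet> v = u \<bullet> (H *v v)"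
  using transpose_inner[of H u v] by (simp add: H_sym)

text \<open>By \<open>A2\<close> the matrix \<open>G G\<^sup>T\<close> is injective, hence onto in
  finite dimension; solving with it yields the component in the range of
  \<open>transpose G\<close>.\<close>

lemma kernel_range_decomp:
  obtains u y where "x = u + transpose G *v y" "G *v u = 0"
proof -
  have lin: "linear (\<lambda>y. G *v (transpose G *v y))"
    by (auto simp: linear_iff matrix_vector_right_distrib matrix_vector_mult_scaleR)
  have "inj (\<lambda>y. G *v (transpose G *v y))"
    unfolding linear_inj_iff_eq_0[OF lin]
  proof (intro allI impI)
    fix y assume "G *v (transpose G *v y) = 0"
    then have "(norm (transpose G *v y))\<^sup>2 = 0"
      by (simp add: power2_norm_eq_inner transpose_inner)
    then have "\<gamma>G * (norm y)\<^sup>2 \<le> 0" using A2[of y] by simp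
    then show "y = 0" using gG by (simp add: mult_le_0_iff)
  qed
  then have "surj (\<lambda>y. G *v (transpose G *v y))"
    by (rule linear_inj_imp_surj[OF lin])
  then obtain y where "G *v (transpose G *v y) = G *v x" by (metis surjD)
  then show thesis
    by (intro that[of "x - transpose G *v y" y]) (auto simp: matrix_vector_mult_diff_distrib)
qed

text \<open>With \<open>v = transpose G *v y\<close>, this follows from
  \<open>(norm v)\<^sup>2 = y \<bullet> (G *v v)\<close> and
  \<open>sqrt \<gamma>G * norm y \<le> norm v\<close>: the lower bound for
  \<open>transpose G\<close> becomes one for \<open>G\<close> off its kernel.\<close>

lemma G_lower_on_range: "\<gamma>G * (norm (transpose G *v y))\<^sup>2 \<le> (norm (G *v (transpose G *v y)))\<^sup>2"
proof -
  let ?v = "transpose G *v y"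
  have "(norm ?v)\<^sup>2 = y \<bullet> (G *v ?v)" by (simp add: power2_norm_eq_inner transpose_inner)
  also have "\<dots> \<le> norm y * norm (G *v ?v)" by (rule norm_cauchy_schwarz)
  finally have "sqrt \<gamma>G * (norm ?v)\<^sup>2 \<le> sqrt \<gamma>G * norm y * norm (G *v ?v)"
    using gG by (simp add: mult.assoc)
  also have "\<dots> \<le> norm ?v * norm (G *v ?v)" by (intro mult_right_mono GT_lower) auto
  finally have "norm ?v * (sqrt \<gamma>G * norm ?v) \<le> norm ?v * norm (G *v ?v)"
    by (simp add: power2_eq_square mult_ac)
  then have "sqrt \<gamma>G * norm ?v \<le> norm (G *v ?v)"
    by (cases "?v = 0") (auto simp: mult_le_cancel_left_pos)
  then have "(sqrt \<gamma>G * norm ?v)\<^sup>2 \<le> (norm (G *v ?v))\<^sup>2" using gG by (intro power_mono) auto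
  then show ?thesis using gG by (simp add: power_mult_distrib)
qed

lemma kernel_range_orthogonal:
  assumes "G *v u = 0"
  shows "(norm (u + transpose G *v y))\<^sup>2 = (norm u)\<^sup>2 + (norm (transpose G *v y))\<^sup>2"
proof -
  have "u \<bullet> (transpose G *v y) = 0" using assms transpose_inner[of G y u] by (simp add: inner_commute)
  then show ?thesis unfolding power2_norm_eq_inner by (simp add: inner_add inner_commute)
qed

text \<open>Young's inequality splits the mixed term with a free weight \<open>t\<close>:
  \<open>\<gamma>H / 2\<close> serves the penalised Hessian, \<open>\<gamma>H / 4\<close> the
  descent estimate.\<close>

lemma quadratic_form_lower:
  assumes "G *v u = 0" and t: "0 < t"
  shows "\<gamma>H * (norm u)\<^sup>2 - t * (norm u)\<^sup>2 - (N\<^sup>2 / t) * (norm v)\<^sup>2 - N * (norm v)\<^sup>2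
    \<le> (u + v) \<bullet> (H *v (u + v))"
proof -
  have e: "(u + v) \<bullet> (H *v (u + v)) = u \<bullet> (H *v u) + 2 * (u \<bullet> (H *v v)) + v \<bullet> (H *v v)"
    using H_inner[of u v] by (simp add: matrix_vector_right_distrib inner_add inner_commute)
  have "\<bar>u \<bullet> (H *v v)\<bar> \<le> norm u * (N * norm v)"
    using Cauchy_Schwarz_ineq2[of u "H *v v"] mult_left_mono[OF H_le[of v] norm_ge_zero[of u]] by linarith
  moreover have "\<bar>v \<bullet> (H *v v)\<bar> \<le> norm v * (N * norm v)"
    using Cauchy_Schwarz_ineq2[of v "H *v v"] mult_left_mono[OF H_le[of v] norm_ge_zero[of v]] by linarith
  moreover have "2 * (norm u * (N * norm v)) \<le> t * (norm u)\<^sup>2 + (N\<^sup>2 / t) * (norm v)\<^sup>2"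
  proof -
    have "0 \<le> (t * norm u - N * norm v)\<^sup>2 / t" using t by simp
    also have "\<dots> = t * (norm u)\<^sup>2 + (N\<^sup>2 / t) * (norm v)\<^sup>2 - 2 * (norm u * (N * norm v))"
      using t by (simp add: power2_diff power_mult_distrib field_simps power2_eq_square)
    finally show ?thesis by simp
  qed
  ultimately show ?thesis using e A1[OF assms(1)] by (simp add: power2_eq_square mult_ac)
qed

lemma mu_bounds: "4 * N\<^sup>2 \<le> \<mu> * \<gamma>G * \<gamma>H" "4 * N\<^sup>2 \<le> \<mu>" "4 \<le> \<mu>"
proof -
  show 1: "4 * N\<^sup>2 \<le> \<mu> * \<gamma>G * \<gamma>H"
    using mu gG gH by (simp add: pos_divide_le_eq mult.assoc)
  have N2: "1 \<le> N\<^sup>2" using N by (rule one_le_power)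
  then have m: "0 < \<mu>" using mu gG gH
    by (meson divide_pos_pos less_le_trans mult_pos_pos zero_less_numeral zero_less_one)
  have "\<mu> * (\<gamma>G * \<gamma>H) \<le> \<mu> * 1" using m gG gH by (intro mult_left_mono mult_le_one) auto
  with 1 show "4 * N\<^sup>2 \<le> \<mu>" by (simp add: mult.assoc)
  with N2 show "4 \<le> \<mu>" by linarith
qed

text \<open>Finsler's argument, and the origin of \<open>mu_hat\<close>: the range component
  \<open>v\<close> costs \<open>2 * N\<^sup>2 / \<gamma>H\<close> from Young and at most as much
  again from \<open>N + \<gamma>H / 2\<close>, while the penalty returns
  \<open>\<mu> * \<gamma>G \<ge> 4 * N\<^sup>2 / \<gamma>H\<close>.\<close>

lemma augmented_hessian_lower: "\<gamma>H / 2 * (norm x)\<^sup>2 \<le> x \<bullet> (H *v x) + \<mu> * (norm (G *v x))\<^sup>2"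
proof -
  obtain u y where x: "x = u + transpose G *v y" and u: "G *v u = 0" by (rule kernel_range_decomp)
  define v where "v = transpose G *v y"
  have t: "0 < \<gamma>H / 2" using gH by simp
  have "\<gamma>H * (norm u)\<^sup>2 - \<gamma>H / 2 * (norm u)\<^sup>2 - (N\<^sup>2 / (\<gamma>H / 2)) * (norm v)\<^sup>2 - N * (norm v)\<^sup>2
      \<le> x \<bullet> (H *v x)"
    using quadratic_form_lower[OF u t, of v] by (simp add: x v_def)
  moreover have "(4 * N\<^sup>2 / \<gamma>H) * (norm v)\<^sup>2 \<le> \<mu> * (norm (G *v x))\<^sup>2"
  proof -
    have "4 * N\<^sup>2 / \<gamma>H \<le> \<mu> * \<gamma>G" using mu_bounds(1) gH by (simp add: field_simps)
    then have "(4 * N\<^sup>2 / \<gamma>H) * (norm v)\<^sup>2 \<le> \<mu> * \<gamma>G * (norm v)\<^sup>2" by (intro mult_right_mono) auto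
    also have "\<dots> \<le> \<mu> * (norm (G *v v))\<^sup>2"
      using G_lower_on_range[of y] mu_bounds(3) by (simp add: v_def mult.assoc)
    finally show ?thesis by (simp add: x u v_def matrix_vector_right_distrib)
  qed
  moreover have "(N + \<gamma>H / 2) * (norm v)\<^sup>2 \<le> (2 * N\<^sup>2 / \<gamma>H) * (norm v)\<^sup>2"
  proof (intro mult_right_mono)
    have "N * 1 \<le> N * N" using N by (intro mult_left_mono) auto
    then have "N + \<gamma>H / 2 \<le> 2 * N\<^sup>2" using N gH unfolding power2_eq_square by linarith
    also have "\<dots> \<le> 2 * N\<^sup>2 / \<gamma>H" using gH by (simp add: le_divide_eq mult_left_le)
    finally show "N + \<gamma>H / 2 \<le> 2 * N\<^sup>2 / \<gamma>H" .
  qed simp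
  moreover have "(norm x)\<^sup>2 = (norm u)\<^sup>2 + (norm v)\<^sup>2"
    unfolding x v_def by (rule kernel_range_orthogonal[OF u])
  ultimately show ?thesis by (simp add: algebra_simps)
qed

text \<open>The KKT matrix of the subproblem on \<open>W\<close>, extended by zero to all coordinates.\<close>

definition sub_kkt :: "'v set \<Rightarrow> (real ^ 'p) \<times> (real ^ 'd) \<Rightarrow> (real ^ 'p) \<times> (real ^ 'd)" where
  "sub_kkt W s = (subvec pn W (H *v subvec pn W (fst s)
        + \<mu> *\<^sub>R (transpose G *v subvec dn (W_hat E W) (G *v subvec pn W (fst s)))
        + transpose G *v subvec dn (W - W_tilde E W) (snd s)),
      subvec dn (W - W_tilde E W) (G *v subvec pn W (fst s)))"

text \<open>\<open>sub_kkt W\<close> ignores all coordinates outside this space, so its lower bound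
  has to be stated on it.\<close>

definition sub_space :: "'v set \<Rightarrow> ((real ^ 'p) \<times> (real ^ 'd)) set" where
  "sub_space W = {s. supported pn W (fst s) \<and> supported dn (W - W_tilde E W) (snd s)}"

definition UK :: real where "UK = 1.5 * \<mu> * N\<^sup>2"

text \<open>The factor 1.5 in \<open>UK\<close>: since \<open>\<mu> \<ge> 4\<close> and
  \<open>N \<le> N\<^sup>2\<close>, half of \<open>\<mu> * N\<^sup>2\<close> covers the
  \<open>2 * N\<close> contributed by \<open>H\<close> and \<open>G\<close>.\<close>

lemma UK_bounds: "N + \<mu> * N\<^sup>2 + N \<le> UK" "\<mu> * N \<le> UK" "6 \<le> UK"
proof -
  have N2: "N \<le> N\<^sup>2" "1 \<le> N\<^sup>2" using N one_le_power[of N 2] by (auto simp: power2_eq_square)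
  have "4 * N\<^sup>2 \<le> \<mu> * N\<^sup>2" using mu_bounds(3) by (intro mult_right_mono) auto
  then show "N + \<mu> * N\<^sup>2 + N \<le> UK" using N2 by (simp add: UK_def)
  have "\<mu> * N \<le> \<mu> * N\<^sup>2" using N2 mu_bounds(3) by (intro mult_left_mono) auto
  moreover have "0 \<le> \<mu> * N\<^sup>2" using mu_bounds(3) by simp
  ultimately show "\<mu> * N \<le> UK" by (simp add: UK_def)
  have "4 * 1 \<le> \<mu> * N\<^sup>2" using mu_bounds(3) N2 by (intro mult_mono) auto
  then show "6 \<le> UK" by (simp add: UK_def)
qed

lemma lower_constant_le_one: "\<gamma>H * \<gamma>G\<^sup>2 / (17 * UK\<^sup>2) \<le> 1"
proof -
  have "\<gamma>H * \<gamma>G\<^sup>2 \<le> 1 * 1" using gH gG by (intro mult_mono power_le_one) auto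
  moreover have "1 * 1 \<le> 17 * UK\<^sup>2" using UK_bounds(3) by (intro mult_mono one_le_power) auto
  ultimately show ?thesis by (subst pos_divide_le_eq) linarith+
qed

lemma subspace_sub_space: "subspace (sub_space W)"
  by (auto simp: subspace_def sub_space_def supported_add supported_scaleR)

lemma linear_sub_kkt: "linear (sub_kkt W)"
  unfolding linear_iff sub_kkt_def
  by (simp add: subvec_add subvec_scale matrix_vector_right_distrib 
      scaleR_add_right matrix_vector_mult_scaleR)

lemma sub_kkt_in_sub_space: "sub_kkt W s \<in> sub_space W"
  by (simp add: sub_kkt_def sub_space_def supported_subvec_self)

lemma sub_kkt_inner: "sub_kkt W s \<bullet> t = (H *v subvec pn W (fst s)) \<bullet> subvec pn W (fst t)
    + \<mu> * (subvec dn (W_hat E W) (G *v subvec pn W (fst s)) \<bullet> (G *v subvec pn W (fst t)))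
    + subvec dn (W - W_tilde E W) (snd s) \<bullet> (G *v subvec pn W (fst t))
    + (G *v subvec pn W (fst s)) \<bullet> subvec dn (W - W_tilde E W) (snd t)"
  by (simp add: sub_kkt_def inner_prod_def subvec_inner[of pn] subvec_inner[of dn "W - W_tilde E W"]
      inner_add_left transpose_inner)

lemma sub_kkt_selfadjoint: "sub_kkt W s \<bullet> t = s \<bullet> sub_kkt W t"
proof -
  have "(H *v a) \<bullet> b = (H *v b) \<bullet> a" for a b
    using H_inner[of a b] by (simp only: inner_commute)
  moreover have "subvec dn I a \<bullet> b = subvec dn I b \<bullet> a" for I a b
    using subvec_inner[of dn I a b] by (simp only: inner_commute)
  ultimately show ?thesis
    unfolding inner_commute[of s] sub_kkt_inner
    by (metis (no_types, lifting) add.assoc add.commute inner_commute)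
qed

text \<open>Hence \<open>transpose G\<close> maps multipliers on the interior into \<open>W\<close>,
  and truncation to \<open>W\<close> loses nothing of the bound \<open>A2\<close>.\<close>

lemma closed_nbhd_interior: "closed_nbhd E 1 (W - W_tilde E W) \<subseteq> W"
  using gdist_sym[OF sym] by (auto simp: closed_nbhd_iff in_W_tilde_iff[OF sym] simp del: One_nat_def) metis

text \<open>The constraint rows that a vector supported in \<open>W\<close> can touch split into
  hard constraints and penalised rows, without loss or overlap; this recovers the full
  \<open>norm (G *v p)\<close> on the subdomain.\<close>

lemma interior_W_hat: "closed_nbhd E 1 W = (W - W_tilde E W) \<union> W_hat E W"
  "(W - W_tilde E W) \<inter> W_hat E W = {}"
  by (auto simp: W_hat_def open_nbhd_def W_tilde_def intro: subsetD[OF subset_closed_nbhd])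

lemma norm_sub_kkt_le: "norm (sub_kkt W s) \<le> UK * norm s"
proof -
  obtain p q where s: "s = (p, q)" by (cases s)
  let ?P = "subvec pn W" and ?Q = "subvec dn (W - W_tilde E W)" and ?R = "subvec dn (W_hat E W)"
  define a where "a = ?P (H *v ?P p + \<mu> *\<^sub>R (transpose G *v ?R (G *v ?P p)))"
  define b where "b = ?P (transpose G *v ?Q q)"
  define c where "c = ?Q (G *v ?P p)"
  \<comment> \<open>The part \<open>(b, c)\<close> exchanges the primal and dual components, so it
    costs \<open>N\<close> once for the pair and not once per component.\<close>
  have K: "sub_kkt W s = (a, 0) + (b, c)" by (simp add: sub_kkt_def s a_def b_def c_def subvec_add)
  have 1: "norm (G *v ?P p) \<le> N * norm p"
    using N by (intro order_trans[OF G_le] mult_left_mono norm_subvec_le) auto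
  have "norm a \<le> norm (H *v ?P p) + \<mu> * norm (transpose G *v ?R (G *v ?P p))"
    unfolding a_def using mu_bounds(3)
    by (intro order_trans[OF norm_subvec_le] order_trans[OF norm_triangle_ineq]) auto
  also have "\<dots> \<le> N * norm p + \<mu> * (N * (N * norm p))"
    using N mu_bounds(3)
    by (intro add_mono mult_left_mono order_trans[OF GT_le] order_trans[OF H_le]
        order_trans[OF norm_subvec_le 1] norm_subvec_le) auto
  finally have a: "norm a \<le> (N + \<mu> * N\<^sup>2) * norm p" by (simp add: power2_eq_square algebra_simps)
  have b: "norm b \<le> N * norm q" unfolding b_def
    using N by (intro order_trans[OF norm_subvec_le] order_trans[OF GT_le] mult_left_mono norm_subvec_le) auto
  have c: "norm c \<le> N * norm p" unfolding c_def by (rule order_trans[OF norm_subvec_le 1])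
  have "(norm (b, c))\<^sup>2 \<le> (N * norm s)\<^sup>2"
  proof -
    have "(norm b)\<^sup>2 + (norm c)\<^sup>2 \<le> (N * norm q)\<^sup>2 + (N * norm p)\<^sup>2"
      using b c by (intro add_mono power_mono) auto
    then show ?thesis by (simp add: s norm_Pair power_mult_distrib algebra_simps)
  qed
  then have bc: "norm (b, c) \<le> N * norm s" by (rule power2_le_imp_le) (use N in simp)
  have "norm p \<le> norm s" by (simp add: s norm_fst_le)
  then have "norm a \<le> (N + \<mu> * N\<^sup>2) * norm s"
    using N mu_bounds(3) by (intro order_trans[OF a] mult_left_mono) auto
  then have "norm (sub_kkt W s) \<le> (N + \<mu> * N\<^sup>2) * norm s + N * norm s"
    unfolding K using bc norm_triangle_ineq[of "(a, 0)" "(b, c)"] by (simp add: norm_Pair)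
  also have "\<dots> = (N + \<mu> * N\<^sup>2 + N) * norm s" by (simp add: algebra_simps)
  also have "\<dots> \<le> UK * norm s" by (intro mult_right_mono UK_bounds) auto
  finally show ?thesis .
qed

text \<open>Rows of \<open>G *v p\<close> are either in the residual \<open>u\<close> or penalised,
  so \<open>augmented_hessian_lower\<close> yields coercivity up to
  \<open>\<mu> * (norm u)\<^sup>2\<close>; and \<open>transpose G *v q\<close> stays inside
  \<open>W\<close>, so \<open>A2\<close> gives the inf-sup bound.\<close>

lemma norm_sub_kkt_ge:
  assumes s: "s \<in> sub_space W"
  shows "\<gamma>H * \<gamma>G\<^sup>2 / (17 * UK\<^sup>2) * norm s \<le> norm (sub_kkt W s)"
proof -
  obtain p q where spq: "s = (p, q)" by (cases s)
  let ?P = "subvec pn W" and ?Q = "subvec dn (W - W_tilde E W)" and ?R = "subvec dn (W_hat E W)"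
  have Pp: "?P p = p" and Qq: "?Q q = q" using s by (auto simp: sub_space_def spq subvec_id_iff)
  define r where "r = ?P (H *v p + \<mu> *\<^sub>R (transpose G *v ?R (G *v p)) + transpose G *v q)"
  define u where "u = ?Q (G *v p)"
  have K: "sub_kkt W s = (r, u)" by (simp add: sub_kkt_def spq Pp Qq r_def u_def)
  have Gp: "G *v p = u + ?R (G *v p)"
  proof -
    have "supported dn (closed_nbhd E 1 W) (G *v p)"
      using s by (intro supported_mult[OF G_band]) (simp add: sub_space_def spq)
    then show ?thesis
      using interior_W_hat[of W] unfolding u_def
      by (auto simp: vec_eq_iff supported_def simp del: One_nat_def)
  qed
  have uR: "u \<bullet> ?R (G *v p) = 0"
    using interior_W_hat(2)[of W] unfolding u_def inner_vec_def by (intro sum.neutral) auto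
  have n: "(norm (G *v p))\<^sup>2 = (norm u)\<^sup>2 + (norm (?R (G *v p)))\<^sup>2"
    by (subst Gp) (simp add: power2_norm_eq_inner inner_add uR inner_commute)
  have "p \<bullet> r = p \<bullet> (H *v p) + \<mu> * (?R (G *v p) \<bullet> (G *v p)) + q \<bullet> (G *v p)"
    unfolding r_def subvec_inner[symmetric] Pp
    by (simp add: inner_add inner_commute[of p] transpose_inner inner_commute[of q])
  also have "?R (G *v p) \<bullet> (G *v p) = (norm (?R (G *v p)))\<^sup>2"
    by (subst (2) Gp) (simp add: inner_add power2_norm_eq_inner uR inner_commute[of _ u])
  also have "q \<bullet> (G *v p) = q \<bullet> u" unfolding u_def subvec_inner[symmetric] Qq ..
  finally have pr: "p \<bullet> r = p \<bullet> (H *v p) + \<mu> * (norm (?R (G *v p)))\<^sup>2 + q \<bullet> u" .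
  have A1': "\<gamma>H / 2 * (norm p)\<^sup>2 \<le> p \<bullet> r + \<mu> * (norm u)\<^sup>2 - q \<bullet> u"
    using augmented_hessian_lower[of p] unfolding pr n by (simp add: algebra_simps)
  have "supported pn W (transpose G *v q)"
    using s by (intro supported_mono[OF supported_mult[OF GT_band] closed_nbhd_interior]) (simp add: sub_space_def spq)
  then have "transpose G *v q = ?P (transpose G *v q)"
    by (metis subvec_id_iff)
  also have "\<dots> = r - ?P (H *v p + \<mu> *\<^sub>R (transpose G *v ?R (G *v p)))"
    by (simp add: r_def subvec_add)
  also have "norm \<dots> \<le> norm r + norm (?P (H *v p + \<mu> *\<^sub>R (transpose G *v ?R (G *v p))))"
    by (rule norm_triangle_ineq4)
  also have "norm (?P (H *v p + \<mu> *\<^sub>R (transpose G *v ?R (G *v p)))) \<le> N * norm p + \<mu> * (N * (N * norm p))"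
    using N mu_bounds(3)
    by (intro order_trans[OF norm_subvec_le] order_trans[OF norm_triangle_ineq] add_mono H_le)
       (auto intro!: mult_left_mono order_trans[OF GT_le] order_trans[OF norm_subvec_le G_le])
  also have "\<dots> = (N + \<mu> * N\<^sup>2) * norm p" by (simp add: power2_eq_square algebra_simps)
  also have "\<dots> \<le> UK * norm p" using UK_bounds(1) N by (intro mult_right_mono) auto
  finally have "norm (transpose G *v q) \<le> norm r + UK * norm p" by simp
  then have A2': "sqrt \<gamma>G * norm q \<le> norm r + UK * norm p" using GT_lower[of q] by linarith
  have "\<mu> * norm u \<le> \<mu> * (N * norm p)"
    unfolding u_def using mu_bounds(3) by (intro mult_left_mono order_trans[OF norm_subvec_le G_le]) auto
  also have "\<dots> \<le> UK * norm p" using UK_bounds(2) by (simp add: mult.assoc[symmetric] mult_right_mono)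
  finally have sU: "\<mu> * norm u \<le> UK * norm p" .
  show ?thesis
    unfolding K unfolding spq
    using mu_bounds(3) UK_bounds(3)
    by (intro saddle_point_lower_bound[OF A1' A2' _ sU gH gG]) auto
qed

section \<open>Propagation of supports and the error on one subdomain\<close>

definition supp2 :: "'v set \<Rightarrow> (real ^ 'p) \<times> (real ^ 'd) \<Rightarrow> bool" where
  "supp2 A s \<longleftrightarrow> supported pn A (fst s) \<and> supported dn A (snd s)"

lemma supp2_mono: "supp2 A s \<Longrightarrow> A \<subseteq> B \<Longrightarrow> supp2 B s"
  by (auto simp: supp2_def intro: supported_mono)

text \<open>The radius 2 comes from \<open>H\<close> and from the penalty block, which composes
  \<open>G\<close> with \<open>transpose G\<close>; the restrictions in between never enlarge a
  support.\<close>

lemma supp2_sub_kkt: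
  assumes "supp2 A s"
  shows "supp2 (closed_nbhd E 2 A) (sub_kkt W s)"
proof -
  let ?P = "subvec pn W" and ?Q = "subvec dn (W - W_tilde E W)" and ?R = "subvec dn (W_hat E W)"
  have 12: "closed_nbhd E 1 A \<subseteq> closed_nbhd E 2 A" by (intro closed_nbhd_mono) auto
  have 11: "closed_nbhd E 1 (closed_nbhd E 1 A) \<subseteq> closed_nbhd E 2 A"
    using closed_nbhd_closed_nbhd[of E 1 1 A] by (simp add: numeral_2_eq_2)
  have p: "supported pn A (?P (fst s))" and q: "supported dn A (?Q (snd s))"
    using assms by (auto simp: supp2_def supported_subvec)
  have g: "supported dn (closed_nbhd E 1 A) (G *v ?P (fst s))" by (rule supported_mult[OF G_band p])
  have "supported pn (closed_nbhd E 2 A) (H *v ?P (fst s))" by (rule supported_mult[OF H_band p])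
  moreover have "supported pn (closed_nbhd E 2 A) (transpose G *v ?R (G *v ?P (fst s)))"
    by (rule supported_mono[OF supported_mult[OF GT_band supported_subvec[OF g]] 11])
  moreover have "supported pn (closed_nbhd E 2 A) (transpose G *v ?Q (snd s))"
    by (rule supported_mono[OF supported_mult[OF GT_band q] 12])
  ultimately show ?thesis
    using supported_mono[OF g 12]
    by (simp add: supp2_def sub_kkt_def supported_subvec supported_add supported_scaleR)
qed

lemma supp2_residual_iterate:
  assumes "supp2 (closed_nbhd E m A) s"
  shows "supp2 (closed_nbhd E (4 * k + m) A) (((\<lambda>s. s - c *\<^sub>R sub_kkt W (sub_kkt W s)) ^^ k) s)"
proof (induction k)
  case (Suc k)
  let ?s = "((\<lambda>s. s - c *\<^sub>R sub_kkt W (sub_kkt W s)) ^^ k) s"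
  have "supp2 (closed_nbhd E 2 (closed_nbhd E 2 (closed_nbhd E (4 * k + m) A))) (sub_kkt W (sub_kkt W ?s))"
    by (intro supp2_sub_kkt Suc)
  moreover have "closed_nbhd E 2 (closed_nbhd E 2 (closed_nbhd E (4 * k + m) A))
      \<subseteq> closed_nbhd E (4 * Suc k + m) A"
    by (rule order_trans[OF closed_nbhd_mono[OF order_refl closed_nbhd_closed_nbhd]
          order_trans[OF closed_nbhd_closed_nbhd closed_nbhd_mono]]) auto
  ultimately have "supp2 (closed_nbhd E (4 * Suc k + m) A) (sub_kkt W (sub_kkt W ?s))" by (rule supp2_mono)
  moreover have "supp2 (closed_nbhd E (4 * Suc k + m) A) ?s"
    by (rule supp2_mono[OF Suc closed_nbhd_mono]) auto
  ultimately show ?case by (simp add: supp2_def supported_diff supported_scaleR)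
qed (simp add: assms)

text \<open>The restricted exact direction solves the subproblem system up to terms cut off by
  truncation. These sit near the complement of \<open>W\<close>, and
  \<open>decay_of_banded_solution\<close> damps them on the way to \<open>A\<close>. Only the
  2-neighbourhood of \<open>W\<close> enters the bound, so that sums over subdomains stay
  controlled.\<close>

lemma subproblem_error:
  assumes exact: "H *v dx + transpose G *v dl = - g" "G *v dx = - cv"
    and w: "supported pn W w" and z: "supported dn (W - W_tilde E W) z"
    and stat: "subvec pn W (H *v w + g + \<mu> *\<^sub>R (transpose G *v subvec dn (W_hat E W) (cv + G *v w))
      + transpose G *v z) = 0"
    and feas: "subvec dn (W - W_tilde E W) (cv + G *v w) = 0"
    and far: "A \<inter> closed_nbhd E b (- W) = {}" and A: "A \<subseteq> W - W_tilde E W"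
    and gam: "0 < \<gamma>" "\<gamma> \<le> \<gamma>H * \<gamma>G\<^sup>2 / (17 * UK\<^sup>2)"
  shows "norm (subvec pn A (w - dx), subvec dn A (z - dl))
    \<le> ((UK\<^sup>2 - \<gamma>\<^sup>2) / (UK\<^sup>2 + \<gamma>\<^sup>2)) ^ (b div 4)
      * (UK * norm (subvec pn (closed_nbhd E 2 W) dx, subvec dn (closed_nbhd E 2 W) dl) / \<gamma>)"
proof -
  let ?P = "subvec pn W" and ?Q = "subvec dn (W - W_tilde E W)" and ?R = "subvec dn (W_hat E W)"
  let ?B = "closed_nbhd E 2 W"
  \<comment> \<open>The first KKT row before truncation to \<open>W\<close>, with the penalised rows
    \<open>?R\<close> kept, so that the local and the exact solution can be inserted alike.\<close>
  define M where "M = (\<lambda>(x, y). H *v x + \<mu> *\<^sub>R (transpose G *v ?R (G *v x)) + transpose G *v y)"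
  define e where "e = (w - ?P dx, z - ?Q dl)"
  \<comment> \<open>\<open>v\<close> and \<open>u\<close> are the cut-off parts of the exact
    direction that are close enough to \<open>W\<close> to matter. The dual part includes
    \<open>W_tilde\<close>, where the subproblem has no multiplier.\<close>
  define v where "v = subvec pn (?B - W) dx"
  define u where "u = subvec dn (?B - (W - W_tilde E W)) dl"
  define n where "n = norm (subvec pn ?B dx, subvec dn ?B dl)"
  have N0: "0 \<le> N" and mu0: "0 \<le> \<mu>" using N mu_bounds(3) by auto
  have M_lin: "linear M"
    unfolding linear_iff M_def
    by (simp add: case_prod_beta subvec_add subvec_scale matrix_vector_right_distrib
        scaleR_add_right matrix_vector_mult_scaleR)
  have e_S: "e \<in> sub_space W"
    using w z by (simp add: e_def sub_space_def supported_diff supported_subvec_self)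
  have Pw: "?P w = w" and Qz: "?Q z = z" using w z by (auto simp: subvec_id_iff)
  have e_P: "?P (w - ?P dx) = w - ?P dx" "?Q (z - ?Q dl) = z - ?Q dl"
    by (simp_all add: subvec_diff subvec_subvec Pw Qz)
  have disj: "closed_nbhd E 2 (- ?B) \<inter> W = {}"
    using gdist_sym[OF sym] by (fastforce simp: closed_nbhd_iff)
  have M_far: "?P (M (x, y)) = 0" if "supported pn (- ?B) x" "supported dn (- ?B) y" for x y
  proof -
    have 11: "closed_nbhd E 1 (closed_nbhd E 1 (- ?B)) \<subseteq> closed_nbhd E 2 (- ?B)"
      using closed_nbhd_closed_nbhd[of E 1 1 "- ?B"] by (simp add: numeral_2_eq_2)
    have "supported pn (closed_nbhd E 2 (- ?B)) (M (x, y))"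
      unfolding M_def case_prod_conv
      by (intro supported_add supported_scaleR supported_mult[OF H_band that(1)]
          supported_mono[OF supported_mult[OF GT_band that(2)] closed_nbhd_mono]
          supported_mono[OF supported_mult[OF GT_band supported_subvec[OF supported_mult[OF G_band that(1)]]] 11])
         auto
    then show ?thesis using disj by (rule subvec_eq_0)
  qed
  \<comment> \<open>Inserting the exact equations turns the penalty argument
    \<open>cv + G *v w\<close> into \<open>G *v (w - dx)\<close>, so the exact direction satisfies
    the penalised row without residual.\<close>
  have "?P (M (w, z)) = ?P (M (dx, dl))"
  proof -
    have g: "g = - (H *v dx + transpose G *v dl)" using exact(1) by (metis minus_minus)
    have cv: "cv = - (G *v dx)" using exact(2) by simp
    have "H *v w + g + \<mu> *\<^sub>R (transpose G *v ?R (cv + G *v w)) + transpose G *v z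
        = M (w, z) - M (dx, dl)"
      unfolding M_def g cv case_prod_conv
      by (simp add: subvec_diff subvec_add linear_neg[OF linear_subvec] matrix_vector_right_distrib
          matrix_vector_mult_diff_distrib algebra_simps)
    then show ?thesis using stat by (simp add: subvec_diff)
  qed
  moreover have "fst (sub_kkt W e) = ?P (M (w, z)) - ?P (M (?P dx, ?Q dl))"
    unfolding subvec_diff[symmetric] linear_diff[OF M_lin, symmetric] sub_kkt_def e_def fst_conv snd_conv e_P
    by (simp add: M_def)
  ultimately have "fst (sub_kkt W e) = ?P (M (dx, dl)) - ?P (M (?P dx, ?Q dl))" by (simp only:)
  also have "\<dots> = ?P (M (dx - ?P dx, dl - ?Q dl))"
    unfolding subvec_diff[symmetric] linear_diff[OF M_lin, symmetric] by simp
  also have "(dx - ?P dx, dl - ?Q dl) = (v, u) + (dx - ?P dx - v, dl - ?Q dl - u)" by simp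
  also have "?P (M \<dots>) = ?P (M (v, u)) + ?P (M (dx - ?P dx - v, dl - ?Q dl - u))"
    by (simp only: linear_add[OF M_lin] subvec_add)
  also have "?P (M (dx - ?P dx - v, dl - ?Q dl - u)) = 0"
    using subset_closed_nbhd[of W E 2]
    by (intro M_far) (auto simp: v_def u_def supported_def)
  finally have K1: "fst (sub_kkt W e) = ?P (M (v, u))" by simp
  have near: "closed_nbhd E 1 (- W) \<inter> (W - W_tilde E W) = {}"
    by (auto simp: closed_nbhd_iff in_W_tilde_iff[OF sym] simp del: One_nat_def)
  \<comment> \<open>An interior constraint row involves only variables in \<open>W\<close>, so
    cutting off \<open>dx\<close> outside \<open>W\<close> leaves it intact.\<close>
  have K2: "snd (sub_kkt W e) = 0"
  proof -
    have "supported dn (closed_nbhd E 1 (- W)) (G *v (dx - ?P dx))"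
      by (rule supported_mult[OF G_band]) (auto simp: supported_def)
    then have "?Q (G *v (dx - ?P dx)) = 0" using near by (rule subvec_eq_0)
    moreover have "?Q (G *v (w - dx)) = 0"
      using feas exact(2) by (simp add: matrix_vector_mult_diff_distrib add.commute)
    moreover have "w - ?P dx = (w - dx) + (dx - ?P dx)" by simp
    ultimately show ?thesis
      unfolding sub_kkt_def snd_conv fst_conv e_def e_P by (metis add.right_neutral matrix_vector_right_distrib subvec_add)
  qed
  have Ke: "sub_kkt W e = (?P (M (v, u)), 0)" using K1 K2 by (metis prod.collapse)
  have v_le: "norm v \<le> n" and u_le: "norm u \<le> n"
  proof -
    have "v = subvec pn (- W) (subvec pn ?B dx)"
      "u = subvec dn (- (W - W_tilde E W)) (subvec dn ?B dl)"
      by (auto simp: v_def u_def vec_eq_iff)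
    then show "norm v \<le> n" "norm u \<le> n"
      unfolding n_def
      by (metis norm_subvec_le norm_fst_le norm_snd_le order_trans)+
  qed
  have "norm (sub_kkt W e) \<le> norm (M (v, u))" unfolding Ke by (simp add: norm_Pair norm_subvec_le)
  also have "\<dots> \<le> norm (H *v v) + \<mu> * norm (transpose G *v ?R (G *v v)) + norm (transpose G *v u)"
    unfolding M_def case_prod_conv using mu0
    by (intro order_trans[OF norm_triangle_ineq] add_mono) auto
  also have "\<dots> \<le> N * n + \<mu> * (N * (N * n)) + N * n"
    using N0 mu0
    by (intro add_mono mult_left_mono order_trans[OF GT_le] order_trans[OF H_le]
        order_trans[OF norm_subvec_le] order_trans[OF G_le] v_le u_le) auto
  also have "\<dots> = (N + \<mu> * N\<^sup>2 + N) * n" by (simp add: power2_eq_square algebra_simps)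
  also have "\<dots> \<le> UK * n" using UK_bounds(1) by (intro mult_right_mono) (auto simp: n_def)
  finally have r_le: "norm (sub_kkt W e) \<le> UK * n" .
  have supp: "supp2 (closed_nbhd E 2 (- W)) (sub_kkt W e)"
  proof -
    have v: "supported pn (- W) v" by (auto simp: v_def supported_def)
    have "supported dn (closed_nbhd E 1 (- W)) u"
      using subset_closed_nbhd[of "- W" E 1]
      by (auto simp: u_def supported_def in_W_tilde_iff[OF sym] closed_nbhd_iff simp del: One_nat_def)
    note u = supported_mult[OF GT_band this]
    have 11: "closed_nbhd E 1 (closed_nbhd E 1 (- W)) \<subseteq> closed_nbhd E 2 (- W)"
      using closed_nbhd_closed_nbhd[of E 1 1 "- W"] by (simp add: numeral_2_eq_2)
    have "supported pn (closed_nbhd E 2 (- W)) (M (v, u))"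
      unfolding M_def case_prod_conv
      by (intro supported_add supported_scaleR supported_mult[OF H_band v] supported_mono[OF u 11]
          supported_mono[OF supported_mult[OF GT_band supported_subvec[OF supported_mult[OF G_band v]]] 11])
    then show ?thesis by (simp add: Ke supp2_def supported_subvec)
  qed
  define P where "P = (\<lambda>s. (subvec pn A (fst s), subvec dn A (snd s)))"
  have Pe: "P e = (subvec pn A (w - dx), subvec dn A (z - dl))"
    using A by (auto simp: P_def e_def vec_eq_iff)
  have gU: "\<gamma> \<le> UK" using gam lower_constant_le_one UK_bounds(3) by linarith
  have "norm (P e) \<le> ((UK\<^sup>2 - \<gamma>\<^sup>2) / (UK\<^sup>2 + \<gamma>\<^sup>2)) ^ (b div 4) * (norm (sub_kkt W e) / \<gamma>)"
  proof (rule decay_of_banded_solution[OF linear_sub_kkt subspace_sub_space sub_kkt_in_sub_space sub_kkt_selfadjoint _ norm_sub_kkt_le gam(1) gU _ _ e_S])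
    show "\<gamma> * norm s \<le> norm (sub_kkt W s)" if "s \<in> sub_space W" for s
      using norm_sub_kkt_ge[OF that] mult_right_mono[OF gam(2) norm_ge_zero[of s]] by linarith
    show "linear P" by (simp add: linear_iff P_def subvec_add subvec_scale)
    show "norm (P s) \<le> norm s" for s
    proof -
      have "(norm (P s))\<^sup>2 \<le> (norm (fst s, snd s))\<^sup>2"
        unfolding P_def norm_Pair by (simp add: add_mono power_mono norm_subvec_le)
      then show ?thesis unfolding prod.collapse by (rule power2_le_imp_le) simp
    qed
    fix k assume "k < b div 4"
    \<comment> \<open>\<open>K (K e)\<close> starts within distance 4 of the complement and each
      iterate adds 4, hence the number \<open>b div 4\<close> of admissible iterations.\<close>
    then have k: "4 * k + 4 \<le> b" by linarith
    have "supp2 (closed_nbhd E 4 (- W)) (sub_kkt W (sub_kkt W e))"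
      using supp2_sub_kkt[OF supp] by (rule supp2_mono) (rule order_trans[OF closed_nbhd_closed_nbhd], simp)
    from supp2_residual_iterate[OF this]
    have "supp2 (closed_nbhd E (4 * k + 4) (- W))
      (((\<lambda>s. s - (2 / (UK\<^sup>2 + \<gamma>\<^sup>2)) *\<^sub>R sub_kkt W (sub_kkt W s)) ^^ k) (sub_kkt W (sub_kkt W e)))" .
    then have "supp2 (closed_nbhd E b (- W))
      (((\<lambda>s. s - (2 / (UK\<^sup>2 + \<gamma>\<^sup>2)) *\<^sub>R sub_kkt W (sub_kkt W s)) ^^ k) (sub_kkt W (sub_kkt W e)))"
      by (rule supp2_mono) (rule closed_nbhd_mono[OF k order_refl])
    then show "P (((\<lambda>s. s - (2 / (UK\<^sup>2 + \<gamma>\<^sup>2)) *\<^sub>R sub_kkt W (sub_kkt W s)) ^^ k) (sub_kkt W (sub_kkt W e))) = 0"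
      using far by (auto simp: P_def supp2_def zero_prod_def intro!: subvec_eq_0)
  qed
  also have "\<dots> \<le> ((UK\<^sup>2 - \<gamma>\<^sup>2) / (UK\<^sup>2 + \<gamma>\<^sup>2)) ^ (b div 4) * (UK * n / \<gamma>)"
    using gam(1) gU r_le
    by (intro mult_left_mono divide_right_mono zero_le_power divide_nonneg_nonneg) (auto intro: power_mono)
  finally show ?thesis by (simp add: Pe n_def)
qed

text \<open>The whole graph has no boundary, so \<open>sub_kkt UNIV\<close> is the plain KKT matrix;
  its lower bound makes it injective, hence onto.\<close>

lemma exact_direction_exists:
  obtains dx dl where "H *v dx + transpose G *v dl = - g" "G *v dx = - cv"
proof -
  have nb: "W_tilde E UNIV = {}" "W_hat E UNIV = {}"
    by (auto simp: in_W_tilde_iff[OF sym] in_W_hat_iff[OF sym])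
  have [simp]: "subvec nd UNIV x = x" "subvec nd {} x = 0" for nd :: "'k::finite \<Rightarrow> 'v" and x
    by (auto simp: vec_eq_iff)
  have c: "0 < \<gamma>H * \<gamma>G\<^sup>2 / (17 * UK\<^sup>2)" using gH gG UK_bounds(3) by (intro divide_pos_pos) auto
  have "s = 0" if "sub_kkt UNIV s = 0" for s
  proof -
    have "s \<in> sub_space UNIV" by (simp add: sub_space_def supported_def nb)
    from norm_sub_kkt_ge[OF this] have "\<gamma>H * \<gamma>G\<^sup>2 / (17 * UK\<^sup>2) * norm s \<le> 0" using that by simp
    then show ?thesis using c by (metis mult_pos_pos not_le zero_less_norm_iff)
  qed
  then have "surj (sub_kkt UNIV)"
    using linear_inj_imp_surj[OF linear_sub_kkt] linear_inj_iff_eq_0[OF linear_sub_kkt] by blast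
  then obtain s where "sub_kkt UNIV s = (- g, - cv)" by (metis surjD)
  then show thesis by (intro that[of "fst s" "snd s"]) (auto simp: sub_kkt_def nb)
qed

end

section \<open>Derivatives of the Lagrangian and the augmented Lagrangian\<close>

lemma directional_derivative_zero:
  fixes f :: "'a::real_normed_vector \<Rightarrow> 'b::real_normed_vector"
  assumes D: "(f has_derivative f') (at x)" and e: "0 < e"
    and const: "\<And>s. \<bar>s\<bar> < e \<Longrightarrow> f (x + s *\<^sub>R v) = f x"
  shows "f' v = 0"
proof -
  have l: "((\<lambda>s. x + s *\<^sub>R v) has_derivative (\<lambda>s. s *\<^sub>R v)) (at 0)"
    by (auto intro!: derivative_eq_intros)
  have 1: "((\<lambda>s. f (x + s *\<^sub>R v)) has_derivative (\<lambda>s. f' (s *\<^sub>R v))) (at 0)"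
    using has_derivative_compose[OF l, of f f'] D by simp
  have 2: "((\<lambda>s. f (x + s *\<^sub>R v)) has_derivative (\<lambda>s. 0)) (at 0)"
    by (rule has_derivative_transform_within_open[of "\<lambda>_. f x" _ _ _ "{-e<..<e}"])
       (use e in \<open>auto simp: const abs_less_iff\<close>)
  have "(\<lambda>s. f' (s *\<^sub>R v)) = (\<lambda>s. 0)" by (rule has_derivative_unique[OF 1 2])
  from fun_cong[OF this, of 1] show ?thesis by simp
qed

text \<open>\<open>g' x v\<close> is the derivative at \<open>x\<close> in direction
  \<open>v\<close>, and \<open>g'' v x w\<close> differentiates it once more in direction
  \<open>w\<close>. Continuity is asked for fixed directions, a form that is kept by sums over
  nodes.\<close>

definition C2_data ::
  "'a::real_normed_vector set \<Rightarrow> ('a \<Rightarrow> 'b::real_normed_vector) \<Rightarrow> ('a \<Rightarrow> 'a \<Rightarrow> 'b) \<Rightarrow> ('a \<Rightarrow> 'a \<Rightarrow> 'a \<Rightarrow> 'b) \<Rightarrow> bool" where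
  "C2_data U g g' g'' \<longleftrightarrow> (\<forall>x\<in>U. (g has_derivative g' x) (at x)
      \<and> (\<forall>v. ((\<lambda>y. g' y v) has_derivative g'' v x) (at x)))
    \<and> (\<forall>v w. continuous_on U (\<lambda>x. g'' v x w))"

lemma Ck_on_imp_C2_data:
  assumes "Ck_on 3 U g"
  shows "C2_data U g (\<lambda>x. frechet_derivative g (at x))
    (\<lambda>v x. frechet_derivative (\<lambda>y. frechet_derivative g (at y) v) (at x))"
  using assms unfolding C2_data_def numeral_3_eq_3 Ck_on.simps
  by (auto simp: frechet_derivative_works[symmetric]
      intro!: continuous_at_imp_continuous_on differentiable_imp_continuous_within)

lemma C2_data_sum:
  assumes "\<And>i. i \<in> I \<Longrightarrow> C2_data U (g i) (g' i) (g'' i)"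
  shows "C2_data U (\<lambda>x. \<Sum>i\<in>I. g i x) (\<lambda>x v. \<Sum>i\<in>I. g' i x v) (\<lambda>v x w. \<Sum>i\<in>I. g'' i v x w)"
  using assms unfolding C2_data_def
  by (auto intro!: has_derivative_sum continuous_on_sum)

locale smooth_nlp =
  fixes f :: "'v::finite \<Rightarrow> real ^ 'p::finite \<Rightarrow> real" and c :: "real ^ 'p \<Rightarrow> real ^ 'd::finite"
    and U :: "(real ^ 'p) set"
    and F' :: "real ^ 'p \<Rightarrow> real ^ 'p \<Rightarrow> real" and F'' :: "real ^ 'p \<Rightarrow> real ^ 'p \<Rightarrow> real ^ 'p \<Rightarrow> real"
    and c' :: "real ^ 'p \<Rightarrow> real ^ 'p \<Rightarrow> real ^ 'd" and c'' :: "real ^ 'p \<Rightarrow> real ^ 'p \<Rightarrow> real ^ 'p \<Rightarrow> real ^ 'd"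
  assumes open_U: "open U"
    and F_data: "C2_data U (\<lambda>y. \<Sum>i\<in>UNIV. f i y) F' F''"
    and c_data: "C2_data U c c' c''"
begin

lemma F_deriv: "y \<in> U \<Longrightarrow> ((\<lambda>y. \<Sum>i\<in>UNIV. f i y) has_derivative F' y) (at y)"
  and F'_deriv: "y \<in> U \<Longrightarrow> ((\<lambda>y. F' y v) has_derivative F'' v y) (at y)"
  and F''_cont: "continuous_on U (\<lambda>y. F'' v y w)"
  using F_data by (auto simp: C2_data_def)

lemma c_deriv: "y \<in> U \<Longrightarrow> (c has_derivative c' y) (at y)"
  and c'_deriv: "y \<in> U \<Longrightarrow> ((\<lambda>y. c' y v) has_derivative c'' v y) (at y)"
  and c''_cont: "continuous_on U (\<lambda>y. c'' v y w)"
  using c_data by (auto simp: C2_data_def)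

text \<open>An explicit formula through the derivative data, to which differentiation rules apply.
  It agrees with \<open>grad_x_Lagr\<close> on \<open>U\<close>, and openness of \<open>U\<close>
  transports derivatives back.\<close>

definition grad_x :: "real ^ 'p \<Rightarrow> real ^ 'd \<Rightarrow> real ^ 'p" where
  "grad_x y l = (\<Sum>b\<in>Basis. (F' y b + l \<bullet> c' y b) *\<^sub>R b)"

lemma grad_x_inner: assumes y: "y \<in> U" shows "grad_x y l \<bullet> u = F' y u + l \<bullet> c' y u"
proof -
  have lin: "linear (\<lambda>u. F' y u + l \<bullet> c' y u)"
    using has_derivative_linear[OF F_deriv[OF y]] has_derivative_linear[OF c_deriv[OF y]]
    by (simp add: linear_iff inner_add_right algebra_simps)
  have "F' y u + l \<bullet> c' y u = (\<lambda>u. F' y u + l \<bullet> c' y u) (\<Sum>b\<in>Basis. (u \<bullet> b) *\<^sub>R b)"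
    by (simp add: euclidean_representation)
  also have "\<dots> = (\<Sum>b\<in>Basis. (u \<bullet> b) * (F' y b + l \<bullet> c' y b))"
    unfolding linear_sum[OF lin] linear_scale[OF lin] by simp
  finally show ?thesis by (simp add: grad_x_def inner_sum_left inner_commute[of u] mult.commute)
qed

lemma Lagr_has_derivative:
  assumes "y \<in> U"
  shows "((\<lambda>y. Lagr f c y l) has_derivative (\<lambda>u. grad_x y l \<bullet> u)) (at y)"
  unfolding grad_x_inner[OF assms] Lagr_def
  by (intro has_derivative_add bounded_linear.has_derivative[OF bounded_linear_inner_right] F_deriv c_deriv assms)

lemma grad_x_Lagr_eq: "y \<in> U \<Longrightarrow> grad_x_Lagr f c y l = grad_x y l"
  unfolding grad_x_Lagr_def by (rule grad_eqI[OF Lagr_has_derivative])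

lemma grad_lam_Lagr_eq: "grad_lam_Lagr f c y l = c y"
  unfolding grad_lam_Lagr_def Lagr_def
  by (rule grad_eqI) (auto intro!: derivative_eq_intros simp: inner_commute)

lemma Lagr_joint_has_derivative:
  assumes "y \<in> U"
  shows "((\<lambda>(y, l). Lagr f c y l) has_derivative (\<lambda>h. (grad_x y l, c y) \<bullet> h)) (at (y, l))"
proof -
  have fst': "((\<lambda>z. fst z) has_derivative fst) (at (y, l))" and snd': "((\<lambda>z. snd z) has_derivative snd) (at (y, l))"
    by (auto intro!: derivative_eq_intros)
  have F: "((\<lambda>z. \<Sum>i\<in>UNIV. f i (fst z)) has_derivative (\<lambda>h. F' y (fst h))) (at (y, l))"
    using has_derivative_compose[OF fst', of "\<lambda>y. \<Sum>i\<in>UNIV. f i y" "F' y"] F_deriv[OF assms] by simp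
  have c: "((\<lambda>z. c (fst z)) has_derivative (\<lambda>h. c' y (fst h))) (at (y, l))"
    using has_derivative_compose[OF fst', of c "c' y"] c_deriv[OF assms] by simp
  have "((\<lambda>z. (\<Sum>i\<in>UNIV. f i (fst z)) + snd z \<bullet> c (fst z)) has_derivative
      (\<lambda>h. F' y (fst h) + (l \<bullet> c' y (fst h) + snd h \<bullet> c y))) (at (y, l))"
    using has_derivative_add[OF F has_derivative_inner[OF snd' c]] by simp
  moreover have "(grad_x y l, c y) \<bullet> h = F' y (fst h) + (l \<bullet> c' y (fst h) + snd h \<bullet> c y)" for h
    by (simp add: inner_prod_def grad_x_inner[OF assms] inner_commute[of "c y"])
  ultimately show ?thesis by (simp add: Lagr_def case_prod_unfold)
qed

lemma grad_Lagr_eq: "y \<in> U \<Longrightarrow> grad (\<lambda>(y, l). Lagr f c y l) (y, l) = (grad_x y l, c y)"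
  by (rule grad_eqI[OF Lagr_joint_has_derivative])

lemma con_jac_mult: assumes "y \<in> U" shows "con_jac c y *v u = c' y u"
proof -
  have "(c has_derivative (\<lambda>h. con_jac c y *v h)) (at y)"
    unfolding con_jac_def using c_deriv[OF assms] jacobian_works differentiableI by blast
  from has_derivative_unique[OF this c_deriv[OF assms]] show ?thesis by (rule fun_cong)
qed

lemma con_jac_transpose_mult:
  assumes "y \<in> U" shows "transpose (con_jac c y) *v w = (\<Sum>b\<in>Basis. (w \<bullet> c' y b) *\<^sub>R b)"
  by (rule euclidean_eqI) (simp add: transpose_inner con_jac_mult[OF assms] inner_sum_left_Basis)

lemma grad_x_has_derivative:
  assumes y: "y \<in> U"
  shows "((\<lambda>y. grad_x y l) has_derivative (\<lambda>u. \<Sum>b\<in>Basis. (F'' b y u + l \<bullet> c'' b y u) *\<^sub>R b)) (at y)"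
  unfolding grad_x_def by (auto intro!: derivative_eq_intros F'_deriv[OF y] c'_deriv[OF y])

lemma grad_x_Lagr_has_derivative:
  assumes y: "y \<in> U"
  shows "((\<lambda>y. grad_x_Lagr f c y l) has_derivative
    (\<lambda>u. \<Sum>b\<in>Basis. (F'' b y u + l \<bullet> c'' b y u) *\<^sub>R b)) (at y)"
  using grad_x_has_derivative[OF y, of l]
  by (rule has_derivative_transform_within_open[OF _ open_U y]) (simp add: grad_x_Lagr_eq)

lemma Lagr_hess_mult:
  assumes y: "y \<in> U"
  shows "Lagr_hess f c y l *v u = (\<Sum>b\<in>Basis. (F'' b y u + l \<bullet> c'' b y u) *\<^sub>R b)"
proof -
  have "((\<lambda>y. grad_x_Lagr f c y l) has_derivative (\<lambda>h. Lagr_hess f c y l *v h)) (at y)"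
    unfolding Lagr_hess_def
    using grad_x_Lagr_has_derivative[OF y, of l] jacobian_works differentiableI by blast
  from has_derivative_unique[OF this grad_x_Lagr_has_derivative[OF y]] show ?thesis by (rule fun_cong)
qed

lemma grad_x_joint_has_derivative:
  assumes y: "y \<in> U"
  shows "((\<lambda>z. grad_x (fst z) (snd z)) has_derivative
    (\<lambda>h. Lagr_hess f c y l *v fst h + transpose (con_jac c y) *v snd h)) (at (y, l))"
proof -
  have fst': "((\<lambda>z. fst z) has_derivative fst) (at (y, l))" and snd': "((\<lambda>z. snd z) has_derivative snd) (at (y, l))"
    by (auto intro!: derivative_eq_intros)
  have F: "((\<lambda>z. F' (fst z) b) has_derivative (\<lambda>h. F'' b y (fst h))) (at (y, l))" for b
    using has_derivative_compose[OF fst', of "\<lambda>y. F' y b" "F'' b y"] F'_deriv[OF y] by simp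
  have c: "((\<lambda>z. c' (fst z) b) has_derivative (\<lambda>h. c'' b y (fst h))) (at (y, l))" for b
    using has_derivative_compose[OF fst', of "\<lambda>y. c' y b" "c'' b y"] c'_deriv[OF y] by simp
  have "((\<lambda>z. F' (fst z) b + snd z \<bullet> c' (fst z) b) has_derivative
      (\<lambda>h. F'' b y (fst h) + (l \<bullet> c'' b y (fst h) + snd h \<bullet> c' y b))) (at (y, l))" for b
    using has_derivative_add[OF F has_derivative_inner[OF snd' c]] by simp
  then have "((\<lambda>z. grad_x (fst z) (snd z)) has_derivative
      (\<lambda>h. \<Sum>b\<in>Basis. (F'' b y (fst h) + (l \<bullet> c'' b y (fst h) + snd h \<bullet> c' y b)) *\<^sub>R b)) (at (y, l))"
    unfolding grad_x_def by (intro has_derivative_sum has_derivative_scaleR_left)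
  then show ?thesis
    by (simp add: Lagr_hess_mult[OF y] con_jac_transpose_mult[OF y] algebra_simps sum.distrib)
qed

text \<open>\<open>transpose H\<close> is the adjoint produced by differentiating the squared norm
  of \<open>grad_x\<close>; the terms with \<open>G\<close> arise in the same way from the two
  penalties.\<close>

definition aug_grad :: "real \<Rightarrow> real \<Rightarrow> (real ^ 'p) \<times> (real ^ 'd) \<Rightarrow> (real ^ 'p) \<times> (real ^ 'd)" where
  "aug_grad \<eta>1 \<eta>2 z = (let y = fst z; l = snd z; G = con_jac c y; H = Lagr_hess f c y l in
     (grad_x y l + \<eta>1 *\<^sub>R (transpose G *v c y) + \<eta>2 *\<^sub>R (transpose H *v grad_x y l),
      c y + \<eta>2 *\<^sub>R (G *v grad_x y l)))"

lemma aug_grad_inner: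
  "aug_grad \<eta>1 \<eta>2 (y, l) \<bullet> h = grad_x y l \<bullet> fst h + c y \<bullet> snd h + \<eta>1 * (c y \<bullet> (con_jac c y *v fst h))
    + \<eta>2 * (grad_x y l \<bullet> (Lagr_hess f c y l *v fst h + transpose (con_jac c y) *v snd h))"
proof -
  have "(con_jac c y *v grad_x y l) \<bullet> snd h = grad_x y l \<bullet> (transpose (con_jac c y) *v snd h)"
    by (metis inner_commute transpose_inner)
  then show ?thesis
    by (simp add: aug_grad_def Let_def inner_prod_def inner_add transpose_inner algebra_simps)
qed

lemma aug_Lagr_has_derivative:
  assumes y: "y \<in> U"
  shows "(aug_Lagr f c \<eta>1 \<eta>2 has_derivative (\<lambda>h. aug_grad \<eta>1 \<eta>2 (y, l) \<bullet> h)) (at (y, l))"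
proof -
  have fst': "((\<lambda>z. fst z) has_derivative fst) (at (y, l))"
    by (auto intro!: derivative_eq_intros)
  have c: "((\<lambda>z. c (fst z)) has_derivative (\<lambda>h. con_jac c y *v fst h)) (at (y, l))"
    using has_derivative_compose[OF fst', of c "c' y"] c_deriv[OF y] by (simp add: con_jac_mult[OF y])
  have sq: "((\<lambda>z. (norm (g z))\<^sup>2) has_derivative (\<lambda>h. 2 * (g z0 \<bullet> g' h))) (at z0)"
    if "(g has_derivative g') (at z0)"
    for g :: "(real ^ 'p) \<times> (real ^ 'd) \<Rightarrow> 'e::real_inner" and g' z0
    using has_derivative_inner[OF that that] unfolding power2_norm_eq_inner by (simp add: inner_commute)
  have "((\<lambda>z. Lagr f c (fst z) (snd z) + \<eta>1 / 2 * (norm (c (fst z)))\<^sup>2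
      + \<eta>2 / 2 * (norm (grad_x (fst z) (snd z)))\<^sup>2) has_derivative
      (\<lambda>h. (grad_x y l, c y) \<bullet> h + \<eta>1 / 2 * (2 * (c y \<bullet> (con_jac c y *v fst h)))
        + \<eta>2 / 2 * (2 * (grad_x y l \<bullet> (Lagr_hess f c y l *v fst h + transpose (con_jac c y) *v snd h))))) (at (y, l))"
    using Lagr_joint_has_derivative[OF y, of l, unfolded case_prod_unfold]
      sq[OF c] sq[OF grad_x_joint_has_derivative[OF y, of l]]
    by (intro has_derivative_add has_derivative_mult_right) (auto)
  then have "((\<lambda>z. Lagr f c (fst z) (snd z) + \<eta>1 / 2 * (norm (c (fst z)))\<^sup>2
      + \<eta>2 / 2 * (norm (grad_x (fst z) (snd z)))\<^sup>2) has_derivative (\<lambda>h. aug_grad \<eta>1 \<eta>2 (y, l) \<bullet> h)) (at (y, l))"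
    unfolding aug_grad_inner by (simp add: inner_prod_def)
  moreover have "open (U \<times> (UNIV :: (real ^ 'd) set))" by (intro open_Times open_U open_UNIV)
  ultimately show ?thesis
    by (rule has_derivative_transform_within_open)
       (auto simp: y aug_Lagr_def grad_lam_Lagr_eq grad_x_Lagr_eq)
qed

lemma grad_aug_Lagr_eq: "y \<in> U \<Longrightarrow> grad (aug_Lagr f c \<eta>1 \<eta>2) (y, l) = aug_grad \<eta>1 \<eta>2 (y, l)"
  by (rule grad_eqI[OF aug_Lagr_has_derivative])

text \<open>Pairing with a fixed \<open>h\<close> makes every matrix act either on a constant
  vector, where continuity of directional derivatives is enough; the gradient is then reassembled
  from its components.\<close>

lemma continuous_grad_aug_Lagr: "continuous_on (U \<times> UNIV) (grad (aug_Lagr f c \<eta>1 \<eta>2))"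
proof -
  let ?D = "U \<times> (UNIV :: (real ^ 'd) set)"
  have cfst: "continuous_on ?D (\<lambda>z. \<phi> (fst z))"
    if "continuous_on U \<phi>" for \<phi> :: "real ^ 'p \<Rightarrow> 'e::topological_space"
    by (rule continuous_on_compose2[OF that continuous_on_fst[OF continuous_on_id]]) auto
  have cd: "continuous_on U \<phi>" if "\<And>y. y \<in> U \<Longrightarrow> (\<phi> has_derivative \<phi>' y) (at y)"
    for \<phi> :: "real ^ 'p \<Rightarrow> 'e::real_normed_vector" and \<phi>'
    by (rule continuous_at_imp_continuous_on) (use that has_derivative_continuous in blast)
  note cc = cfst[OF cd[OF c_deriv]] and cc' = cfst[OF cd[OF c'_deriv]] and cF' = cfst[OF cd[OF F'_deriv]]
    and cF'' = cfst[OF F''_cont] and cc'' = cfst[OF c''_cont]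
  have g: "continuous_on ?D (\<lambda>z. grad_x (fst z) (snd z))"
    unfolding grad_x_def by (intro continuous_intros cF' cc')
  have H: "continuous_on ?D (\<lambda>z. Lagr_hess f c (fst z) (snd z) *v u)" for u
  proof -
    have "continuous_on ?D (\<lambda>z. \<Sum>b\<in>Basis. (F'' b (fst z) u + snd z \<bullet> c'' b (fst z) u) *\<^sub>R b)"
      by (intro continuous_intros cF'' cc'')
    then show ?thesis by (rule continuous_on_eq) (auto simp: Lagr_hess_mult)
  qed
  have GT: "continuous_on ?D (\<lambda>z. transpose (con_jac c (fst z)) *v w)" for w
  proof -
    have "continuous_on ?D (\<lambda>z. \<Sum>b\<in>Basis. (w \<bullet> c' (fst z) b) *\<^sub>R b)"
      by (intro continuous_intros cc')
    then show ?thesis by (rule continuous_on_eq) (auto simp: con_jac_transpose_mult)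
  qed
  have G: "continuous_on ?D (\<lambda>z. con_jac c (fst z) *v u)" for u
    by (rule continuous_on_eq[OF cc']) (auto simp: con_jac_mult)
  have "continuous_on ?D (\<lambda>z. grad (aug_Lagr f c \<eta>1 \<eta>2) z \<bullet> h)" for h
  proof -
    have "continuous_on ?D (\<lambda>z. grad_x (fst z) (snd z) \<bullet> fst h + c (fst z) \<bullet> snd h
        + \<eta>1 * (c (fst z) \<bullet> (con_jac c (fst z) *v fst h))
        + \<eta>2 * (grad_x (fst z) (snd z) \<bullet> (Lagr_hess f c (fst z) (snd z) *v fst h + transpose (con_jac c (fst z)) *v snd h)))"
      by (intro continuous_intros g cc G GT H)
    then show ?thesis by (rule continuous_on_eq) (auto simp: grad_aug_Lagr_eq aug_grad_inner)
  qed
  then have "continuous_on ?D (\<lambda>z. \<Sum>b\<in>Basis. (grad (aug_Lagr f c \<eta>1 \<eta>2) z \<bullet> b) *\<^sub>R b)"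
    by (intro continuous_on_sum continuous_on_scaleR continuous_on_const)
  then show ?thesis by (simp add: euclidean_representation)
qed

end

section \<open>Sparsity of the Jacobian and of the Hessian\<close>

locale graph_nlp = smooth_nlp f c U F' F'' c' c''
  for f :: "'v::finite \<Rightarrow> real ^ 'p::finite \<Rightarrow> real" and c :: "real ^ 'p \<Rightarrow> real ^ 'd::finite" and U F' F'' c' c'' +
  fixes E :: "('v \<times> 'v) set" and pn :: "'p \<Rightarrow> 'v" and dn :: "'d \<Rightarrow> 'v"
  assumes sym: "sym E"
    and f_local: "\<And>i. depends_only_on pn (closed_nbhd E 1 {i}) (f i)"
    and c_local: "\<And>i. depends_only_on pn (closed_nbhd E 1 {i}) (\<lambda>y. subvec dn {i} (c y))"
begin

lemma f_shift: "\<not> gdist E (pn a) i \<le> enat 1 \<Longrightarrow> f i (y + s *\<^sub>R axis a 1) = f i y"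
  using f_local[of i] unfolding depends_only_on_def
  by (erule_tac x = "y + s *\<^sub>R axis a 1" in allE, erule_tac x = y in allE)
     (auto simp: axis_def closed_nbhd_iff simp del: One_nat_def)

lemma c_shift:
  assumes "\<not> gdist E (pn a) (dn k) \<le> enat 1"
  shows "c (y + s *\<^sub>R axis a 1) $ k = c y $ k"
proof -
  have "subvec dn {dn k} (c (y + s *\<^sub>R axis a 1)) = subvec dn {dn k} (c y)"
    using c_local[of "dn k"] assms unfolding depends_only_on_def
    by (erule_tac x = "y + s *\<^sub>R axis a 1" in allE, erule_tac x = y in allE)
       (auto simp: axis_def closed_nbhd_iff simp del: One_nat_def)
  then have "subvec dn {dn k} (c (y + s *\<^sub>R axis a 1)) $ k = subvec dn {dn k} (c y) $ k" by simp
  then show ?thesis by simp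
qed

lemma banded_con_jac:
  assumes y: "y \<in> U"
  shows "banded E 1 dn pn (con_jac c y)"
  unfolding banded_def
proof (intro allI impI, rule ccontr)
  fix k a assume nz: "con_jac c y $ k $ a \<noteq> 0" and "\<not> gdist E (dn k) (pn a) \<le> enat 1"
  then have far: "\<not> gdist E (pn a) (dn k) \<le> enat 1" by (simp only: gdist_sym[OF sym] not_False_eq_True)
  have "((\<lambda>y. c y $ k) has_derivative (\<lambda>h. (con_jac c y *v h) $ k)) (at y)"
    using c_deriv[OF y] unfolding con_jac_mult[OF y] by (rule bounded_linear.has_derivative[OF bounded_linear_vec_nth])
  from directional_derivative_zero[OF this zero_less_one c_shift[OF far]]
  have "(con_jac c y *v axis a 1) $ k = 0" .
  then show False using nz by (simp add: matrix_vector_mult_basis column_def)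
qed

text \<open>No single \<open>f i\<close> or constraint component sees two coordinates more than
  distance 2 apart. Hence the increment of the Lagrangian along axis \<open>b\<close> is unchanged
  by shifts along axis \<open>a\<close> (\<open>diff2\<close>); differentiating in \<open>a\<close>
  shows that component \<open>a\<close> of the gradient is locally constant along axis
  \<open>b\<close>.\<close>

lemma banded_Lagr_hess:
  assumes y: "y \<in> U"
  shows "banded E 2 pn pn (Lagr_hess f c y l)"
  unfolding banded_def
proof (intro allI impI, rule ccontr)
  fix a b assume nz: "Lagr_hess f c y l $ a $ b \<noteq> 0" and far: "\<not> gdist E (pn a) (pn b) \<le> enat 2"
  have split: "\<not> gdist E (pn a) i \<le> enat 1 \<or> \<not> gdist E (pn b) i \<le> enat 1" for i
    using far gdist_triangle[of E "pn a" i 1 "pn b" 1, unfolded one_add_one] gdist_sym[OF sym, of "pn b" i]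
    by metis
  have diff2: "Lagr f c (y + r *\<^sub>R axis a 1 + s *\<^sub>R axis b 1) l - Lagr f c (y + r *\<^sub>R axis a 1) l
      = Lagr f c (y + s *\<^sub>R axis b 1) l - Lagr f c y l" for r s
  proof -
    have *: "y + r *\<^sub>R axis a 1 + s *\<^sub>R axis b 1 = (y + s *\<^sub>R axis b 1) + r *\<^sub>R axis a 1" by simp
    have f: "f i (y + r *\<^sub>R axis a 1 + s *\<^sub>R axis b 1) - f i (y + r *\<^sub>R axis a 1)
        = f i (y + s *\<^sub>R axis b 1) - f i y" for i
    proof (cases "gdist E (pn a) i \<le> enat 1")
      case True
      then have "\<not> gdist E (pn b) i \<le> enat 1" using split[of i] by blast
      then show ?thesis by (simp only: f_shift not_False_eq_True)
    next
      case False
      then show ?thesis by (simp only: * f_shift not_False_eq_True)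
    qed
    have c: "c (y + r *\<^sub>R axis a 1 + s *\<^sub>R axis b 1) $ k - c (y + r *\<^sub>R axis a 1) $ k
        = c (y + s *\<^sub>R axis b 1) $ k - c y $ k" for k
    proof (cases "gdist E (pn a) (dn k) \<le> enat 1")
      case True
      then have "\<not> gdist E (pn b) (dn k) \<le> enat 1" using split[of "dn k"] by blast
      then show ?thesis by (simp only: c_shift not_False_eq_True)
    next
      case False
      then show ?thesis by (simp only: * c_shift not_False_eq_True)
    qed
    have "c (y + r *\<^sub>R axis a 1 + s *\<^sub>R axis b 1) - c (y + r *\<^sub>R axis a 1)
        = c (y + s *\<^sub>R axis b 1) - c y"
      unfolding vec_eq_iff using c by simp
    then have "l \<bullet> c (y + r *\<^sub>R axis a 1 + s *\<^sub>R axis b 1) - l \<bullet> c (y + r *\<^sub>R axis a 1)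
        = l \<bullet> c (y + s *\<^sub>R axis b 1) - l \<bullet> c y"
      by (simp add: inner_diff_right[symmetric])
    moreover have "(\<Sum>i\<in>UNIV. f i (y + r *\<^sub>R axis a 1 + s *\<^sub>R axis b 1)) - (\<Sum>i\<in>UNIV. f i (y + r *\<^sub>R axis a 1))
        = (\<Sum>i\<in>UNIV. f i (y + s *\<^sub>R axis b 1)) - (\<Sum>i\<in>UNIV. f i y)"
      unfolding sum_subtractf[symmetric] f ..
    ultimately show ?thesis by (simp add: Lagr_def)
  qed
  obtain e where e: "0 < e" "ball y e \<subseteq> U" using open_U y open_contains_ball by blast
  have const: "grad_x_Lagr f c (y + s *\<^sub>R axis b 1) l $ a = grad_x_Lagr f c y l $ a" if "\<bar>s\<bar> < e" for s
  proof -
    have ys: "y + s *\<^sub>R axis b 1 \<in> U" using e that by (auto simp: dist_norm norm_axis_1 subset_iff)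
    have sh: "((\<lambda>z. z + s *\<^sub>R axis b 1) has_derivative (\<lambda>u. u)) (at y)"
      by (auto intro!: derivative_eq_intros)
    have 1: "((\<lambda>z. Lagr f c (z + s *\<^sub>R axis b 1) l) has_derivative (\<lambda>u. grad_x (y + s *\<^sub>R axis b 1) l \<bullet> u)) (at y)"
      using has_derivative_compose[OF sh Lagr_has_derivative[OF ys]] .
    have "grad_x (y + s *\<^sub>R axis b 1) l \<bullet> axis a 1 - grad_x y l \<bullet> axis a 1 = 0"
      by (rule directional_derivative_zero[OF has_derivative_diff[OF 1 Lagr_has_derivative[OF y]] zero_less_one diff2])
    then show ?thesis by (simp add: grad_x_Lagr_eq y ys inner_axis)
  qed
  have "((\<lambda>y. grad_x_Lagr f c y l $ a) has_derivative (\<lambda>h. (Lagr_hess f c y l *v h) $ a)) (at y)"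
    using grad_x_Lagr_has_derivative[OF y, of l] unfolding Lagr_hess_mult[OF y]
    by (rule bounded_linear.has_derivative[OF bounded_linear_vec_nth])
  from directional_derivative_zero[OF this e(1) const]
  have "(Lagr_hess f c y l *v axis b 1) $ a = 0" .
  then show False using nz by (simp add: matrix_vector_mult_basis column_def)
qed

end

section \<open>Descent along the exact and the approximate direction\<close>

context banded_kkt
begin

lemma newton_direction_bounds:
  assumes exact: "H *v dx + transpose G *v dl = - g" "G *v dx = - cv"
  shows "norm g \<le> 2 * N * norm (dx, dl)" "norm cv \<le> N * norm (dx, dl)"
proof -
  have x: "norm dx \<le> norm (dx, dl)" and l: "norm dl \<le> norm (dx, dl)"
    by (rule norm_fst_le norm_snd_le)+
  have "norm g = norm (H *v dx + transpose G *v dl)" using exact(1) by simp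
  also have "\<dots> \<le> N * norm dx + N * norm dl"
    by (intro order_trans[OF norm_triangle_ineq] add_mono H_le GT_le)
  also have "\<dots> \<le> N * norm (dx, dl) + N * norm (dx, dl)" using N x l by (intro add_mono mult_left_mono) auto
  finally show "norm g \<le> 2 * N * norm (dx, dl)" by simp
  have "norm cv = norm (G *v dx)" using exact(2) by simp
  also have "\<dots> \<le> N * norm (dx, dl)" using N x by (intro order_trans[OF G_le] mult_left_mono) auto
  finally show "norm cv \<le> N * norm (dx, dl)" .
qed

text \<open>A budget in \<open>a\<close>, \<open>b\<close> (kernel and range part of
  \<open>dx\<close>), \<open>L\<close> (dual part) and \<open>C\<close> (constraints). Of the 9
  units \<open>1 / (\<eta>2 * \<gamma>G)\<close> in \<eta>1, 8 absorb the cross term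
  \<open>2 * (cv \<bullet> dl)\<close> and 1 pays for \<open>b\<close>. The bound on \<eta>2 limits
  its loss in \<open>dx\<close> to \<open>5 / 14 * \<gamma>H\<close>, below the
  \<open>3 / 4 * \<gamma>H\<close> available for the kernel part.\<close>

lemma newton_descent:
  fixes Hl :: "real ^ 'p ^ 'p"
  assumes exact: "H *v dx + transpose G *v dl = - g" "G *v dx = - cv"
    and Hl: "\<And>x. norm (Hl *v x) \<le> N * norm x"
    and eta2: "0 < \<eta>2" "\<eta>2 \<le> \<gamma>H / (7 * N\<^sup>2)" and eta1: "9 / (\<eta>2 * \<gamma>G) \<le> \<eta>1"
  shows "g \<bullet> dx + cv \<bullet> dl + \<eta>1 * (cv \<bullet> (G *v dx)) + \<eta>2 * (g \<bullet> (Hl *v dx + transpose G *v dl))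
    \<le> - (\<eta>2 * \<gamma>G / 8) * (norm (dx, dl))\<^sup>2"
proof -
  obtain u y where dx: "dx = u + transpose G *v y" and u: "G *v u = 0" by (rule kernel_range_decomp)
  define v where "v = transpose G *v y"
  define a b where "a = (norm u)\<^sup>2" and "b = (norm v)\<^sup>2"
  define L C where "L = (norm dl)\<^sup>2" and "C = (norm cv)\<^sup>2"
  define Z where "Z = N\<^sup>2 / \<gamma>H"
  have nonneg: "0 \<le> a" "0 \<le> b" "0 \<le> L" "0 \<le> C" by (auto simp: a_def b_def L_def C_def)
  have N2: "1 \<le> N\<^sup>2" "N \<le> N\<^sup>2" using N one_le_power[OF N, of 2] by (auto simp: power2_eq_square)
  have X: "(norm dx)\<^sup>2 = a + b"
    unfolding dx a_def b_def v_def by (rule kernel_range_orthogonal[OF u])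
  have NZ: "N\<^sup>2 \<le> Z" unfolding Z_def using gH by (simp add: le_divide_eq mult_left_le)
  have g: "g = - (H *v dx + transpose G *v dl)" using exact(1) by (metis minus_minus)
  have e1: "g \<bullet> dx = - (dx \<bullet> (H *v dx)) + cv \<bullet> dl"
    using transpose_inner[of G dl dx] exact(2)
    by (simp add: g inner_add_left inner_diff_left inner_commute[of dx] inner_commute[of cv])
  have e2: "cv \<bullet> (G *v dx) = - C" using exact(2) by (simp add: C_def power2_norm_eq_inner)
  \<comment> \<open>The term \<open>- (norm g)\<^sup>2\<close> drives the decrease in the dual step,
    through \<open>b2\<close>. The mismatch of the true Hessian \<open>Hl\<close> and the modified
    \<open>H\<close> is charged to half of it and to \<open>dx\<close> in \<open>b1\<close>.\<close>
  have e3: "g \<bullet> (Hl *v dx + transpose G *v dl) = g \<bullet> (Hl *v dx - H *v dx) - (norm g)\<^sup>2"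
  proof -
    have "transpose G *v dl = - g - H *v dx" using exact(1) by (simp add: algebra_simps)
    then show ?thesis by (simp add: inner_diff_right inner_add_right power2_norm_eq_inner)
  qed
  have b1: "g \<bullet> (Hl *v dx - H *v dx) \<le> (norm g)\<^sup>2 / 2 + 2 * N\<^sup>2 * (a + b)"
  proof -
    have "norm (Hl *v dx - H *v dx) \<le> 2 * N * norm dx"
      using norm_triangle_ineq4[of "Hl *v dx" "H *v dx"] Hl[of dx] H_le[of dx] by simp
    then have "g \<bullet> (Hl *v dx - H *v dx) \<le> norm g * (2 * N * norm dx)"
      by (intro order_trans[OF norm_cauchy_schwarz] mult_left_mono) auto
    also have "\<dots> \<le> (norm g)\<^sup>2 / 2 + (2 * N * norm dx)\<^sup>2 / 2"
      using sum_squares_bound[of "norm g" "2 * N * norm dx"] by simp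
    also have "(2 * N * norm dx)\<^sup>2 / 2 = 2 * N\<^sup>2 * (a + b)" by (simp add: power_mult_distrib X)
    finally show ?thesis .
  qed
  have b2: "\<gamma>G * L \<le> 2 * (norm g)\<^sup>2 + 2 * N\<^sup>2 * (a + b)"
  proof -
    have "transpose G *v dl = - (g + H *v dx)" using exact(1) by (simp add: algebra_simps)
    then have "norm (transpose G *v dl) = norm (g + H *v dx)" by (simp only: norm_minus_cancel)
    then have "norm (transpose G *v dl) \<le> norm g + N * norm dx"
      using norm_triangle_ineq[of g "H *v dx"] H_le[of dx] by linarith
    then have "(norm (transpose G *v dl))\<^sup>2 \<le> (norm g + N * norm dx)\<^sup>2" by (intro power_mono) auto
    also have "\<dots> \<le> 2 * (norm g)\<^sup>2 + 2 * (N * norm dx)\<^sup>2"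
      using sum_squares_bound[of "norm g" "N * norm dx"] by (simp add: power2_sum)
    also have "(N * norm dx)\<^sup>2 = N\<^sup>2 * (a + b)" by (simp add: power_mult_distrib X)
    finally show ?thesis using A2[of dl] by (simp add: L_def)
  qed
  have b3: "\<eta>2 * (g \<bullet> (Hl *v dx + transpose G *v dl)) \<le> - (\<eta>2 * \<gamma>G / 4) * L + 5 / 14 * \<gamma>H * (a + b)"
  proof -
    have "g \<bullet> (Hl *v dx + transpose G *v dl) \<le> - (\<gamma>G / 4) * L + 5 / 2 * (N\<^sup>2 * (a + b))"
      unfolding e3 using b1 b2 by (simp add: algebra_simps)
    then have "\<eta>2 * (g \<bullet> (Hl *v dx + transpose G *v dl)) \<le> \<eta>2 * (- (\<gamma>G / 4) * L + 5 / 2 * (N\<^sup>2 * (a + b)))"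
      using eta2(1) by (intro mult_left_mono) auto
    also have "\<dots> = - (\<eta>2 * \<gamma>G / 4) * L + 5 / 2 * ((\<eta>2 * N\<^sup>2) * (a + b))" by (simp add: algebra_simps)
    also have "(\<eta>2 * N\<^sup>2) * (a + b) \<le> (\<gamma>H / 7) * (a + b)"
    proof (intro mult_right_mono)
      have "0 < 7 * N\<^sup>2" using N2(1) by linarith
      then have "\<eta>2 * (7 * N\<^sup>2) \<le> \<gamma>H" using eta2(2) by (simp only: pos_le_divide_eq)
      then show "\<eta>2 * N\<^sup>2 \<le> \<gamma>H / 7" by simp
    qed (use nonneg in auto)
    finally show ?thesis by (simp add: algebra_simps)
  qed
  have eg: "0 < \<eta>2 * \<gamma>G" using eta2 gG by simp
  have b4: "2 * (cv \<bullet> dl) \<le> \<eta>2 * \<gamma>G / 8 * L + 8 / (\<eta>2 * \<gamma>G) * C"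
  proof -
    have "0 \<le> (\<eta>2 * \<gamma>G * norm dl - 8 * norm cv)\<^sup>2 / (8 * (\<eta>2 * \<gamma>G))" using eg by simp
    also have "\<dots> = \<eta>2 * \<gamma>G / 8 * L + 8 / (\<eta>2 * \<gamma>G) * C - 2 * (norm cv * norm dl)"
      using less_imp_neq[OF eta2(1)] less_imp_neq[OF gG(1)]
      by (simp add: power2_diff power_mult_distrib L_def C_def divide_simps)
         (simp add: algebra_simps power2_eq_square)
    finally show ?thesis using norm_cauchy_schwarz[of cv dl] by linarith
  qed
  have b5: "9 / (\<eta>2 * \<gamma>G) * C \<le> \<eta>1 * C" using eta1 nonneg by (intro mult_right_mono) auto
  have b6: "- (dx \<bullet> (H *v dx)) \<le> - \<gamma>H * a + \<gamma>H / 4 * a + 4 * Z * b + N * b"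
    using quadratic_form_lower[OF u, of "\<gamma>H / 4" v] gH
    by (simp add: dx v_def[symmetric] a_def b_def Z_def)
  \<comment> \<open>The range part collects at most \<open>4 * Z\<close>, \<open>N\<close>,
    \<open>5 / 14 * \<gamma>H\<close> and \<open>\<gamma>H / 8\<close>, all within
    \<open>7 * Z\<close>.\<close>
  have b7: "7 * Z * b \<le> 1 / (\<eta>2 * \<gamma>G) * C"
  proof -
    have "\<gamma>G * b \<le> C"
    proof -
      have "G *v v = - cv" using exact(2) u by (simp add: dx v_def matrix_vector_right_distrib)
      then show ?thesis using G_lower_on_range[of y] by (simp add: v_def[symmetric] b_def C_def)
    qed
    have "0 < 7 * N\<^sup>2" using N2(1) by linarith
    then have "\<eta>2 * (7 * N\<^sup>2) \<le> \<gamma>H" using eta2(2) by (simp only: pos_le_divide_eq)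
    then have "7 * Z \<le> 1 / \<eta>2" using eta2(1) gH unfolding Z_def by (simp add: field_simps)
    then have "7 * Z * b \<le> 1 / \<eta>2 * b" using nonneg by (intro mult_right_mono) auto
    also have "\<dots> = 1 / (\<eta>2 * \<gamma>G) * (\<gamma>G * b)" using gG by simp
    also have "\<dots> \<le> 1 / (\<eta>2 * \<gamma>G) * C" using eg \<open>\<gamma>G * b \<le> C\<close> by (intro mult_left_mono) auto
    finally show ?thesis .
  qed
  have "\<eta>2 * \<gamma>G \<le> \<gamma>H"
  proof -
    have "\<eta>2 * \<gamma>G \<le> \<eta>2 * 1" using eta2 gG by (intro mult_left_mono) auto
    also have "\<eta>2 * 1 \<le> \<gamma>H / (7 * N\<^sup>2)" using eta2 by simp
    also have "\<dots> \<le> \<gamma>H / 1" using gH N2 by (intro divide_left_mono) auto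
    finally show ?thesis by simp
  qed
  then have b8: "\<eta>2 * \<gamma>G / 8 * a \<le> \<gamma>H / 8 * a" "\<eta>2 * \<gamma>G / 8 * b \<le> \<gamma>H / 8 * b"
    using nonneg by (auto intro!: mult_right_mono)
  have b9: "\<gamma>H * b \<le> Z * b" "N * b \<le> Z * b" "0 \<le> \<gamma>H * a" "0 \<le> Z * b"
    using NZ N2 gH nonneg by (auto intro!: mult_right_mono)
  have "g \<bullet> dx + cv \<bullet> dl + \<eta>1 * (cv \<bullet> (G *v dx)) + \<eta>2 * (g \<bullet> (Hl *v dx + transpose G *v dl))
      \<le> (- \<gamma>H * a + \<gamma>H / 4 * a + 4 * Z * b + N * b) + (\<eta>2 * \<gamma>G / 8 * L + 8 / (\<eta>2 * \<gamma>G) * C)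
        - 9 / (\<eta>2 * \<gamma>G) * C + (- (\<eta>2 * \<gamma>G / 4) * L + 5 / 14 * \<gamma>H * (a + b))"
    using b3 b4 b5 b6 unfolding e1 e2 by linarith
  also have "\<dots> = - (11 / 28) * (\<gamma>H * a) + 4 * (Z * b) + N * b + 5 / 14 * (\<gamma>H * b)
      - 1 / (\<eta>2 * \<gamma>G) * C - \<eta>2 * \<gamma>G / 8 * L"
    by (simp add: algebra_simps diff_divide_distrib[symmetric])
  also have "\<dots> \<le> - (\<eta>2 * \<gamma>G / 8) * (a + b + L)"
  proof -
    have "- (\<eta>2 * \<gamma>G / 8) * (a + b + L) = - (\<eta>2 * \<gamma>G / 8 * a) - \<eta>2 * \<gamma>G / 8 * b - \<eta>2 * \<gamma>G / 8 * L"
      by (simp add: algebra_simps)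
    then show ?thesis using b7 b8 b9 by linarith
  qed
  also have "a + b + L = (norm (dx, dl))\<^sup>2" by (simp add: norm_Pair X[symmetric] L_def)
  finally show ?thesis .
qed

text \<open>The gradient of the augmented Lagrangian is at most
  \<open>17 / 16 * \<eta>1 * N\<^sup>2\<close> times the exact direction in norm, so the 17 in the
  bound on \<delta> lets the perturbation cost at most half of the rate
  \<open>\<eta>2 * \<gamma>G / 8\<close>.\<close>

lemma inexact_newton_descent:
  fixes Hl :: "real ^ 'p ^ 'p"
  assumes exact: "H *v dx + transpose G *v dl = - g" "G *v dx = - cv"
    and Hl: "\<And>x. norm (Hl *v x) \<le> N * norm x"
    and eta2: "0 < \<eta>2" "\<eta>2 \<le> \<gamma>H / (7 * N\<^sup>2)" and eta1: "9 / (\<eta>2 * \<gamma>G) \<le> \<eta>1"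
    and delta: "\<delta> \<le> \<eta>2 * \<gamma>G / (17 * \<eta>1 * N\<^sup>2)"
    and err: "norm ((ex, el) - (dx, dl)) \<le> \<delta> * norm (dx, dl)"
  shows "(g + \<eta>1 *\<^sub>R (transpose G *v cv) + \<eta>2 *\<^sub>R (transpose Hl *v g), cv + \<eta>2 *\<^sub>R (G *v g)) \<bullet> (ex, el)
    \<le> - (\<eta>2 * \<gamma>G / 16) * (norm (dx, dl))\<^sup>2"
proof -
  define n where "n = norm (dx, dl)"
  define D where "D = (g + \<eta>1 *\<^sub>R (transpose G *v cv) + \<eta>2 *\<^sub>R (transpose Hl *v g), cv + \<eta>2 *\<^sub>R (G *v g))"
  have n0: "0 \<le> n" by (simp add: n_def)
  have N2: "1 \<le> N\<^sup>2" "N \<le> N\<^sup>2" using N one_le_power[OF N, of 2] by (auto simp: power2_eq_square)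
  have g_le: "norm g \<le> 2 * N * n" and c_le: "norm cv \<le> N * n"
    using newton_direction_bounds[OF exact] by (auto simp: n_def)
  have eN: "\<eta>2 * N\<^sup>2 \<le> 1 / 7"
  proof -
    have "0 < 7 * N\<^sup>2" using N2(1) by linarith
    then have "\<eta>2 * (7 * N\<^sup>2) \<le> \<gamma>H" using eta2(2) by (simp only: pos_le_divide_eq)
    then have "\<eta>2 * N\<^sup>2 \<le> \<gamma>H / 7" by simp
    then show ?thesis using gH by linarith
  qed
  \<comment> \<open>This makes \<open>\<eta>1 / 16\<close> larger than the 25 / 7 collected from all
    other terms of \<open>D\<close>.\<close>
  have e63: "63 \<le> \<eta>1"
  proof -
    have "\<eta>2 * \<gamma>G \<le> 1 / 7 * 1"
    proof (rule mult_mono)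
      have "\<eta>2 * 1 \<le> \<eta>2 * N\<^sup>2" using eta2 N2 by (intro mult_left_mono) auto
      then show "\<eta>2 \<le> 1 / 7" using eN by linarith
    qed (use gG in auto)
    then have "9 / (1 / 7) \<le> 9 / (\<eta>2 * \<gamma>G)" using eta2 gG by (intro divide_left_mono) auto
    then have "63 \<le> 9 / (\<eta>2 * \<gamma>G)" by simp
    also note eta1
    finally show ?thesis .
  qed
  have D_le: "norm D \<le> 17 / 16 * \<eta>1 * N\<^sup>2 * n"
  proof -
    have "norm D \<le> norm (g + \<eta>1 *\<^sub>R (transpose G *v cv) + \<eta>2 *\<^sub>R (transpose Hl *v g)) + norm (cv + \<eta>2 *\<^sub>R (G *v g))"
      unfolding D_def by (rule norm_Pair_le)
    also have "\<dots> \<le> (norm g + \<eta>1 * norm (transpose G *v cv) + \<eta>2 * norm (transpose Hl *v g))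
        + (norm cv + \<eta>2 * norm (G *v g))"
      using e63 eta2(1) by (intro add_mono order_trans[OF norm_triangle_ineq]) auto
    also have "\<dots> \<le> (2 * N * n + \<eta>1 * (N * (N * n)) + \<eta>2 * (N * (2 * N * n))) + (N * n + \<eta>2 * (N * (2 * N * n)))"
      using e63 eta2(1) N
      by (intro add_mono mult_left_mono g_le c_le order_trans[OF GT_le] order_trans[OF G_le]
          order_trans[OF norm_transpose_bound[OF Hl]]) auto
    also have "\<dots> = 3 * (N * n) + \<eta>1 * N\<^sup>2 * n + 4 * ((\<eta>2 * N\<^sup>2) * n)"
      by (simp add: power2_eq_square algebra_simps)
    also have "\<dots> \<le> 3 * (N\<^sup>2 * n) + \<eta>1 * N\<^sup>2 * n + 4 * (1 / 7 * (N\<^sup>2 * n))"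
    proof (intro add_mono mult_left_mono)
      show "N * n \<le> N\<^sup>2 * n" using N2 n0 by (intro mult_right_mono) auto
      have "\<eta>2 * N\<^sup>2 * n \<le> 1 / 7 * n" using eN n0 by (intro mult_right_mono) auto
      also have "\<dots> \<le> 1 / 7 * (N\<^sup>2 * n)" using N2 n0 mult_right_mono[of 1 "N\<^sup>2" n] by simp
      finally show "\<eta>2 * N\<^sup>2 * n \<le> 1 / 7 * (N\<^sup>2 * n)" .
    qed (use e63 in auto)
    also have "\<dots> = \<eta>1 * N\<^sup>2 * n + 25 / 7 * (N\<^sup>2 * n)" by simp
    also have "25 / 7 * (N\<^sup>2 * n) \<le> \<eta>1 / 16 * (N\<^sup>2 * n)" using e63 N2 n0 by (intro mult_right_mono) auto
    finally show ?thesis by (simp add: mult_ac)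
  qed
  have "D \<bullet> (dx, dl) \<le> - (\<eta>2 * \<gamma>G / 8) * n\<^sup>2"
  proof -
    have "(G *v g) \<bullet> dl = g \<bullet> (transpose G *v dl)" by (metis inner_commute transpose_inner)
    then have "D \<bullet> (dx, dl) = g \<bullet> dx + cv \<bullet> dl + \<eta>1 * (cv \<bullet> (G *v dx)) + \<eta>2 * (g \<bullet> (Hl *v dx + transpose G *v dl))"
      by (simp add: D_def inner_prod_def inner_add transpose_inner algebra_simps)
    then show ?thesis using newton_descent[OF exact Hl eta2 eta1] by (simp add: n_def)
  qed
  moreover have "D \<bullet> ((ex, el) - (dx, dl)) \<le> \<eta>2 * \<gamma>G / 16 * n\<^sup>2"
  proof -
    have "D \<bullet> ((ex, el) - (dx, dl)) \<le> norm D * norm ((ex, el) - (dx, dl))" by (rule norm_cauchy_schwarz)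
    also have "\<dots> \<le> (17 / 16 * \<eta>1 * N\<^sup>2 * n) * (\<eta>2 * \<gamma>G / (17 * \<eta>1 * N\<^sup>2) * n)"
    proof (rule mult_mono[OF D_le])
      show "norm ((ex, el) - (dx, dl)) \<le> \<eta>2 * \<gamma>G / (17 * \<eta>1 * N\<^sup>2) * n"
        using err mult_right_mono[OF delta n0] by (simp add: n_def)
      show "0 \<le> 17 / 16 * \<eta>1 * N\<^sup>2 * n" using e63 n0 by simp
    qed simp
    also have "\<dots> = \<eta>2 * \<gamma>G / 16 * n\<^sup>2"
      using e63 N by (simp add: divide_simps) (simp add: power2_eq_square algebra_simps)
    finally show ?thesis .
  qed
  moreover have "D \<bullet> (ex, el) = D \<bullet> (dx, dl) + D \<bullet> ((ex, el) - (dx, dl))"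
    by (simp add: inner_diff_right del: diff_Pair)
  ultimately show ?thesis unfolding D_def[symmetric] n_def[symmetric] by (simp add: algebra_simps)
qed

end

section \<open>Error of the composed direction\<close>

lemma norm_sq_partition:
  fixes nd :: "'k::finite \<Rightarrow> 'v"
  assumes fin: "finite L" and disj: "disjoint_family_on V L" and cover: "(\<Union>l\<in>L. V l) = UNIV"
    and eq: "\<And>l k. l \<in> L \<Longrightarrow> nd k \<in> V l \<Longrightarrow> x $ k = y l $ k"
  shows "(norm x)\<^sup>2 = (\<Sum>l\<in>L. (norm (subvec nd (V l) (y l)))\<^sup>2)"
proof -
  have "(\<Sum>l\<in>L. if nd k \<in> V l then (y l $ k)\<^sup>2 else 0) = (x $ k)\<^sup>2" for k
  proof -
    obtain l where l: "l \<in> L" "nd k \<in> V l" using cover by blast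
    have "(\<Sum>l'\<in>L. if nd k \<in> V l' then (y l' $ k)\<^sup>2 else 0) = (\<Sum>l'\<in>L. if l' = l then (x $ k)\<^sup>2 else 0)"
      using l disj by (intro sum.cong) (auto simp: eq disjoint_family_on_def)
    then show ?thesis using fin l by simp
  qed
  then show ?thesis
    unfolding norm_subvec_sq norm_sq_vec[of x] by (subst sum.swap) simp
qed

lemma sum_norm_overlap_le:
  fixes nd :: "'k::finite \<Rightarrow> 'v" and x :: "real ^ 'k"
  assumes fin: "finite L" and count: "\<And>i. real (card {l \<in> L. i \<in> B l}) \<le> m"
  shows "(\<Sum>l\<in>L. (norm (subvec nd (B l) x))\<^sup>2) \<le> m * (norm x)\<^sup>2"
proof -
  have "(\<Sum>l\<in>L. (norm (subvec nd (B l) x))\<^sup>2) = (\<Sum>k\<in>UNIV. \<Sum>l\<in>L. if nd k \<in> B l then (x $ k)\<^sup>2 else 0)"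
    unfolding norm_subvec_sq by (rule sum.swap)
  also have "\<dots> = (\<Sum>k\<in>UNIV. real (card {l \<in> L. nd k \<in> B l}) * (x $ k)\<^sup>2)"
    using fin by (simp add: sum.If_cases Int_def)
  also have "\<dots> \<le> (\<Sum>k\<in>UNIV. m * (x $ k)\<^sup>2)" by (intro sum_mono mult_right_mono count) auto
  finally show ?thesis by (simp add: norm_sq_vec sum_distrib_left)
qed

text \<open>On \<open>V l\<close> the composed direction is the local solution, so squared local
  errors add up over the partition. The right-hand sides overlap, each node being counted at most
  \<open>m\<close> times, whence \<open>sqrt m\<close>.\<close>

lemma (in banded_kkt) composed_direction_error:
  assumes exact: "H *v dx + transpose G *v dl = - g" "G *v dx = - cv"
    and fin: "finite L" and disj: "disjoint_family_on V L" and cover: "(\<Union>l\<in>L. V l) = UNIV"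
    and b: "1 \<le> b" and W: "\<And>l. l \<in> L \<Longrightarrow> closed_nbhd E b (V l) \<subseteq> W l"
    and w: "\<And>l. l \<in> L \<Longrightarrow> supported pn (W l) (w l)"
    and z: "\<And>l. l \<in> L \<Longrightarrow> supported dn (W l - W_tilde E (W l)) (z l)"
    and stat: "\<And>l. l \<in> L \<Longrightarrow> subvec pn (W l) (H *v w l + g
      + \<mu> *\<^sub>R (transpose G *v subvec dn (W_hat E (W l)) (cv + G *v w l)) + transpose G *v z l) = 0"
    and feas: "\<And>l. l \<in> L \<Longrightarrow> subvec dn (W l - W_tilde E (W l)) (cv + G *v w l) = 0"
    and gam: "0 < \<gamma>" "\<gamma> \<le> \<gamma>H * \<gamma>G\<^sup>2 / (17 * UK\<^sup>2)"
    and ex: "\<And>l k. l \<in> L \<Longrightarrow> pn k \<in> V l \<Longrightarrow> ex $ k = w l $ k"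
    and el: "\<And>l k. l \<in> L \<Longrightarrow> dn k \<in> V l \<Longrightarrow> el $ k = z l $ k"
    and count: "\<And>i. real (card {l \<in> L. i \<in> closed_nbhd E 2 (W l)}) \<le> m"
  shows "norm ((ex, el) - (dx, dl))
    \<le> ((UK\<^sup>2 - \<gamma>\<^sup>2) / (UK\<^sup>2 + \<gamma>\<^sup>2)) ^ (b div 4) * (UK / \<gamma>) * sqrt m * norm (dx, dl)"
proof -
  define K where "K = ((UK\<^sup>2 - \<gamma>\<^sup>2) / (UK\<^sup>2 + \<gamma>\<^sup>2)) ^ (b div 4) * (UK / \<gamma>)"
  have m0: "0 \<le> m" using count order_trans[OF of_nat_0_le_iff] by blast
  have block: "(norm (subvec pn (V l) (w l - dx)))\<^sup>2 + (norm (subvec dn (V l) (z l - dl)))\<^sup>2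
      \<le> K\<^sup>2 * ((norm (subvec pn (closed_nbhd E 2 (W l)) dx))\<^sup>2 + (norm (subvec dn (closed_nbhd E 2 (W l)) dl))\<^sup>2)"
    if l: "l \<in> L" for l
  proof -
    have far: "V l \<inter> closed_nbhd E b (- W l) = {}"
    proof (rule ccontr)
      assume "\<not> ?thesis"
      then obtain i j where ij: "i \<in> V l" "j \<notin> W l" "gdist E i j \<le> enat b" by (auto simp: closed_nbhd_iff)
      then have "j \<in> closed_nbhd E b (V l)" using gdist_sym[OF sym, of i j] by (auto simp: closed_nbhd_iff)
      then show False using W[OF l] ij by blast
    qed
    \<comment> \<open>Here \<open>b \<ge> 1\<close> matters: it keeps \<open>V l\<close> off the
      inner boundary, so the local multiplier is available on all of \<open>V l\<close>.\<close>
    have A: "V l \<subseteq> W l - W_tilde E (W l)"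
    proof -
      have "V l \<subseteq> W l" using W[OF l] subset_closed_nbhd[of "V l" E b] by blast
      moreover have "closed_nbhd E 1 (- W l) \<subseteq> closed_nbhd E b (- W l)" using b by (intro closed_nbhd_mono) auto
      ultimately show ?thesis
        using far by (fastforce simp: in_W_tilde_iff[OF sym] closed_nbhd_iff simp del: One_nat_def)
    qed
    have "norm (subvec pn (V l) (w l - dx), subvec dn (V l) (z l - dl))
        \<le> K * norm (subvec pn (closed_nbhd E 2 (W l)) dx, subvec dn (closed_nbhd E 2 (W l)) dl)"
      using subproblem_error[OF exact w[OF l] z[OF l] stat[OF l] feas[OF l] far A gam] by (simp add: K_def)
    then have "(norm (subvec pn (V l) (w l - dx), subvec dn (V l) (z l - dl)))\<^sup>2
        \<le> (K * norm (subvec pn (closed_nbhd E 2 (W l)) dx, subvec dn (closed_nbhd E 2 (W l)) dl))\<^sup>2"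
      by (intro power_mono) auto
    then show ?thesis by (simp add: norm_Pair power_mult_distrib)
  qed
  have "(norm ((ex, el) - (dx, dl)))\<^sup>2 = (norm (ex - dx))\<^sup>2 + (norm (el - dl))\<^sup>2" by (simp add: norm_Pair)
  also have "\<dots> = (\<Sum>l\<in>L. (norm (subvec pn (V l) (w l - dx)))\<^sup>2) + (\<Sum>l\<in>L. (norm (subvec dn (V l) (z l - dl)))\<^sup>2)"
    using ex el
    by (intro arg_cong2[where f = "(+)"] norm_sq_partition[OF fin disj cover]) auto
  also have "\<dots> \<le> (\<Sum>l\<in>L. K\<^sup>2 * ((norm (subvec pn (closed_nbhd E 2 (W l)) dx))\<^sup>2
      + (norm (subvec dn (closed_nbhd E 2 (W l)) dl))\<^sup>2))"
    unfolding sum.distrib[symmetric] by (intro sum_mono block)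
  also have "\<dots> = K\<^sup>2 * ((\<Sum>l\<in>L. (norm (subvec pn (closed_nbhd E 2 (W l)) dx))\<^sup>2)
      + (\<Sum>l\<in>L. (norm (subvec dn (closed_nbhd E 2 (W l)) dl))\<^sup>2))"
    by (simp only: sum_distrib_left[symmetric] sum.distrib)
  also have "\<dots> \<le> K\<^sup>2 * (m * (norm dx)\<^sup>2 + m * (norm dl)\<^sup>2)"
    by (intro mult_left_mono add_mono sum_norm_overlap_le fin count) auto
  also have "\<dots> = (K * sqrt m * norm (dx, dl))\<^sup>2"
    using m0 by (simp add: norm_Pair power_mult_distrib algebra_simps)
  finally have "(norm ((ex, el) - (dx, dl)))\<^sup>2 \<le> (K * sqrt m * norm (dx, dl))\<^sup>2" .
  moreover have "0 \<le> K"
  proof -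
    have "\<gamma> \<le> UK" using gam lower_constant_le_one UK_bounds(3) by linarith
    then show ?thesis unfolding K_def using gam(1) UK_bounds(3)
      by (intro mult_nonneg_nonneg zero_le_power divide_nonneg_nonneg) (auto intro: power_mono)
  qed
  ultimately have "norm ((ex, el) - (dx, dl)) \<le> K * sqrt m * norm (dx, dl)"
    using m0 by (intro power2_le_imp_le[of "norm ((ex, el) - (dx, dl))"]) auto
  then show ?thesis by (simp add: K_def)
qed

text \<open>The stationarity clause of \<open>sub_solution\<close> becomes the first KKT row;
  symmetry of \<open>Hh\<close> merges the two halves of the differentiated quadratic form.\<close>

lemma sub_solution_stationary:
  assumes H: "transpose Hh = Hh" and sol: "sub_solution E pn dn \<mu> W Hh G g cv w z"
  shows "supported pn W w" "supported dn (W - W_tilde E W) z"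
    "subvec pn W (Hh *v w + g + \<mu> *\<^sub>R (transpose G *v subvec dn (W_hat E W) (cv + G *v w))
      + transpose G *v z) = 0"
    "subvec dn (W - W_tilde E W) (cv + G *v w) = 0"
proof -
  let ?P = "subvec pn W" and ?Q = "subvec dn (W - W_tilde E W)" and ?R = "subvec dn (W_hat E W)"
  have Pw: "?P w = w" and Qz: "?Q z = z" and con: "sub_con E pn dn W G cv w = 0"
    and gr: "grad (\<lambda>u. sub_obj E pn dn \<mu> W Hh G g cv u + z \<bullet> sub_con E pn dn W G cv u) w = 0"
    using sol by (auto simp: sub_solution_def)
  show "supported pn W w" "supported dn (W - W_tilde E W) z"
    using Pw Qz by (auto simp: subvec_id_iff)
  show "?Q (cv + G *v w) = 0" using con by (simp add: sub_con_def submat_mult Pw subvec_add)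
  define LH where "LH = (\<lambda>u. ?P (Hh *v ?P u))"
  define LR where "LR = (\<lambda>u. ?R (G *v ?P u))"
  define LQ where "LQ = (\<lambda>u. ?Q (G *v ?P u))"
  have lin: "linear LH" "linear LR" "linear LQ"
    by (simp_all add: linear_iff LH_def LR_def LQ_def subvec_add subvec_scale
        matrix_vector_right_distrib matrix_vector_mult_scaleR)
  then have D: "(LH has_derivative LH) (at w)" "(LR has_derivative LR) (at w)" "(LQ has_derivative LQ) (at w)"
    by (simp_all add: linear_conv_bounded_linear bounded_linear_imp_has_derivative)
  have sq: "((\<lambda>u. (norm (k u))\<^sup>2) has_derivative (\<lambda>h. 2 * (k w \<bullet> k' h))) (at w)"
    if "(k has_derivative k') (at w)" for k :: "real ^ 'a \<Rightarrow> real ^ 'c" and k'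
    using has_derivative_inner[OF that that] unfolding power2_norm_eq_inner by (simp add: inner_commute)
  define v where "v = ?P (Hh *v w + g + \<mu> *\<^sub>R (transpose G *v ?R (cv + G *v w)) + transpose G *v z)"
  have obj: "(\<lambda>u. sub_obj E pn dn \<mu> W Hh G g cv u + z \<bullet> sub_con E pn dn W G cv u)
      = (\<lambda>u. 1 / 2 * (u \<bullet> LH u) + u \<bullet> ?P g + \<mu> / 2 * (norm (?R cv + LR u))\<^sup>2 + z \<bullet> (?Q cv + LQ u))"
    by (simp add: fun_eq_iff sub_obj_def sub_con_def submat_mult LH_def LR_def LQ_def)
  have DR: "((\<lambda>u. ?R cv + LR u) has_derivative LR) (at w)"
    and DQ: "((\<lambda>u. ?Q cv + LQ u) has_derivative LQ) (at w)"
    using has_derivative_add[OF has_derivative_const D(2)] has_derivative_add[OF has_derivative_const D(3)]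
    by simp_all
  have "((\<lambda>u. sub_obj E pn dn \<mu> W Hh G g cv u + z \<bullet> sub_con E pn dn W G cv u) has_derivative
      (\<lambda>h. 1 / 2 * (w \<bullet> LH h + h \<bullet> LH w) + h \<bullet> ?P g + \<mu> / 2 * (2 * ((?R cv + LR w) \<bullet> LR h)) + z \<bullet> LQ h)) (at w)"
    unfolding obj
    by (intro has_derivative_add has_derivative_mult_right has_derivative_inner[OF has_derivative_ident D(1)]
        bounded_linear.has_derivative[OF bounded_linear_inner_right DQ]
        bounded_linear.has_derivative[OF bounded_linear_inner_left has_derivative_ident] sq[OF DR])
  moreover have "1 / 2 * (w \<bullet> LH h + h \<bullet> LH w) + h \<bullet> ?P g + \<mu> / 2 * (2 * ((?R cv + LR w) \<bullet> LR h)) + z \<bullet> LQ h = v \<bullet> h" for h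
  proof -
    have "w \<bullet> LH h = ?P w \<bullet> (Hh *v ?P h)" by (simp only: LH_def subvec_inner)
    also have "\<dots> = (transpose Hh *v w) \<bullet> ?P h" by (simp only: Pw transpose_inner)
    also have "\<dots> = LH w \<bullet> h" by (simp only: H LH_def Pw subvec_inner)
    finally have "w \<bullet> LH h = LH w \<bullet> h" .
    moreover have "z \<bullet> LQ h = ?P (transpose G *v z) \<bullet> h"
    proof -
      have "z \<bullet> LQ h = ?Q z \<bullet> (G *v ?P h)" by (simp only: LQ_def subvec_inner)
      also have "\<dots> = ?P (transpose G *v z) \<bullet> h" by (simp only: Qz transpose_inner subvec_inner)
      finally show ?thesis .
    qed
    moreover have "(?R cv + LR w) \<bullet> LR h = ?P (transpose G *v ?R (cv + G *v w)) \<bullet> h"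
    proof -
      have "(?R cv + LR w) \<bullet> LR h = ?R (?R cv + LR w) \<bullet> (G *v ?P h)" by (simp only: LR_def subvec_inner)
      also have "?R (?R cv + LR w) = ?R (cv + G *v w)" by (simp add: LR_def Pw subvec_add subvec_subvec)
      also have "?R (cv + G *v w) \<bullet> (G *v ?P h) = ?P (transpose G *v ?R (cv + G *v w)) \<bullet> h"
        by (simp only: transpose_inner subvec_inner)
      finally show ?thesis .
    qed
    ultimately show ?thesis
      by (simp add: v_def subvec_add subvec_scale inner_add_left LH_def Pw inner_commute[of h])
  qed
  ultimately have "grad (\<lambda>u. sub_obj E pn dn \<mu> W Hh G g cv u + z \<bullet> sub_con E pn dn W G cv u) w = v"
    by (intro grad_eqI) simp
  then show "?P (Hh *v w + g + \<mu> *\<^sub>R (transpose G *v ?R (cv + G *v w)) + transpose G *v z) = 0"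
    using gr by (simp add: v_def)
qed

section \<open>Overlap counting and comparison with the decay constant\<close>

lemma polynomial_growth_ball:
  assumes "polynomial_growth E b M W pW pG"
  shows "real (card {j. gdist E i j \<le> enat n}) \<le> poly pG (real n)"
proof -
  have "gdist E i j \<le> enat n \<longleftrightarrow> ereal_of_enat (gdist E i j) \<le> ereal (real n)" for j
    using ereal_of_enat_le_iff[of "gdist E i j" "enat n"] by simp
  then show ?thesis using assms by (simp add: polynomial_growth_def)
qed

text \<open>The \<open>W l\<close> containing \<open>j\<close> inject into a ball around
  \<open>j\<close>: pick a node in each nonempty \<open>V l\<close>; these parts are disjoint, and
  the node shares \<open>W l\<close> with \<open>j\<close>. Sets that are merely near
  \<open>i\<close> are reached through a ball of radius 2.\<close>

lemma overlap_count:
  fixes E :: "('v::finite \<times> 'v) set"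
  assumes growth: "polynomial_growth E b M W pW pG" and disj: "disjoint_family_on V {1..M}"
    and VW: "\<And>l. l \<in> {1..M} \<Longrightarrow> V l \<subseteq> W l" and ne: "\<And>l. l \<in> L \<Longrightarrow> V l \<noteq> {}" and L: "L \<subseteq> {1..M}"
  shows "real (card {l \<in> L. i \<in> closed_nbhd E 2 (W l)}) \<le> poly pG (real (b + 2)) * poly pG (poly pW (real b))"
proof -
  have finL: "finite L" using L finite_subset by blast
  have one: "real (card {l \<in> L. j \<in> W l}) \<le> poly pG (poly pW (real b))" for j
  proof -
    define v where "v = (\<lambda>l. SOME k. k \<in> V l)"
    have v: "v l \<in> V l" if "l \<in> L" for l
      unfolding v_def using ne[OF that] some_in_eq by blast
    have "inj_on v {l \<in> L. j \<in> W l}"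
    proof (rule inj_onI, rule ccontr)
      fix l l' assume *: "l \<in> {l \<in> L. j \<in> W l}" "l' \<in> {l \<in> L. j \<in> W l}" "v l = v l'" "l \<noteq> l'"
      then have "V l \<inter> V l' = {}" using disj L unfolding disjoint_family_on_def by blast
      moreover have "v l \<in> V l" "v l' \<in> V l'" using *(1,2) by (auto intro: v)
      ultimately show False using *(3) by auto
    qed
    moreover have "v ` {l \<in> L. j \<in> W l} \<subseteq> {k. ereal_of_enat (gdist E j k) \<le> ereal (poly pW (real b))}"
    proof safe
      fix l assume l: "l \<in> L" "j \<in> W l"
      then have "v l \<in> W l" using v VW L by blast
      then show "ereal_of_enat (gdist E j (v l)) \<le> ereal (poly pW (real b))"
        using growth l L unfolding polynomial_growth_def by blast
    qed
    ultimately have "card {l \<in> L. j \<in> W l} \<le> card {k. ereal_of_enat (gdist E j k) \<le> ereal (poly pW (real b))}"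
      by (intro card_inj_on_le) auto
    moreover have "real (card {k. ereal_of_enat (gdist E j k) \<le> ereal (poly pW (real b))}) \<le> poly pG (poly pW (real b))"
      using growth by (simp add: polynomial_growth_def)
    ultimately show ?thesis by linarith
  qed
  let ?B = "{j. gdist E i j \<le> enat 2}"
  have "{l \<in> L. i \<in> closed_nbhd E 2 (W l)} \<subseteq> (\<Union>j\<in>?B. {l \<in> L. j \<in> W l})" by (auto simp: closed_nbhd_iff)
  then have "card {l \<in> L. i \<in> closed_nbhd E 2 (W l)} \<le> card (\<Union>j\<in>?B. {l \<in> L. j \<in> W l})"
    using finL by (intro card_mono) auto
  also have "\<dots> \<le> (\<Sum>j\<in>?B. card {l \<in> L. j \<in> W l})" by (rule card_UN_le) simp
  finally have "real (card {l \<in> L. i \<in> closed_nbhd E 2 (W l)}) \<le> real (\<Sum>j\<in>?B. card {l \<in> L. j \<in> W l})"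
    by (rule of_nat_mono)
  also have "\<dots> = (\<Sum>j\<in>?B. real (card {l \<in> L. j \<in> W l}))" by (rule of_nat_sum)
  also have "\<dots> \<le> (\<Sum>j\<in>?B. poly pG (poly pW (real b)))" by (intro sum_mono one)
  also have "\<dots> = real (card ?B) * poly pG (poly pW (real b))" by simp
  also have "\<dots> \<le> poly pG (real (b + 2)) * poly pG (poly pW (real b))"
  proof (rule mult_right_mono)
    \<comment> \<open>Radius 2 is enlarged to \<open>b + 2\<close> to match the factor in
      \<open>Ups_mu_b\<close>.\<close>
    have "gdist E i j \<le> enat (b + 2)" if "gdist E i j \<le> enat 2" for j
      using that by (rule order_trans) simp
    then have "?B \<subseteq> {j. gdist E i j \<le> enat (b + 2)}" by blast
    then have "card ?B \<le> card {j. gdist E i j \<le> enat (b + 2)}" by (intro card_mono) auto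
    then show "real (card ?B) \<le> poly pG (real (b + 2))"
      using polynomial_growth_ball[OF growth, of i "b + 2"] by linarith
    show "0 \<le> poly pG (poly pW (real b))" using one order_trans[OF of_nat_0_le_iff] by blast
  qed
  finally show ?thesis .
qed

text \<open>With \<open>\<rho> ^ 4 = \<theta>\<close>, rounding in \<open>b div 4\<close> costs at
  most \<open>\<rho> ^ 3\<close>, the power of \<rho> in the denominator on the right. The surplus
  factors there, \<open>sqrt 2 / sqrt (1 - \<rho>\<^sup>2)\<close> and a second
  \<open>U / \<gamma>\<close>, are at least 1, and \<open>A\<close> dominates its root.\<close>

lemma decay_factor_le_delta:
  fixes U \<gamma> A B :: real and b :: nat
  assumes g: "0 < \<gamma>" "\<gamma> < U" and AB: "1 \<le> A" "1 \<le> B"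
  defines "\<theta> \<equiv> (U\<^sup>2 - \<gamma>\<^sup>2) / (U\<^sup>2 + \<gamma>\<^sup>2)"
  defines "\<rho> \<equiv> \<theta> powr (1 / 4)"
  shows "\<theta> ^ (b div 4) * (U / \<gamma>) * sqrt (B * A)
    \<le> sqrt 2 * (U / (\<gamma>\<^sup>2 * \<rho>\<^sup>2)) * U / (\<rho> * sqrt (1 - \<rho>\<^sup>2)) * A * sqrt B * \<rho> ^ b"
proof -
  have "\<gamma>\<^sup>2 < U\<^sup>2" using g by (intro power_strict_mono) auto
  then have th: "0 < \<theta>" "\<theta> < 1" using g by (auto simp: \<theta>_def add_pos_pos)
  have r0: "0 < \<rho>" using th by (simp add: \<rho>_def)
  have r4: "\<rho> ^ 4 = \<theta>" using th by (simp add: \<rho>_def powr_power)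
  have r1: "\<rho> < 1"
  proof (rule ccontr)
    assume "\<not> \<rho> < 1"
    then have "1 \<le> \<rho> ^ 4" by (intro one_le_power) simp
    then show False using r4 th by simp
  qed
  have s: "0 < sqrt (1 - \<rho>\<^sup>2)"
  proof -
    have "\<rho>\<^sup>2 < 1" using r0 r1 by (simp add: abs_square_less_1)
    then show ?thesis by (intro real_sqrt_gt_zero) linarith
  qed
  define Y where "Y = (\<rho> ^ b / \<rho> ^ 3) * (U / \<gamma>) * (A * sqrt B)"
  have Y0: "0 \<le> Y" using r0 g AB by (simp add: Y_def)
  have "b \<le> 4 * (b div 4) + 3" by presburger
  then have "\<rho> ^ (4 * (b div 4) + 3) \<le> \<rho> ^ b" using r0 r1 by (intro power_decreasing) auto
  then have "\<theta> ^ (b div 4) * \<rho> ^ 3 \<le> \<rho> ^ b" by (simp add: power_add power_mult r4)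
  then have t: "\<theta> ^ (b div 4) \<le> \<rho> ^ b / \<rho> ^ 3" using r0 by (simp add: le_divide_eq)
  have "sqrt A \<le> A" using AB by (intro real_le_lsqrt) (auto simp: power2_eq_square)
  then have "sqrt (B * A) \<le> A * sqrt B"
    using AB by (simp add: real_sqrt_mult mult.commute[of A] mult_left_mono)
  then have "\<theta> ^ (b div 4) * (U / \<gamma>) * sqrt (B * A) \<le> Y"
    unfolding Y_def using t th r0 g AB by (intro mult_mono mult_nonneg_nonneg) auto
  also have "1 * Y \<le> (sqrt 2 / sqrt (1 - \<rho>\<^sup>2) * (U / \<gamma>)) * Y"
  proof (intro mult_right_mono Y0)
    have "sqrt (1 - \<rho>\<^sup>2) \<le> sqrt 2" by (rule real_sqrt_le_mono) (use zero_le_power2[of \<rho>] in linarith)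
    then have "1 \<le> sqrt 2 / sqrt (1 - \<rho>\<^sup>2)" by (simp only: pos_le_divide_eq[OF s] mult_1)
    moreover have "1 \<le> U / \<gamma>" using g by simp
    ultimately show "1 \<le> sqrt 2 / sqrt (1 - \<rho>\<^sup>2) * (U / \<gamma>)"
      using mult_mono[of 1 "sqrt 2 / sqrt (1 - \<rho>\<^sup>2)" 1 "U / \<gamma>"] by simp
  qed
  also have "\<dots> = sqrt 2 * (U / (\<gamma>\<^sup>2 * \<rho>\<^sup>2)) * U / (\<rho> * sqrt (1 - \<rho>\<^sup>2)) * A * sqrt B * \<rho> ^ b"
    by (simp add: Y_def power2_eq_square power3_eq_cube mult_ac)
  finally show ?thesis by simp
qed

section \<open>Convergence\<close>

lemma mat_mult_vec: "mat k *v v = k *\<^sub>R v" for v :: "real ^ 'n::finite"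
  by (simp add: vec_eq_iff mat_def matrix_vector_mult_def if_distrib[of "\<lambda>a. a * _"] cong: if_cong)

lemma graph_nlp_exists:
  fixes f :: "'v::finite \<Rightarrow> real ^ 'p::finite \<Rightarrow> real" and c :: "real ^ 'p \<Rightarrow> real ^ 'd::finite"
  assumes "open U" and smooth: "\<And>i. Ck_on 3 U (f i)" "\<And>i. Ck_on 3 U (\<lambda>y. subvec dn {i} (c y))"
    and "sym E"
    and "\<And>i. depends_only_on pn (closed_nbhd E 1 {i}) (f i)"
    and "\<And>i. depends_only_on pn (closed_nbhd E 1 {i}) (\<lambda>y. subvec dn {i} (c y))"
  obtains F' F'' c' c'' where "graph_nlp f c U F' F'' c' c'' E pn dn"
proof -
  have c: "(\<lambda>y. \<Sum>i\<in>UNIV. subvec dn {i} (c y)) = c"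
    by (simp add: fun_eq_iff vec_eq_iff)
  have 1: "\<exists>F' F''. C2_data U (\<lambda>y. \<Sum>i\<in>UNIV. f i y) F' F''"
    by (intro exI) (rule C2_data_sum[OF Ck_on_imp_C2_data[OF smooth(1)]])
  have "\<exists>c' c''. C2_data U (\<lambda>y. \<Sum>i\<in>UNIV. subvec dn {i} (c y)) c' c''"
    by (intro exI) (rule C2_data_sum[OF Ck_on_imp_C2_data[OF smooth(2)]])
  then have 2: "\<exists>c' c''. C2_data U c c' c''" by (simp only: c)
  from 1 2 show thesis using assms that
    unfolding graph_nlp_def smooth_nlp_def graph_nlp_axioms_def by blast
qed

theorem theorem4p4:
  fixes E :: "('v::{finite,linorder} \<times> 'v) set"
    and pn :: "'p::finite \<Rightarrow> 'v" and dn :: "'d::finite \<Rightarrow> 'v"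
    and f :: "'v \<Rightarrow> real ^ 'p \<Rightarrow> real" and c :: "real ^ 'p \<Rightarrow> real ^ 'd"
    and M b :: nat and V W :: "nat \<Rightarrow> 'v set"
    and \<mu> \<eta>1 \<eta>2 \<beta> \<kappa> \<gamma>H \<gamma>G \<Upsilon> :: real
    and pW pG :: "real poly"
    and X :: "(real ^ 'p) set" and \<Lambda> :: "(real ^ 'd) set"
    and Hh :: "nat \<Rightarrow> real ^ 'p ^ 'p"
    and x dx :: "nat \<Rightarrow> real ^ 'p" and lam dlam :: "nat \<Rightarrow> real ^ 'd"
    and \<omega> :: "nat \<Rightarrow> nat \<Rightarrow> real ^ 'p" and \<zeta> :: "nat \<Rightarrow> nat \<Rightarrow> real ^ 'd"
    and \<alpha> :: "nat \<Rightarrow> real"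
  \<comment> \<open>graph-structured problem\<close>
  assumes graph: "sym E"
    and f_local: "\<And>i. depends_only_on pn (closed_nbhd E 1 {i}) (f i)"
    and c_local: "\<And>i. depends_only_on pn (closed_nbhd E 1 {i}) (\<lambda>y. subvec dn {i} (c y))"
  \<comment> \<open>overlapping decomposition\<close>
    and V_disjoint: "disjoint_family_on V {1..M}"
    and V_cover: "(\<Union>l\<in>{1..M}. V l) = UNIV"
    and b_pos: "1 \<le> b"
    and W_overlap: "\<And>l. l \<in> {1..M} \<Longrightarrow> closed_nbhd E b (V l) \<subseteq> W l"
  \<comment> \<open>structure-preserving symmetric Hessian modification\<close>
    and Hh_sym: "\<And>t. transpose (Hh t) = Hh t"
    and Hh_struct: "\<And>t i j. gdist E i j > 2 \<Longrightarrow> submat pn pn {i} {j} (Hh t) = 0"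
  \<comment> \<open>FOGD method\<close>
    and mu_pos: "0 < \<mu>" and eta_pos: "0 < \<eta>1" "0 < \<eta>2"
    and beta: "0 < \<beta>" "\<beta> < 1 / 2" and kappa: "0 < \<kappa>" "\<kappa> < 1"
    and subproblems: "\<And>t l. l \<in> {1..M} \<Longrightarrow>
        sub_solution E pn dn \<mu> (W l) (Hh t) (con_jac c (x t))
          (grad_x_Lagr f c (x t) (lam t)) (c (x t)) (\<omega> t l) (\<zeta> t l)"
    and compose_x: "\<And>t l k. l \<in> {1..M} \<Longrightarrow> pn k \<in> V l \<Longrightarrow> dx t $ k = \<omega> t l $ k"
    and compose_lam: "\<And>t l k. l \<in> {1..M} \<Longrightarrow> dn k \<in> V l \<Longrightarrow> dlam t $ k = \<zeta> t l $ k"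
    and stepsize: "\<And>t. \<alpha> t =
        backtrack (aug_Lagr f c \<eta>1 \<eta>2) \<beta> \<kappa> (x t, lam t) (dx t, dlam t)"
    and update: "\<And>t. (x (Suc t), lam (Suc t)) = (x t, lam t) + \<alpha> t *\<^sub>R (dx t, dlam t)"
  \<comment> \<open>assumption A1\<close>
    and gH: "0 < \<gamma>H" "\<gamma>H \<le> 1"
    and A1: "\<And>t w. con_jac c (x t) *v w = 0 \<Longrightarrow> w \<bullet> (Hh t *v w) \<ge> \<gamma>H * (norm w)\<^sup>2"
  \<comment> \<open>assumption A2\<close>
    and gG: "0 < \<gamma>G" "\<gamma>G \<le> 1"
    and A2: "\<And>t v. 0 \<le> v \<bullet> ((con_jac c (x t) ** transpose (con_jac c (x t)) - mat \<gamma>G) *v v)"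
  \<comment> \<open>assumption A3\<close>
    and Ups: "1 \<le> \<Upsilon>"
    and A3: "\<And>t i j. Max {block_norm pn pn i j (Hh t),
        block_norm pn pn i j (Lagr_hess f c (x t) (lam t)),
        block_norm dn pn i j (con_jac c (x t))} \<le> \<Upsilon>"
  \<comment> \<open>assumption A4\<close>
    and A4: "polynomial_growth E b M W pW pG"
  \<comment> \<open>assumption A5\<close>
    and compact: "compact X" "compact \<Lambda>"
    and in_compact: "\<And>t a. 0 \<le> a \<Longrightarrow> a \<le> 1 \<Longrightarrow>
        (x t + a *\<^sub>R dx t, lam t + a *\<^sub>R dlam t) \<in> X \<times> \<Lambda>"
    and smooth: "\<exists>U. open U \<and> X \<subseteq> U \<and>
        (\<forall>i. Ck_on 3 U (f i) \<and> Ck_on 3 U (\<lambda>y. subvec dn {i} (c y)))"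
    and H_bound: "\<And>y l i j. y \<in> X \<Longrightarrow> l \<in> \<Lambda> \<Longrightarrow>
        block_norm pn pn i j (Lagr_hess f c y l) \<le> \<Upsilon>"
    and G_bound: "\<And>y i j. y \<in> X \<Longrightarrow> block_norm dn pn i j (con_jac c y) \<le> \<Upsilon>"
  \<comment> \<open>choice of the parameters\<close>
    and mu_ge: "\<mu> \<ge> mu_hat \<gamma>H \<gamma>G \<Upsilon> pG"
    and eta1_ge: "\<eta>1 \<ge> 9 / (\<eta>2 * \<gamma>G)"
    and eta2_le: "\<eta>2 \<le> \<gamma>H / (7 * (Ups_hat \<Upsilon> pG)\<^sup>2)"
    and delta_le: "delta_mu_b \<mu> b \<gamma>H \<gamma>G \<Upsilon> pW pG
        \<le> \<eta>2 * \<gamma>G / (17 * \<eta>1 * (Ups_hat \<Upsilon> pG)\<^sup>2)"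
  shows "(\<lambda>t. norm (grad (\<lambda>(y, l). Lagr f c y l) (x t, lam t))) \<longlonglongrightarrow> 0"
proof -
  define N where "N = Ups_hat \<Upsilon> pG"
  define \<gamma> where "\<gamma> = gam_K \<mu> \<gamma>H \<gamma>G \<Upsilon> pG"
  define UK where "UK = Ups_K \<mu> \<Upsilon> pG"
  define \<delta> where "\<delta> = delta_mu_b \<mu> b \<gamma>H \<gamma>G \<Upsilon> pW pG"
  define g where "g = (\<lambda>t. grad_x_Lagr f c (x t) (lam t))"
  obtain U where U: "open U" "X \<subseteq> U" "\<And>i. Ck_on 3 U (f i)" "\<And>i. Ck_on 3 U (\<lambda>y. subvec dn {i} (c y))"
    using smooth by blast
  obtain F' F'' c' c'' where nlp: "graph_nlp f c U F' F'' c' c'' E pn dn"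
    by (rule graph_nlp_exists[OF U(1,3,4) graph f_local c_local])
  interpret graph_nlp f c U F' F'' c' c'' E pn dn by (rule nlp)
  have xX: "x t \<in> X" "lam t \<in> \<Lambda>" for t using in_compact[of 0 t] by auto
  then have xU: "x t \<in> U" for t using U(2) by blast
  have ball: "real (card {j. gdist E i j \<le> enat n}) \<le> poly pG (real n)" for i n
    by (rule polynomial_growth_ball[OF A4])
  have ball_ge: "1 \<le> poly pG (real n)" for n
  proof -
    have "{undefined} \<subseteq> {j. gdist E undefined j \<le> enat n}" using gdist_self by auto
    then have "card {undefined :: 'v} \<le> card {j. gdist E undefined j \<le> enat n}" by (intro card_mono) auto
    then show ?thesis using ball[of undefined n] by simp
  qed
  define D where "D = poly pG 1"
  have D1: "1 \<le> D" using ball_ge[of 1] by (simp add: D_def)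
  have ball1: "real (card {j. gdist E i j \<le> enat 1}) \<le> D" for i using ball[of i 1] by (simp add: D_def)
  have N_eq: "N = \<Upsilon> * D\<^sup>2" by (simp add: N_def Ups_hat_def D_def)
  have D2: "D \<le> D\<^sup>2" "1 \<le> D\<^sup>2" using D1 by (auto simp: power2_eq_square intro: order_trans[OF _ mult_mono[of 1 D 1 D]])
  have N1: "1 \<le> N" using mult_mono[of 1 \<Upsilon> 1 "D\<^sup>2"] Ups D2 by (simp add: N_eq)
  have blocks: "block_norm pn pn i j (Hh t) \<le> \<Upsilon>"
    "block_norm pn pn i j (Lagr_hess f c (x t) (lam t)) \<le> \<Upsilon>"
    "block_norm dn pn i j (con_jac c (x t)) \<le> \<Upsilon>" for i j t
    using A3[of i j t] by simp_all
  have Hh_band: "banded E 2 pn pn (Hh t)" for t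
    unfolding banded_def
  proof (intro allI impI, rule ccontr)
    fix k l assume nz: "Hh t $ k $ l \<noteq> 0" and "\<not> gdist E (pn k) (pn l) \<le> enat 2"
    then have "submat pn pn {pn k} {pn l} (Hh t) = 0"
      by (intro Hh_struct) (simp add: numeral_eq_enat)
    then have "submat pn pn {pn k} {pn l} (Hh t) $ k $ l = 0" by simp
    then show False using nz by (simp add: submat_def)
  qed
  have H_le: "norm (Hh t *v v) \<le> N * norm v" for t v
    unfolding N_eq using Ups by (intro banded_norm_bound[OF graph Hh_band card_ball_two[OF ball1] blocks(1)]) auto
  have Hl_le: "norm (Lagr_hess f c (x t) (lam t) *v v) \<le> N * norm v" for t v
    unfolding N_eq using Ups
    by (intro banded_norm_bound[OF graph banded_Lagr_hess[OF xU] card_ball_two[OF ball1] blocks(2)]) auto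
  have G_le: "norm (con_jac c (x t) *v v) \<le> N * norm v" for t v
  proof -
    have "norm (con_jac c (x t) *v v) \<le> \<Upsilon> * D * norm v"
      using Ups by (intro banded_norm_bound[OF graph banded_con_jac[OF xU] ball1 blocks(3)]) auto
    also have "\<dots> \<le> N * norm v"
      unfolding N_eq using Ups D2 by (intro mult_right_mono mult_left_mono) auto
    finally show ?thesis .
  qed
  have A2': "\<gamma>G * (norm v)\<^sup>2 \<le> (norm (transpose (con_jac c (x t)) *v v))\<^sup>2" for t v
  proof -
    have "v \<bullet> ((con_jac c (x t) ** transpose (con_jac c (x t)) - mat \<gamma>G) *v v)
        = v \<bullet> (con_jac c (x t) *v (transpose (con_jac c (x t)) *v v)) - \<gamma>G * (v \<bullet> v)"
      by (simp only: matrix_vector_mult_diff_rdistrib matrix_vector_mul_assoc[symmetric] mat_mult_vec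
          inner_diff_right inner_scaleR_right)
    also have "v \<bullet> (con_jac c (x t) *v (transpose (con_jac c (x t)) *v v))
        = (norm (transpose (con_jac c (x t)) *v v))\<^sup>2"
      by (simp only: transpose_inner[symmetric] power2_norm_eq_inner)
    finally show ?thesis using A2[of v t] by (simp add: power2_norm_eq_inner)
  qed
  have kkt: "banded_kkt E pn dn (Hh t) (con_jac c (x t)) N \<gamma>H \<gamma>G \<mu>" for t
    using graph Hh_sym Hh_band banded_con_jac[OF xU] H_le G_le N1 gH gG A1 A2' mu_ge
    by unfold_locales (auto simp: mu_hat_def N_def)
  have "banded_kkt.UK N \<mu> = 1.5 * \<mu> * N\<^sup>2" by (rule banded_kkt.UK_def[OF kkt])
  then have UK_eq: "banded_kkt.UK N \<mu> = UK" by (simp only: UK_def Ups_K_def N_def)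
  have UK6: "6 \<le> UK" using banded_kkt.UK_bounds(3)[OF kkt] by (simp add: UK_eq)
  \<comment> \<open>\<open>gam_K\<close> lies below the constant of \<open>norm_sub_kkt_ge\<close>,
    and the decay estimate accepts any smaller positive lower bound.\<close>
  have gam_le: "\<gamma> \<le> \<gamma>H * \<gamma>G\<^sup>2 / (17 * UK\<^sup>2)"
  proof -
    have "\<gamma>H ^ 3 * \<gamma>G\<^sup>2 \<le> \<gamma>H * \<gamma>G\<^sup>2"
      using gH power_decreasing[of 1 3 \<gamma>H] by (intro mult_right_mono) auto
    moreover have "17 * UK\<^sup>2 \<le> 75 * UK ^ 6"
      using UK6 by (intro mult_mono power_increasing) auto
    ultimately show ?thesis
      unfolding \<gamma>_def gam_K_def UK_def[symmetric] using UK6 gH gG by (intro frac_le) auto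
  qed
  have gam0: "0 < \<gamma>"
    unfolding \<gamma>_def gam_K_def UK_def[symmetric] using UK6 gH gG by (intro divide_pos_pos mult_pos_pos) auto
  have gamU: "\<gamma> < UK"
    using gam_le banded_kkt.lower_constant_le_one[OF kkt] UK6 unfolding UK_eq by linarith
  \<comment> \<open>Empty parts own no coordinates of the composed direction, but could be
    arbitrarily many, so they are dropped before overlaps are counted.\<close>
  define L where "L = {l \<in> {1..M}. V l \<noteq> {}}"
  have L: "finite L" "L \<subseteq> {1..M}" "\<And>l. l \<in> L \<Longrightarrow> l \<in> {1..M}" "\<And>l. l \<in> L \<Longrightarrow> V l \<noteq> {}"
    by (auto simp: L_def)
  have "(\<Union>l\<in>L. V l) = (\<Union>l\<in>{1..M}. V l)" by (auto simp: L_def)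
  then have L_cover: "(\<Union>l\<in>L. V l) = UNIV" by (simp only: V_cover)
  have L_disj: "disjoint_family_on V L" using V_disjoint L(2) by (meson disjoint_family_on_mono)
  have VW: "V l \<subseteq> W l" if "l \<in> {1..M}" for l
    using W_overlap[OF that] subset_closed_nbhd[of "V l" E b] by blast
  have GW1: "1 \<le> poly pG (poly pW (real b))"
  proof -
    obtain l i where l: "l \<in> {1..M}" "i \<in> V l" using V_cover by blast
    then have i: "i \<in> W l" using VW by blast
    then have "{i} \<subseteq> {j. ereal_of_enat (gdist E i j) \<le> ereal (poly pW (real b))}"
      using A4 l(1) unfolding polynomial_growth_def by blast
    then have "card {i} \<le> card {j. ereal_of_enat (gdist E i j) \<le> ereal (poly pW (real b))}"
      by (intro card_mono) auto
    moreover have "real (card {j. ereal_of_enat (gdist E i j) \<le> ereal (poly pW (real b))}) \<le> poly pG (poly pW (real b))"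
      using A4 by (simp add: polynomial_growth_def)
    ultimately show ?thesis by simp
  qed
  define m where "m = poly pG (real (b + 2)) * poly pG (poly pW (real b))"
  have count: "real (card {l \<in> L. i \<in> closed_nbhd E 2 (W l)}) \<le> m" for i
    unfolding m_def by (rule overlap_count[OF A4 V_disjoint VW L(4,2)])
  have "\<forall>t. \<exists>p. Hh t *v fst p + transpose (con_jac c (x t)) *v snd p = - g t
      \<and> con_jac c (x t) *v fst p = - c (x t)"
    using banded_kkt.exact_direction_exists[OF kkt] by (metis fst_conv snd_conv)
  then obtain p where p: "\<And>t. Hh t *v fst (p t) + transpose (con_jac c (x t)) *v snd (p t) = - g t"
    "\<And>t. con_jac c (x t) *v fst (p t) = - c (x t)" by metis
  have err: "norm ((dx t, dlam t) - (fst (p t), snd (p t))) \<le> \<delta> * norm (fst (p t), snd (p t))" for t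
  proof -
    have "norm ((dx t, dlam t) - (fst (p t), snd (p t)))
        \<le> ((UK\<^sup>2 - \<gamma>\<^sup>2) / (UK\<^sup>2 + \<gamma>\<^sup>2)) ^ (b div 4) * (UK / \<gamma>) * sqrt m * norm (fst (p t), snd (p t))"
      unfolding UK_eq[symmetric]
    proof (rule banded_kkt.composed_direction_error[OF kkt p L(1) L_disj L_cover b_pos _ _ _ _ _ gam0
          gam_le[folded UK_eq], where W = W and w = "\<omega> t" and z = "\<zeta> t"])
      fix l assume l: "l \<in> L"
      note st = sub_solution_stationary[OF Hh_sym subproblems[OF L(3)[OF l], of t]]
      show "closed_nbhd E b (V l) \<subseteq> W l" by (rule W_overlap[OF L(3)[OF l]])
      show "supported pn (W l) (\<omega> t l)" "supported dn (W l - W_tilde E (W l)) (\<zeta> t l)"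
        by (rule st)+
      show "subvec pn (W l) (Hh t *v \<omega> t l + g t + \<mu> *\<^sub>R (transpose (con_jac c (x t))
          *v subvec dn (W_hat E (W l)) (c (x t) + con_jac c (x t) *v \<omega> t l))
          + transpose (con_jac c (x t)) *v \<zeta> t l) = 0"
        using st(3) by (simp only: g_def)
      show "subvec dn (W l - W_tilde E (W l)) (c (x t) + con_jac c (x t) *v \<omega> t l) = 0" by (rule st)
      show "dx t $ k = \<omega> t l $ k" if "pn k \<in> V l" for k by (rule compose_x[OF L(3)[OF l] that])
      show "dlam t $ k = \<zeta> t l $ k" if "dn k \<in> V l" for k by (rule compose_lam[OF L(3)[OF l] that])
    qed (rule count)
    also have "\<dots> \<le> \<delta> * norm (fst (p t), snd (p t))"
    proof (rule mult_right_mono)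
      show "((UK\<^sup>2 - \<gamma>\<^sup>2) / (UK\<^sup>2 + \<gamma>\<^sup>2)) ^ (b div 4) * (UK / \<gamma>) * sqrt m \<le> \<delta>"
        using decay_factor_le_delta[OF gam0 gamU GW1 ball_ge[of "b + 2"], of b]
        unfolding m_def \<delta>_def delta_mu_b_def Ups_mu_b_def Ups_mu_def rho_mu_def
          \<gamma>_def[symmetric] UK_def[symmetric] .
    qed simp
    finally show ?thesis .
  qed
  define k where "k = \<eta>2 * \<gamma>G / 16"
  \<comment> \<open>Convergence is measured by the exact direction: it bounds the gradient, and by
    \<open>err\<close> the computed direction vanishes with it.\<close>
  define n where "n = (\<lambda>t. norm (fst (p t), snd (p t)))"
  have descent: "grad (aug_Lagr f c \<eta>1 \<eta>2) (x t, lam t) \<bullet> (dx t, dlam t) \<le> - k * (n t)\<^sup>2" for t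
    using banded_kkt.inexact_newton_descent[OF kkt p Hl_le[of t] eta_pos(2) eta2_le[folded N_def] eta1_ge
        delta_le[folded N_def \<delta>_def] err]
    by (simp add: grad_aug_Lagr_eq[OF xU] aug_grad_def Let_def g_def grad_x_Lagr_eq[OF xU] k_def n_def)
  have n_lim: "n \<longlonglongrightarrow> 0"
  proof (rule backtracking_convergence[where \<phi> = "aug_Lagr f c \<eta>1 \<eta>2" and K = "X \<times> \<Lambda>"
        and z = "\<lambda>t. (x t, lam t)" and d = "\<lambda>t. (dx t, dlam t)" and \<beta> = \<beta> and \<kappa> = \<kappa> and k = k])
    show "compact (X \<times> \<Lambda>)" by (intro compact_Times compact)
    show "aug_Lagr f c \<eta>1 \<eta>2 differentiable at z" if "z \<in> X \<times> \<Lambda>" for z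
    proof -
      have "fst z \<in> U" using that U(2) by auto
      from aug_Lagr_has_derivative[OF this, of \<eta>1 \<eta>2 "snd z"] show ?thesis
        unfolding prod.collapse by (rule differentiableI)
    qed
    show "continuous_on (X \<times> \<Lambda>) (grad (aug_Lagr f c \<eta>1 \<eta>2))"
      by (rule continuous_on_subset[OF continuous_grad_aug_Lagr]) (use U(2) in auto)
    show "(x t, lam t) + a *\<^sub>R (dx t, dlam t) \<in> X \<times> \<Lambda>" if "0 \<le> a" "a \<le> 1" for t a
      using in_compact[OF that] by simp
    show "(x (Suc t), lam (Suc t)) = (x t, lam t)
        + backtrack (aug_Lagr f c \<eta>1 \<eta>2) \<beta> \<kappa> (x t, lam t) (dx t, dlam t) *\<^sub>R (dx t, dlam t)" for t
      unfolding update stepsize ..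
    show "0 < k" using eta_pos gG by (simp add: k_def)
    show "(dx t, dlam t) = 0" if "n t = 0" for t
    proof -
      have "norm ((dx t, dlam t) - (fst (p t), snd (p t))) \<le> 0" using err[of t] that by (simp add: n_def)
      moreover have "(fst (p t), snd (p t)) = 0" using that unfolding n_def norm_eq_zero .
      ultimately show ?thesis by (metis diff_zero norm_le_zero_iff)
    qed
  qed (use beta kappa descent in \<open>auto simp: n_def\<close>)
  have bound: "norm (grad (\<lambda>(y, l). Lagr f c y l) (x t, lam t)) \<le> 3 * N * n t" for t
  proof -
    have "norm (grad (\<lambda>(y, l). Lagr f c y l) (x t, lam t)) = norm (g t, c (x t))"
      by (simp add: grad_Lagr_eq[OF xU] g_def grad_x_Lagr_eq[OF xU])
    also have "\<dots> \<le> norm (g t) + norm (c (x t))" by (rule norm_Pair_le)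
    also have "\<dots> \<le> 2 * N * n t + N * n t"
      unfolding n_def by (intro add_mono banded_kkt.newton_direction_bounds[OF kkt p])
    finally show ?thesis by simp
  qed
  have "(\<lambda>t. 3 * N * n t) \<longlonglongrightarrow> 0" using tendsto_mult_right_zero[OF n_lim] by simp
  then show ?thesis
    by (rule Lim_null_comparison[rotated]) (simp add: bound)
qed

end
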